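(* Let $0<\alpha<1$, $1<p<\infty$, let $w$ be a weight in the one-sided class $A_p^+$, and let $f\in L^p(w)=L^p(\mathbb{R},w(x)\,dx)$. Then the function $$U(x,t):=\frac{t^{2\alpha}}{4^\alpha\Gamma(\alpha)}\int_0^\infty e^{-t^2/(4s)}f(x+s)\,\frac{ds}{s^{1+\alpha}},\qquad x\in\mathbb{R},\ t>0,$$ is a classical solution to the extension problem $$\begin{cases}-D_{\rm right}U+\frac{1-2\alpha}{t}\,U_t+U_{tt}=0,&\text{in }\mathbb{R}\times(0,\infty),\\ \lim_{t\to0^+}U(x,t)=f(x),&\text{for a.e. }x\text{ and in }L^p(w),\end{cases}$$ where $D_{\rm right}$ acts in the variable $x$. Moreover, for $c_\alpha:=\frac{4^{\alpha-1/2}\Gamma(\alpha)}{\Gamma(1-\alpha)}>0$, $$-c_\alpha\lim_{t\to0^+}t^{1-2\alpha}U_t(x,t)=(D_{\rm right})^\alpha f(x)\quad\text{in the distributional sense.}$$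
   Context: The derivative from the right is $D_{\rm right}u(x)=\lim_{h\to0^+}\frac{u(x)-u(x+h)}{h}$ (so $D_{\rm right}u=-u'$ for differentiable $u$). A weight is a measurable function $w$ on $\mathbb{R}$ with $0<w<\infty$. For $1<p<\infty$, $w\in A_p^+$ means that there is $C>0$ such that $$\Big(\frac1h\int_{a-h}^a w\Big)^{1/p}\Big(\frac1h\int_a^{a+h}w^{1-p'}\Big)^{1/p'}\le C\quad\text{for all }a\in\mathbb{R},\ h>0,$$ where $1/p+1/p'=1$. For $\varphi$ in the Schwartz class $\mathcal{S}=\mathcal{S}(\mathbb{R})$, $(D_{\rm left})^\alpha\varphi(x)=\frac{1}{\Gamma(-\alpha)}\int_0^\infty\frac{\varphi(x-s)-\varphi(x)}{s^{1+\alpha}}\,ds$. The object $(D_{\rm right})^\alpha f$ is the tempered distribution defined by duality: $\langle(D_{\rm right})^\alpha f,\varphi\rangle=\langle f,(D_{\rm left})^\alpha\varphi\rangle=\int_{\mathbb{R}}f(x)\,(D_{\rm left})^\alpha\varphi(x)\,dx$ for every $\varphi\in\mathcal{S}$. The last limit in the distributional sense means that for every $\varphi\in\mathcal{S}$, $$-c_\alpha\lim_{t\to0^+}\int_{\mathbb{R}}t^{1-2\alpha}U_t(x,t)\varphi(x)\,dx=\langle(D_{\rm right})^\alpha f,\varphi\rangle.$$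
   Formalization: The last limit is claimed for all Schwartz φ only when the duality integral of f against (D_left)^α φ converges for every φ in S (it can diverge, e.g. w=e^x, f=e^{-x/(2p)} on x<0); without this it is claimed for Schwartz φ vanishing near -∞. Functions are real-valued. *)

theory Defs
  imports "HOL-Analysis.Analysis"
begin

text \<open>
  Functions on the line are real-valued, and "measurable" means Lebesgue measurable; for this reason
  integrals are taken with respect to \<^const>\<open>lebesgue\<close>, not \<^const>\<open>lborel\<close>.
\<close>

section \<open>Weights and one-sided Muckenhoupt classes\<close>

definition weight :: "(real \<Rightarrow> real) \<Rightarrow> bool" where
  "weight w \<longleftrightarrow> w \<in> borel_measurable lebesgue \<and> (\<forall>x. 0 < w x)"

definition conj_exponent :: "real \<Rightarrow> real" where
  "conj_exponent p = p / (p - 1)"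

text \<open>Powers on $[0,\infty]$, meant for exponents $r > 0$ only.\<close>

definition ennreal_powr :: "ennreal \<Rightarrow> real \<Rightarrow> ennreal" where
  "ennreal_powr x r = (if x = \<infinity> then \<infinity> else ennreal (enn2real x powr r))"

text \<open>
  The integrals in the $A_p^+$ condition are $[0,\infty]$-valued. The Bochner integral would assign the
  value 0 to a non-integrable function and thereby admit weights for which the condition fails.
\<close>

definition Ap_plus :: "real \<Rightarrow> (real \<Rightarrow> real) \<Rightarrow> bool" where
  "Ap_plus p w \<longleftrightarrow> weight w \<and>
     (\<exists>C::real. C > 0 \<and> (\<forall>a::real. \<forall>h::real. h > 0 \<longrightarrow>
        ennreal_powr (ennreal (1 / h) * (\<integral>\<^sup>+ x \<in> {a - h..a}. ennreal (w x) \<partial>lebesgue)) (1 / p) *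
        ennreal_powr (ennreal (1 / h) *
            (\<integral>\<^sup>+ x \<in> {a..a + h}. ennreal (w x powr (1 - conj_exponent p)) \<partial>lebesgue))
          (1 / conj_exponent p)
        \<le> ennreal C))"

definition Lp_weighted :: "real \<Rightarrow> (real \<Rightarrow> real) \<Rightarrow> (real \<Rightarrow> real) set" where
  "Lp_weighted p w =
     {f. f \<in> borel_measurable lebesgue \<and> integrable lebesgue (\<lambda>x. \<bar>f x\<bar> powr p * w x)}"

definition Lp_weighted_norm :: "real \<Rightarrow> (real \<Rightarrow> real) \<Rightarrow> (real \<Rightarrow> real) \<Rightarrow> real" where
  "Lp_weighted_norm p w f = (LINT x|lebesgue. \<bar>f x\<bar> powr p * w x) powr (1 / p)"

section \<open>The extension problem\<close>

definition has_D_right :: "(real \<Rightarrow> real) \<Rightarrow> real \<Rightarrow> real \<Rightarrow> bool" where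
  "has_D_right u D x \<longleftrightarrow> ((\<lambda>h. (u x - u (x + h)) / h) \<longlongrightarrow> D) (at_right 0)"

definition extension_integrand :: "real \<Rightarrow> (real \<Rightarrow> real) \<Rightarrow> real \<Rightarrow> real \<Rightarrow> real \<Rightarrow> real" where
  "extension_integrand \<alpha> f x t s = exp (- (t\<^sup>2 / (4 * s))) * f (x + s) / s powr (1 + \<alpha>)"

definition extension :: "real \<Rightarrow> (real \<Rightarrow> real) \<Rightarrow> real \<Rightarrow> real \<Rightarrow> real" where
  "extension \<alpha> f x t =
     t powr (2 * \<alpha>) / (4 powr \<alpha> * Gamma \<alpha>) * (LINT s:{0<..}|lebesgue. extension_integrand \<alpha> f x t s)"

text \<open>
  Classical solution: all derivatives in the equation exist and are (jointly) continuous in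
  $\mathbb{R}\times(0,\infty)$, and the equation holds at every point.
\<close>

definition classical_solution :: "real \<Rightarrow> (real \<Rightarrow> real \<Rightarrow> real) \<Rightarrow> bool" where
  "classical_solution \<alpha> U \<longleftrightarrow>
     (\<exists>DU Ut Utt :: real \<Rightarrow> real \<Rightarrow> real.
        (\<forall>G \<in> {U, DU, Ut, Utt}. continuous_on (UNIV \<times> {0<..}) (\<lambda>(x, t). G x t)) \<and>
        (\<forall>x t. t > 0 \<longrightarrow>
           has_D_right (\<lambda>y. U y t) (DU x t) x \<and>
           ((\<lambda>\<tau>. U x \<tau>) has_real_derivative Ut x t) (at t) \<and>
           ((\<lambda>\<tau>. Ut x \<tau>) has_real_derivative Utt x t) (at t) \<and>
           - DU x t + (1 - 2 * \<alpha>) / t * Ut x t + Utt x t = 0))"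

section \<open>Fractional derivatives and the distributional limit\<close>

definition schwartz :: "(real \<Rightarrow> real) set" where
  "schwartz = {\<phi>. (\<forall>n x. (deriv ^^ n) \<phi> differentiable (at x)) \<and>
                  (\<forall>m n. bounded (range (\<lambda>x. x ^ m * (deriv ^^ n) \<phi> x)))}"

definition frac_D_left :: "real \<Rightarrow> (real \<Rightarrow> real) \<Rightarrow> real \<Rightarrow> real" where
  "frac_D_left \<alpha> \<phi> x =
     1 / Gamma (- \<alpha>) * (LINT s:{0<..}|lebesgue. (\<phi> (x - s) - \<phi> x) / s powr (1 + \<alpha>))"

text \<open>
  $(D_{\rm right})^\alpha f$ as a functional on test functions. The duality formula defines it on a class
  of test functions only if the integral converges for each of them.
\<close>

definition frac_D_right :: "real \<Rightarrow> (real \<Rightarrow> real) \<Rightarrow> (real \<Rightarrow> real) \<Rightarrow> real" where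
  "frac_D_right \<alpha> f \<phi> = (LINT x|lebesgue. f x * frac_D_left \<alpha> \<phi> x)"

definition frac_D_right_defined_on :: "(real \<Rightarrow> real) set \<Rightarrow> real \<Rightarrow> (real \<Rightarrow> real) \<Rightarrow> bool" where
  "frac_D_right_defined_on T \<alpha> f \<longleftrightarrow>
     (\<forall>\<phi> \<in> T. integrable lebesgue (\<lambda>x. f x * frac_D_left \<alpha> \<phi> x))"

text \<open>
  For $w \in A_p^+$ and $f \in L^p(w)$ the duality formula need not converge on the whole Schwartz class,
  since $f$ may grow too fast at $-\infty$: take $w(x) = e^x$, $f(x) = e^{-x/(2p)} 1_{x<0}$ and
  $\varphi(x) = e^{-\varepsilon\sqrt{1+x^2}}$ with $0 < \varepsilon < 1/(2p)$. It always converges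
  on the Schwartz functions that vanish near $-\infty$; these include all smooth functions of compact
  support.
\<close>

definition schwartz_left_bounded :: "(real \<Rightarrow> real) set" where
  "schwartz_left_bounded = {\<phi> \<in> schwartz. \<exists>A. \<forall>x<A. \<phi> x = 0}"

text \<open>The limit of $t^{1-2\alpha} U_t$, multiplied by $-c$, is $(D_{\rm right})^\alpha f$, tested against
  the class \<open>T\<close>. Convergence of all integrals involved is part of the assertion.\<close>

definition distributional_limit ::
    "(real \<Rightarrow> real) set \<Rightarrow> real \<Rightarrow> real \<Rightarrow> (real \<Rightarrow> real \<Rightarrow> real) \<Rightarrow> (real \<Rightarrow> real) \<Rightarrow> bool" where
  "distributional_limit T \<alpha> c U f \<longleftrightarrow>
     frac_D_right_defined_on T \<alpha> f \<and>
     (\<forall>\<phi> \<in> T.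
        (\<forall>t>0. integrable lebesgue (\<lambda>x. t powr (1 - 2 * \<alpha>) * deriv (\<lambda>\<tau>. U x \<tau>) t * \<phi> x)) \<and>
        ((\<lambda>t. - c * (LINT x|lebesgue. t powr (1 - 2 * \<alpha>) * deriv (\<lambda>\<tau>. U x \<tau>) t * \<phi> x))
           \<longlongrightarrow> frac_D_right \<alpha> f \<phi>) (at_right 0))"

definition c_const :: "real \<Rightarrow> real" where
  "c_const \<alpha> = 4 powr (\<alpha> - 1 / 2) * Gamma \<alpha> / Gamma (1 - \<alpha>)"

end

theory Submission
  imports Defs
begin

text \<open>
  The extension is a convolution with the kernels $e^{-t^2/(4s)} s^{-b}$, a family closed under
  differentiation in \<open>t\<close> and \<open>s\<close>; the $A_p^+$ condition and Hoelder's inequality give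
  $\int_x^{x+h} |f| \le K_x (1 + h)$, which is all that differentiation under the integral needs.
  An integration by parts writes $U(x,t)$ as a superposition of the right averages of \<open>f\<close> at \<open>x\<close>, whence the
  convergence almost everywhere; convergence in $L^p(w)$ follows from a uniform bound and truncation.
  The flux $t^{1-2\alpha} U_t$ is a convolution with a kernel of integral 0 dominated by
  $s^{-1-\alpha}$, so that, tested against $\varphi$, it converges by dominated convergence as soon as
  $\int |f(y)| \int_0^\infty |\varphi(y-s) - \varphi(y)| s^{-1-\alpha}\,ds\,dy$ is finite.
  If the duality formula makes sense on the whole Schwartz class, then \<open>f\<close> has polynomial growth
  on average at $-\infty$, since otherwise a sparse sum of translated Gaussians would violate it.
\<close>

section \<open>Integrals depending on a parameter\<close>

text \<open>The \<open>A_p^+\<close> condition compares the mass of \<open>w\<close> to the left of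
  a point with the mass of the dual weight to its right. It thus controls \<open>f\<close> to the
  right of each point, with nothing uniform as the point moves to -infinity. All majorants are
  therefore one-sided, and decay on the left has to come from the test functions.

  The flux kernel has integral 0 because it is, up to a factor, the s-derivative of
  \<open>e^{-t^2/(4s)} s^{-\<alpha>}\<close>, which vanishes at both ends of the half-line. This
  allows \<open>\<phi> (y - s)\<close> to be replaced by \<open>\<phi> (y - s) - \<phi> y\<close>,
  and the increment tames the singularity of the kernel at \<open>s = 0\<close> uniformly in
  \<open>t\<close>.

  Tonelli's theorem is applied to products of Borel measures. Hence \<open>f\<close> and
  \<open>w\<close> are first replaced by Borel versions; the integral over \<open>s\<close> does not
  see the change, so the extension is the same at every point.\<close>

lemma tendsto_integral_dominated:
  fixes F :: "'a::metric_space \<Rightarrow> 'b \<Rightarrow> real"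
  assumes meas: "\<And>x. F x \<in> borel_measurable M" "L \<in> borel_measurable M"
    and g: "integrable M g"
    and bound: "\<forall>\<^sub>F x in at a within S. AE y in M. \<bar>F x y\<bar> \<le> g y"
    and lim: "AE y in M. ((\<lambda>x. F x y) \<longlongrightarrow> L y) (at a within S)"
  shows "((\<lambda>x. LINT y|M. F x y) \<longlongrightarrow> (LINT y|M. L y)) (at a within S)"
  unfolding tendsto_at_iff_sequentially o_def
proof (intro allI impI)
  fix X assume X: "\<forall>i. X i \<in> S - {a}" "X \<longlonglongrightarrow> a"
  have flim: "filterlim X (at a within S) sequentially"
    using X by (auto simp: filterlim_at)
  then obtain N where N: "\<And>n. N \<le> n \<Longrightarrow> AE y in M. \<bar>F (X n) y\<bar> \<le> g y"
    using bound unfolding filterlim_iff eventually_sequentially by blast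
  show "(\<lambda>n. LINT y|M. F (X n) y) \<longlonglongrightarrow> (LINT y|M. L y)"
  proof (rule LIMSEQ_offset[where k = N], rule integral_dominated_convergence[where w = g])
    show "AE y in M. (\<lambda>n. F (X (n + N)) y) \<longlonglongrightarrow> L y"
      using lim
    proof eventually_elim
      case (elim y)
      from filterlim_compose[OF elim flim] show ?case by (rule LIMSEQ_ignore_initial_segment)
    qed
    show "AE y in M. norm (F (X (n + N)) y) \<le> g y" for n
      using N[of "n + N"] by simp
  qed (use meas g in auto)
qed

text \<open>The mean value inequality on the convex set \<open>S\<close> turns the bound on
  \<open>F'\<close> into the same bound for the difference quotients, to which dominated convergence
  applies. A majorant on a neighbourhood of \<open>x\<close> is enough.\<close>

lemma has_real_derivative_integral_dominated:
  fixes F F' :: "real \<Rightarrow> 'b \<Rightarrow> real"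
  assumes S: "open S" "convex S" "x \<in> S"
    and meas: "\<And>x. F x \<in> borel_measurable M" "F' x \<in> borel_measurable M"
    and int: "\<And>u. u \<in> S \<Longrightarrow> integrable M (F u)"
    and g: "integrable M g"
    and deriv: "\<And>u y. u \<in> S \<Longrightarrow> ((\<lambda>u. F u y) has_real_derivative F' u y) (at u)"
    and bound: "\<And>u y. u \<in> S \<Longrightarrow> \<bar>F' u y\<bar> \<le> g y"
  shows "((\<lambda>u. LINT y|M. F u y) has_real_derivative (LINT y|M. F' x y)) (at x)"
proof -
  have ev: "\<forall>\<^sub>F u in at x. u \<in> S"
    using S(1,3) by (rule eventually_at_in_open')
  have "((\<lambda>u. LINT y|M. (F u y - F x y) / (u - x)) \<longlongrightarrow> (LINT y|M. F' x y)) (at x)"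
  proof (rule tendsto_integral_dominated[where g = g])
    show "\<forall>\<^sub>F u in at x. AE y in M. \<bar>(F u y - F x y) / (u - x)\<bar> \<le> g y"
      using ev eventually_neq_at_within[of x x UNIV]
    proof eventually_elim
      case (elim u)
      have "\<bar>F u y - F x y\<bar> \<le> g y * \<bar>u - x\<bar>" for y
        using field_differentiable_bound[OF S(2), of "\<lambda>u. F u y" "\<lambda>u. F' u y" "g y" u x]
          deriv bound elim S(3)
        by (auto intro: has_field_derivative_at_within)
      then show ?case using elim by (auto simp: abs_div divide_le_eq)
    qed
    show "AE y in M. ((\<lambda>u. (F u y - F x y) / (u - x)) \<longlongrightarrow> F' x y) (at x)"
      using deriv[OF S(3)] by (auto simp: has_field_derivative_iff)
  qed (use meas g in auto)
  moreover have "\<forall>\<^sub>F u in at x. (LINT y|M. (F u y - F x y) / (u - x))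
      = ((LINT y|M. F u y) - (LINT y|M. F x y)) / (u - x)"
    using ev by eventually_elim (use int S(3) in auto)
  ultimately show ?thesis
    unfolding has_field_derivative_iff by (rule Lim_transform_eventually)
qed

section \<open>Jensen's inequality and the layer cake formula\<close>

text \<open>The graph of the convex function \<open>x powr p\<close> lies above its tangent at
  \<open>l\<close>; Young's inequality for \<open>x\<close> and \<open>l powr (p - 1)\<close> gives
  this with the exact constants.\<close>

lemma powr_ge_tangent:
  fixes p x l :: real
  assumes "1 < p" "0 \<le> x" "0 < l"
  shows "p * l powr (p - 1) * x \<le> x powr p + (p - 1) * l powr p"
proof -
  have q: "(p / (p - 1)) > 1" "1 / p + 1 / (p / (p - 1)) = 1"
    using assms by (auto simp: field_simps)
  have "x * l powr (p - 1) \<le> x powr p / p + (l powr (p - 1)) powr (p / (p - 1)) / (p / (p - 1))"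
    by (rule Youngs_inequality) (use assms q in auto)
  moreover have "(l powr (p - 1)) powr (p / (p - 1)) = l powr p"
    using assms by (simp add: powr_powr)
  ultimately show ?thesis using assms by (simp add: field_simps)
qed

text \<open>The tangent inequality at \<open>l = u / K\<close> is integrated against
  \<open>k\<close>; this \<open>l\<close> is the mean value of \<open>g\<close> if \<open>u\<close>
  is the integral of \<open>k * g\<close> and \<open>K\<close> that of \<open>k\<close>. The number
  \<open>u\<close> stands for a finite part of a possibly infinite integral, and \<open>K\<close>
  only has to bound the mass of \<open>k\<close>.\<close>

lemma jensen_nn_integral:
  fixes k g :: "'a \<Rightarrow> real"
  assumes p: "1 < p" and [measurable]: "k \<in> borel_measurable M" "g \<in> borel_measurable M"
    and nn: "\<And>x. 0 \<le> k x" "\<And>x. 0 \<le> g x"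
    and K: "(\<integral>\<^sup>+x. ennreal (k x) \<partial>M) \<le> ennreal K" "0 < K"
    and u: "0 \<le> u" "ennreal u \<le> (\<integral>\<^sup>+x. ennreal (k x * g x) \<partial>M)"
  shows "ennreal (u powr p) \<le> ennreal (K powr (p - 1)) * (\<integral>\<^sup>+x. ennreal (k x * g x powr p) \<partial>M)"
proof (cases "u = 0")
  case False
  define l where "l = u / K"
  have l: "0 < l" using False u K by (simp add: l_def)
  let ?J = "\<integral>\<^sup>+x. ennreal (k x * g x powr p) \<partial>M"
  have "ennreal (p * l powr (p - 1) * u) \<le> ennreal (p * l powr (p - 1)) * (\<integral>\<^sup>+x. ennreal (k x * g x) \<partial>M)"
    using u p by (subst ennreal_mult) (auto intro!: mult_left_mono)
  also have "\<dots> = (\<integral>\<^sup>+x. ennreal (k x * (p * l powr (p - 1) * g x)) \<partial>M)"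
    using p nn by (subst nn_integral_cmult[symmetric]) (auto simp: ennreal_mult'[symmetric] mult_ac intro!: nn_integral_cong)
  also have "\<dots> \<le> (\<integral>\<^sup>+x. ennreal (k x * g x powr p) + ennreal ((p - 1) * l powr p) * ennreal (k x) \<partial>M)"
  proof (rule nn_integral_mono)
    fix x
    have "k x * (p * l powr (p - 1) * g x) \<le> k x * (g x powr p + (p - 1) * l powr p)"
      by (intro mult_left_mono powr_ge_tangent) (use p nn l in auto)
    then have "ennreal (k x * (p * l powr (p - 1) * g x))
        \<le> ennreal (k x * g x powr p + ((p - 1) * l powr p) * k x)"
      by (intro ennreal_leI) (simp add: algebra_simps)
    then show "ennreal (k x * (p * l powr (p - 1) * g x))
        \<le> ennreal (k x * g x powr p) + ennreal ((p - 1) * l powr p) * ennreal (k x)"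
      using p nn by (simp add: ennreal_mult ennreal_plus)
  qed
  also have "\<dots> = ?J + ennreal ((p - 1) * l powr p) * (\<integral>\<^sup>+x. ennreal (k x) \<partial>M)"
    by (subst nn_integral_add) (auto simp: nn_integral_cmult)
  also have "\<dots> \<le> ?J + ennreal ((p - 1) * l powr p) * ennreal K"
    using K by (intro add_left_mono mult_left_mono) auto
  finally have *: "ennreal (p * l powr (p - 1) * u) \<le> ?J + ennreal ((p - 1) * l powr p * K)"
    using p K by (simp add: ennreal_mult)
  \<comment> \<open>By the choice of \<open>l\<close> the term with the factor \<open>p - 1\<close>
    is \<open>p - 1\<close> copies of \<open>l powr (p - 1) * u\<close>, so that one copy survives
    the cancellation. Cancelling is legitimate in \<open>ennreal\<close> because the cancelled term
    is finite.\<close>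
  have lp: "l powr p * K = l powr (p - 1) * u"
    using l K False u by (simp add: powr_diff l_def)
  have "ennreal (l powr (p - 1) * u) \<le> ?J"
  proof -
    have "ennreal (p * l powr (p - 1) * u) = ennreal (l powr (p - 1) * u) + ennreal ((p - 1) * l powr p * K)"
    proof (subst ennreal_plus[symmetric])
      have "(p - 1) * l powr p * K = (p - 1) * (l powr (p - 1) * u)"
        using lp by (simp add: mult.assoc)
      then show "ennreal (p * l powr (p - 1) * u) = ennreal (l powr (p - 1) * u + (p - 1) * l powr p * K)"
        by (simp add: algebra_simps)
    qed (use p K u in auto)
    with * have "ennreal ((p - 1) * l powr p * K) + ennreal (l powr (p - 1) * u)
        \<le> ennreal ((p - 1) * l powr p * K) + ?J"
      by (simp add: add.commute)
    then show ?thesis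
      unfolding ennreal_add_left_cancel_le by simp
  qed
  then have "ennreal (K powr (p - 1)) * ennreal (l powr (p - 1) * u) \<le> ennreal (K powr (p - 1)) * ?J"
    by (rule mult_left_mono) auto
  moreover have "K powr (p - 1) * (l powr (p - 1) * u) = u powr p"
    using K False u by (simp add: l_def powr_divide powr_diff)
  ultimately show ?thesis by (simp add: ennreal_mult'[symmetric])
qed (use p in simp)

lemma nn_integral_layer_cake:
  fixes m :: "real \<Rightarrow> real" and g :: "real \<Rightarrow> ennreal"
  assumes [measurable]: "m \<in> borel_measurable borel" "g \<in> borel_measurable borel"
  shows "(\<integral>\<^sup>+s. (\<integral>\<^sup>+u. ennreal (m u) * indicator {s..} u \<partial>lborel) * g s \<partial>lborel)
    = (\<integral>\<^sup>+u. ennreal (m u) * (\<integral>\<^sup>+s. g s * indicator {..u} s \<partial>lborel) \<partial>lborel)"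
proof -
  have [measurable]: "Measurable.pred (borel \<Otimes>\<^sub>M borel) (\<lambda>x::real\<times>real. fst x \<in> {snd x..})"
    "Measurable.pred (borel \<Otimes>\<^sub>M borel) (\<lambda>x::real\<times>real. snd x \<in> {fst x..})"
    unfolding atLeast_iff by measurable
  have "(\<integral>\<^sup>+s. (\<integral>\<^sup>+u. ennreal (m u) * indicator {s..} u \<partial>lborel) * g s \<partial>lborel)
     = (\<integral>\<^sup>+s. \<integral>\<^sup>+u. ennreal (m u) * g s * indicator {s..} u \<partial>lborel \<partial>lborel)"
    by (intro nn_integral_cong, subst nn_integral_multc[symmetric]) (auto simp: mult_ac intro!: nn_integral_cong)
  also have "\<dots> = (\<integral>\<^sup>+u. \<integral>\<^sup>+s. ennreal (m u) * g s * indicator {s..} u \<partial>lborel \<partial>lborel)"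
    by (rule lborel_pair.Fubini') measurable
  also have "\<dots> = (\<integral>\<^sup>+u. ennreal (m u) * (\<integral>\<^sup>+s. g s * indicator {..u} s \<partial>lborel) \<partial>lborel)"
    by (intro nn_integral_cong, subst nn_integral_cmult[symmetric])
      (auto simp: indicator_def intro!: nn_integral_cong)
  finally show ?thesis .
qed

lemma nn_integral_powr_tail:
  fixes b r :: real
  assumes "0 < b" "0 \<le> r"
  shows "(\<integral>\<^sup>+u. ennreal ((1 + u) powr (-1 - b)) * indicator {r..} u \<partial>lborel) = ennreal ((1 + r) powr (-b) / b)"
proof -
  have "(\<integral>\<^sup>+u. ennreal ((1 + u) powr (-1 - b)) * indicator {r..} u \<partial>lborel)
     = ennreal (0 - (- ((1 + r) powr (-b) / b)))"
  proof (rule nn_integral_FTC_atLeast)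
    show "((\<lambda>u. - ((1 + u) powr (-b) / b)) has_real_derivative (1 + x) powr (-1 - b)) (at x)" if "r \<le> x" for x
    proof -
      have "((\<lambda>u. (1 + u) powr (-b)) has_real_derivative (-b) * (1 + x) powr (-b - of_nat 1) * 1) (at x)"
        by (rule DERIV_fun_powr) (use that assms in \<open>auto intro!: derivative_eq_intros\<close>)
      then have "((\<lambda>u. (1 + u) powr (-b)) has_real_derivative (-b) * (1 + x) powr (-1 - b) * 1) (at x)"
        unfolding diff_conv_add_uminus[of _ "of_nat 1"] by (simp add: add.commute)
      from DERIV_minus[OF DERIV_cdivide[OF this, of b]] show ?thesis
        using assms by simp
    qed
    have "((\<lambda>u. (1 + u) powr (-b)) \<longlongrightarrow> 0) at_top"
      by (rule tendsto_neg_powr) (use assms in \<open>auto intro!: filterlim_tendsto_add_at_top filterlim_ident tendsto_const\<close>)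
    then show "((\<lambda>u. - ((1 + u) powr (-b) / b)) \<longlongrightarrow> 0) at_top"
      using tendsto_minus[OF tendsto_divide[OF _ tendsto_const[of b], where f = "\<lambda>u. (1 + u) powr (-b)" and a = 0]] assms by simp
  qed auto
  then show ?thesis by simp
qed

lemma integrable_powr_tail:
  fixes b r :: real
  assumes "0 < b" "0 \<le> r"
  shows "integrable lborel (\<lambda>u. indicator {r..} u * (1 + u) powr (-1 - b))"
proof (rule integrableI_bounded)
  have "(\<integral>\<^sup>+u. ennreal (norm (indicator {r..} u * (1 + u) powr (-1 - b))) \<partial>lborel)
     = (\<integral>\<^sup>+u. ennreal ((1 + u) powr (-1 - b)) * indicator {r..} u \<partial>lborel)"
    by (intro nn_integral_cong) (auto split: split_indicator)
  then show "(\<integral>\<^sup>+u. ennreal (norm (indicator {r..} u * (1 + u) powr (-1 - b))) \<partial>lborel) < \<infinity>"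
    by (simp add: nn_integral_powr_tail[OF assms])
qed auto

section \<open>The kernels $e^{-t^2/(4s)} s^{-b}$\<close>

text \<open>The value 0 for \<open>s \<le> 0\<close> turns integrals over the half-line into
  convolutions on the line. For \<open>t > 0\<close> the exponential beats every power of
  \<open>s\<close>, so this extension is differentiable across \<open>s = 0\<close> as well.\<close>

definition ekern :: "real \<Rightarrow> real \<Rightarrow> real \<Rightarrow> real" where
  "ekern b t s = (if s \<le> 0 then 0 else exp (-(t\<^sup>2 / (4 * s))) * s powr (-b))"

lemma measurable_ekern [measurable]:
  assumes [measurable]: "f \<in> borel_measurable M" "g \<in> borel_measurable M"
  shows "(\<lambda>x. ekern b (f x) (g x)) \<in> borel_measurable M"
  unfolding ekern_def by measurable

lemma ekern_nonneg: "0 \<le> ekern b t s"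
  by (simp add: ekern_def)

lemma ekern_eq_0: "s \<le> 0 \<Longrightarrow> ekern b t s = 0"
  by (simp add: ekern_def)

lemma ekern_le_powr: "0 < s \<Longrightarrow> ekern b t s \<le> s powr (-b)"
  by (simp add: ekern_def mult_left_le_one_le)

lemma ekern_shift: "0 < s \<Longrightarrow> ekern (b + a) t s = s powr (-a) * ekern b t s"
  by (simp add: ekern_def powr_add[symmetric] algebra_simps)

text \<open>The function \<open>x powr b * exp (- (k * x))\<close> is largest at
  \<open>x = b / k\<close>. The estimate \<open>ln z \<le> z - 1\<close> at
  \<open>z = k * x / b\<close> expresses this; the factor \<open>exp (- b)\<close> of the maximum is
  discarded.\<close>

lemma powr_le_exp:
  fixes b k x :: real
  assumes "0 < b" "0 < k" "0 < x"
  shows "x powr b \<le> (b / k) powr b * exp (k * x)"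
proof -
  have "ln (k * x / b) \<le> k * x / b - 1"
    by (rule ln_le_minus_one) (use assms in auto)
  moreover have "ln x = ln (k * x / b) + ln (b / k)"
    using assms by (simp add: ln_mult ln_div)
  ultimately have "b * ln x \<le> b * (k * x / b - 1 + ln (b / k))"
    using assms by (intro mult_left_mono) auto
  also have "\<dots> = k * x - b + b * ln (b / k)"
    using assms by (simp add: field_simps)
  also have "\<dots> \<le> k * x + b * ln (b / k)"
    using assms by simp
  finally show ?thesis
    using assms by (simp add: powr_def mult_exp_exp add.commute)
qed

lemma ekern_bound:
  assumes "0 < b" "0 < \<tau>"
  obtains C where "0 \<le> C" "\<And>t s. \<tau> \<le> t \<Longrightarrow> 0 < s \<Longrightarrow> ekern b t s \<le> C * (1 + s) powr (-b)"
proof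
  define k where "k = \<tau>\<^sup>2 / 4"
  have k: "0 < k" using assms by (simp add: k_def)
  define C where "C = (b / k) powr b * exp k"
  show "0 \<le> C" by (simp add: C_def)
  fix t s :: real assume t: "\<tau> \<le> t" and s: "0 < s"
  \<comment> \<open>Since \<open>1 + 1 / s = (1 + s) / s\<close>, the power
    \<open>s powr (-b)\<close> is \<open>(1 + 1 / s) powr b\<close> times
    \<open>(1 + s) powr (-b)\<close>. The exponential absorbs the first factor: the singularity at 0
    disappears and the decay at infinity is kept.\<close>
  have "(1 + 1 / s) powr b \<le> (b / k) powr b * exp (k * (1 + 1 / s))"
    by (rule powr_le_exp) (use assms k s in \<open>auto intro: add_pos_pos\<close>)
  also have "\<dots> = C * exp (k / s)"
    by (simp add: C_def distrib_left exp_add)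
  finally have *: "(1 + 1 / s) powr b * exp (-(k / s)) \<le> C"
    by (simp add: exp_minus field_simps)
  have "\<tau>\<^sup>2 \<le> t\<^sup>2"
    using t assms by (simp add: power_mono)
  then have "exp (-(t\<^sup>2 / (4 * s))) \<le> exp (-(k / s))"
    using s by (simp add: k_def divide_right_mono)
  then have "ekern b t s \<le> exp (-(k / s)) * s powr (-b)"
    using s by (simp add: ekern_def)
  also have "s powr (-b) = (1 + 1 / s) powr b * (1 + s) powr (-b)"
  proof -
    have "1 + 1 / s = (1 + s) / s" using s by (simp add: field_simps)
    then show ?thesis using s by (simp add: powr_divide powr_minus field_simps)
  qed
  also have "exp (-(k / s)) * ((1 + 1 / s) powr b * (1 + s) powr (-b))
      = ((1 + 1 / s) powr b * exp (-(k / s))) * (1 + s) powr (-b)" by simp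
  also have "\<dots> \<le> C * (1 + s) powr (-b)"
    using * by (rule mult_right_mono) auto
  finally show "ekern b t s \<le> C * (1 + s) powr (-b)" .
qed

lemma ekern_deriv_time:
  "((\<lambda>t. ekern b t s) has_real_derivative - (t / 2) * ekern (b + 1) t s) (at t)"
proof (cases "s \<le> 0")
  case False
  then show ?thesis
    unfolding ekern_def
    by (auto intro!: derivative_eq_intros simp: powr_diff powr_minus field_simps powr_add power2_eq_square)
qed (simp add: ekern_def)

lemma ekern_deriv_space:
  assumes "0 < b" "0 < t"
  shows "(ekern b t has_real_derivative t\<^sup>2 / 4 * ekern (b + 2) t s - b * ekern (b + 1) t s) (at s)"
proof (cases s "0::real" rule: linorder_cases)
  case less
  have "((\<lambda>_. 0) has_real_derivative 0) (at s)" by simp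
  then have "(ekern b t has_real_derivative 0) (at s)"
    by (rule has_field_derivative_transform_within_open[where S = "{..<0}"])
      (use less in \<open>auto simp: ekern_def\<close>)
  then show ?thesis using less by (simp add: ekern_def)
next
  case equal
  \<comment> \<open>At 0 the difference quotient is \<open>ekern b t h / h\<close>, which is
    \<open>h * ekern (b + 2) t h\<close> for \<open>h > 0\<close>. The kernel of exponent
    \<open>b + 2\<close> being bounded, the quotient tends to 0.\<close>
  obtain C where C: "0 \<le> C" "\<And>s. 0 < s \<Longrightarrow> ekern (b + 2) t s \<le> C * (1 + s) powr (-(b + 2))"
    by (rule ekern_bound[of "b + 2" t]) (use assms in auto)
  have *: "\<bar>ekern b t h / h\<bar> \<le> C * \<bar>h\<bar>" for h
  proof (cases "h \<le> 0")
    case False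
    then have h: "0 < h" by simp
    have "ekern (b + 2) t h \<le> C * (1 + h) powr (-(b + 2))" by (rule C(2)[OF h])
    also have "\<dots> \<le> C * 1 powr (-(b + 2))"
      using C h assms by (intro mult_left_mono powr_mono2') auto
    finally have "ekern (b + 2) t h \<le> C" by simp
    moreover have "ekern b t h = h\<^sup>2 * ekern (b + 2) t h"
      using h by (simp add: ekern_def powr_diff powr_minus field_simps powr_add power2_eq_square)
    ultimately have "ekern b t h \<le> h\<^sup>2 * C"
      using C by (simp add: mult_left_mono)
    then show ?thesis using h ekern_nonneg[of b t h]
      by (simp add: abs_div divide_le_eq power2_eq_square mult_ac)
  qed (use C(1) in \<open>simp add: ekern_def mult_nonneg_nonpos\<close>)
  have "((\<lambda>h. ekern b t h / h) \<longlongrightarrow> 0) (at 0)"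
  proof (rule tendsto_rabs_zero_cancel, rule tendsto_sandwich[of "\<lambda>_. 0" _ _ "\<lambda>h. C * \<bar>h\<bar>"])
    show "((\<lambda>h. C * \<bar>h\<bar>) \<longlongrightarrow> 0) (at 0)"
      by (rule tendsto_eq_intros | simp)+
  qed (use * in auto)
  then show ?thesis using equal by (simp add: has_field_derivative_iff ekern_def)
next
  case greater
  have "((\<lambda>s. exp (-(t\<^sup>2 / (4 * s))) * s powr (-b)) has_real_derivative
      t\<^sup>2 / 4 * ekern (b + 2) t s - b * ekern (b + 1) t s) (at s)"
    using greater unfolding ekern_def
    by (auto intro!: derivative_eq_intros simp: powr_diff powr_minus field_simps powr_add power2_eq_square)
  then show ?thesis
    by (rule has_field_derivative_transform_within_open[where S = "{0<..}"])
      (use greater in \<open>auto simp: ekern_def\<close>)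
qed

section \<open>Functions with linearly growing integrals to the right\<close>

text \<open>The one-sided condition that membership in \<open>L^p(w)\<close> yields. The constant
  depends on the left end point \<open>a\<close>, without control as \<open>a\<close> decreases, and
  \<open>1 + h\<close> in place of \<open>h\<close> asks for local integrability only, not for
  bounded averages as \<open>h\<close> tends to 0.\<close>

definition linear_growth :: "(real \<Rightarrow> real) \<Rightarrow> bool" where
  "linear_growth f \<longleftrightarrow> f \<in> borel_measurable borel \<and>
    (\<forall>a. \<exists>K\<ge>0. \<forall>h\<ge>0. (\<integral>\<^sup>+y. ennreal \<bar>f y\<bar> * indicator {a..a+h} y \<partial>lborel) \<le> ennreal (K * (1 + h)))"

lemma linear_growth_measurable: "linear_growth f \<Longrightarrow> f \<in> borel_measurable borel"
  by (simp add: linear_growth_def)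

text \<open>Layer cake: \<open>(1 + s) powr (-b)\<close> is \<open>b\<close> times the integral of
  \<open>(1 + u) powr (-1 - b)\<close> over \<open>u \<ge> s\<close>. After exchanging the integrals
  the growth bound \<open>K * (1 + u)\<close> costs one power, and \<open>(1 + u) powr (-b)\<close>
  is still integrable because \<open>b > 1\<close>.\<close>

lemma nn_integral_powr_tail_linear_growth:
  assumes f: "linear_growth f" and b: "1 < b"
  shows "(\<integral>\<^sup>+y. ennreal (indicator {a..} y * (1 + y - a) powr (-b) * \<bar>f y\<bar>) \<partial>lborel) < \<infinity>"
proof -
  have [measurable]: "f \<in> borel_measurable borel" using f by (rule linear_growth_measurable)
  obtain K where K: "0 \<le> K"
    "\<And>h. 0 \<le> h \<Longrightarrow> (\<integral>\<^sup>+y. ennreal \<bar>f y\<bar> * indicator {a..a+h} y \<partial>lborel) \<le> ennreal (K * (1 + h))"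
    using f unfolding linear_growth_def by blast
  define g where "g s = ennreal \<bar>f (a + s)\<bar> * indicator {0..} s" for s
  have [measurable]: "g \<in> borel_measurable borel" unfolding g_def by measurable
  define m where "m u = indicator {0..} u * (1 + u) powr (-1 - b)" for u :: real
  have [measurable]: "m \<in> borel_measurable borel" unfolding m_def by measurable
  have [measurable]: "Measurable.pred (borel \<Otimes>\<^sub>M borel) (\<lambda>x::real\<times>real. snd x \<in> {fst x..})"
    unfolding atLeast_iff by measurable
  have [measurable]: "(\<lambda>s. \<integral>\<^sup>+u. ennreal (m u) * indicator {s..} u \<partial>lborel) \<in> borel_measurable borel"
    by measurable
  have g_int: "(\<integral>\<^sup>+s. g s * indicator {..u} s \<partial>lborel) \<le> ennreal (K * (1 + u))" if "0 \<le> u" for u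
  proof -
    have "(\<integral>\<^sup>+s. g s * indicator {..u} s \<partial>lborel)
        = (\<integral>\<^sup>+y. ennreal \<bar>f y\<bar> * indicator {a..a+u} y \<partial>lborel)"
      by (subst (2) nn_integral_real_affine[where c = 1 and t = a])
        (auto simp: g_def indicator_def intro!: nn_integral_cong)
    then show ?thesis using K(2)[OF that] by simp
  qed
  have "(\<integral>\<^sup>+y. ennreal (indicator {a..} y * (1 + y - a) powr (-b) * \<bar>f y\<bar>) \<partial>lborel)
      = (\<integral>\<^sup>+s. ennreal ((1 + s) powr (-b)) * g s \<partial>lborel)"
    by (subst nn_integral_real_affine[where c = 1 and t = a])
      (auto simp: g_def ennreal_mult'[symmetric] indicator_def intro!: nn_integral_cong)
  also have "\<dots> = (\<integral>\<^sup>+s. ennreal b * ((\<integral>\<^sup>+u. ennreal (m u) * indicator {s..} u \<partial>lborel) * g s) \<partial>lborel)"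
  proof (rule nn_integral_cong)
    fix s :: real
    show "ennreal ((1 + s) powr (-b)) * g s
        = ennreal b * ((\<integral>\<^sup>+u. ennreal (m u) * indicator {s..} u \<partial>lborel) * g s)"
    proof (cases "0 \<le> s")
      case True
      then have "(\<integral>\<^sup>+u. ennreal (m u) * indicator {s..} u \<partial>lborel)
          = (\<integral>\<^sup>+u. ennreal ((1 + u) powr (-1 - b)) * indicator {s..} u \<partial>lborel)"
        by (intro nn_integral_cong) (auto simp: m_def split: split_indicator)
      also have "\<dots> = ennreal ((1 + s) powr (-b) / b)"
        by (rule nn_integral_powr_tail) (use b True in auto)
      finally show ?thesis
        using b by (simp add: mult.assoc[symmetric] ennreal_mult[symmetric])
    qed (simp add: g_def)
  qed
  also have "\<dots> = ennreal b * (\<integral>\<^sup>+u. ennreal (m u) * (\<integral>\<^sup>+s. g s * indicator {..u} s \<partial>lborel) \<partial>lborel)"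
    by (subst nn_integral_cmult) (auto simp: nn_integral_layer_cake)
  also have "\<dots> \<le> ennreal b * (\<integral>\<^sup>+u. ennreal K * (ennreal ((1 + u) powr (-1 - (b - 1))) * indicator {0..} u) \<partial>lborel)"
  proof (rule mult_left_mono, rule nn_integral_mono)
    fix u :: real
    show "ennreal (m u) * (\<integral>\<^sup>+s. g s * indicator {..u} s \<partial>lborel)
        \<le> ennreal K * (ennreal ((1 + u) powr (-1 - (b - 1))) * indicator {0..} u)"
    proof (cases "0 \<le> u")
      case True
      have "ennreal (m u) * (\<integral>\<^sup>+s. g s * indicator {..u} s \<partial>lborel) \<le> ennreal (m u) * ennreal (K * (1 + u))"
        using g_int[OF True] by (rule mult_left_mono) simp
      also have "\<dots> = ennreal (K * (1 + u) powr (-1 - (b - 1)))"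
      proof -
        have "(1 + u) powr (-1 - b) * (1 + u) = (1 + u) powr (-1 - b) * (1 + u) powr 1"
          using True by simp
        also have "\<dots> = (1 + u) powr (-1 - (b - 1))"
          by (subst powr_add[symmetric]) simp
        finally have "m u * (K * (1 + u)) = K * (1 + u) powr (-1 - (b - 1))"
          using True by (simp add: m_def mult_ac)
        then show ?thesis using True K by (simp add: ennreal_mult'[symmetric] m_def)
      qed
      also have "\<dots> = ennreal K * (ennreal ((1 + u) powr (-1 - (b - 1))) * indicator {0..} u)"
        using True K by (simp add: ennreal_mult')
      finally show ?thesis .
    qed (simp add: m_def)
  qed simp
  also have "\<dots> = ennreal b * (ennreal K * ennreal ((1 + 0) powr (-(b - 1)) / (b - 1)))"
    by (subst nn_integral_cmult, simp, subst nn_integral_powr_tail) (use b in auto)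
  also have "\<dots> < \<infinity>" by (simp add: ennreal_mult_less_top)
  finally show ?thesis .
qed

lemma integrable_powr_tail_linear_growth:
  assumes f: "linear_growth f" and b: "1 < b"
  shows "integrable lborel (\<lambda>y. indicator {a..} y * (1 + y - a) powr (-b) * \<bar>f y\<bar>)"
proof (rule integrableI_bounded)
  show "(\<lambda>y. indicator {a..} y * (1 + y - a) powr (-b) * \<bar>f y\<bar>) \<in> borel_measurable lborel"
    using linear_growth_measurable[OF f] by measurable
qed (use nn_integral_powr_tail_linear_growth[OF assms, of a] in \<open>simp add: abs_mult\<close>)

section \<open>Convolution with the kernels, and the extension equation\<close>

definition kconv :: "real \<Rightarrow> (real \<Rightarrow> real) \<Rightarrow> real \<Rightarrow> real \<Rightarrow> real" where
  "kconv b f x t = (LINT y|lborel. ekern b t (y - x) * f y)"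

lemma ekern_dominated:
  assumes b: "0 < b" and \<tau>: "0 < \<tau>"
  obtains C where "0 \<le> C"
    "\<And>x t y. \<bar>x - x\<^sub>0\<bar> \<le> 1 \<Longrightarrow> \<tau> \<le> t \<Longrightarrow>
      ekern b t (y - x) \<le> C * (indicator {x\<^sub>0 - 1..} y * (1 + y - (x\<^sub>0 - 1)) powr (-b))"
proof -
  obtain C where C: "0 \<le> C" "\<And>t s. \<tau> \<le> t \<Longrightarrow> 0 < s \<Longrightarrow> ekern b t s \<le> C * (1 + s) powr (-b)"
    using ekern_bound[OF b \<tau>] by metis
  show ?thesis
  proof (rule that[of "C * 3 powr b"])
    fix x t y assume x: "\<bar>x - x\<^sub>0\<bar> \<le> 1" and t: "\<tau> \<le> t"
    show "ekern b t (y - x) \<le> C * 3 powr b * (indicator {x\<^sub>0 - 1..} y * (1 + y - (x\<^sub>0 - 1)) powr (-b))"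
    proof (cases "y \<le> x")
      case False
      then have "ekern b t (y - x) \<le> C * (1 + (y - x)) powr (-b)"
        using C(2)[OF t] by simp
      \<comment> \<open>For \<open>y > x\<close> and \<open>x\<close> at distance at most 1 from the
        centre, \<open>1 + y - (x\<^sub>0 - 1)\<close> is at most \<open>3 + (y - x)\<close>, hence
        at most \<open>3 * (1 + (y - x))\<close>. This is the origin of the factor
        \<open>3 powr b\<close>.\<close>
      also have "\<dots> \<le> C * ((1 + y - (x\<^sub>0 - 1)) / 3) powr (-b)"
        by (intro mult_left_mono powr_mono2') (use False x b C(1) in auto)
      also have "\<dots> = C * 3 powr b * (1 + y - (x\<^sub>0 - 1)) powr (-b)"
        using False x by (simp add: powr_divide powr_minus field_simps)
      finally show ?thesis
        using False x by simp
    qed (use C(1) in \<open>simp add: ekern_eq_0\<close>)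
  qed (use C(1) in simp)
qed

lemma ekern_dominated_linear_growth:
  assumes f: "linear_growth f" and b: "1 < b" and \<tau>: "0 < \<tau>"
  obtains g where "integrable lborel g"
    "\<And>x t y. \<bar>x - x\<^sub>0\<bar> \<le> 1 \<Longrightarrow> \<tau> \<le> t \<Longrightarrow> \<bar>ekern b t (y - x) * f y\<bar> \<le> g y"
proof -
  have "0 < b" using b by simp
  then obtain C where C: "0 \<le> C" "\<And>x t y. \<bar>x - x\<^sub>0\<bar> \<le> 1 \<Longrightarrow> \<tau> \<le> t \<Longrightarrow>
      ekern b t (y - x) \<le> C * (indicator {x\<^sub>0 - 1..} y * (1 + y - (x\<^sub>0 - 1)) powr (-b))"
    using ekern_dominated[OF _ \<tau>] by metis
  show ?thesis
  proof (rule that[of "\<lambda>y. C * (indicator {x\<^sub>0 - 1..} y * (1 + y - (x\<^sub>0 - 1)) powr (-b) * \<bar>f y\<bar>)"])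
    show "integrable lborel (\<lambda>y. C * (indicator {x\<^sub>0 - 1..} y * (1 + y - (x\<^sub>0 - 1)) powr (-b) * \<bar>f y\<bar>))"
      by (intro integrable_mult_right integrable_powr_tail_linear_growth f b)
    fix x t y assume "\<bar>x - x\<^sub>0\<bar> \<le> 1" "\<tau> \<le> t"
    from mult_right_mono[OF C(2)[OF this, of y], of "\<bar>f y\<bar>"]
    show "\<bar>ekern b t (y - x) * f y\<bar> \<le> C * (indicator {x\<^sub>0 - 1..} y * (1 + y - (x\<^sub>0 - 1)) powr (-b) * \<bar>f y\<bar>)"
      by (simp add: abs_mult ekern_nonneg mult.assoc)
  qed
qed

lemma integrable_kconv:
  assumes f: "linear_growth f" and b: "1 < b" and t: "0 < t"
  shows "integrable lborel (\<lambda>y. ekern b t (y - x) * f y)"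
proof -
  have [measurable]: "f \<in> borel_measurable borel" using f by (rule linear_growth_measurable)
  obtain g where g: "integrable lborel g"
    "\<And>x' t' y. \<bar>x' - x\<bar> \<le> 1 \<Longrightarrow> t \<le> t' \<Longrightarrow> \<bar>ekern b t' (y - x') * f y\<bar> \<le> g y"
    using ekern_dominated_linear_growth[OF f b t] by metis
  show ?thesis
    by (rule Bochner_Integration.integrable_bound[OF g(1)])
      (auto intro!: AE_I2 order_trans[OF g(2) abs_ge_self])
qed

text \<open>The line \<open>s = 0\<close> is left out because for positive \<open>b\<close> the
  kernel with \<open>t = 0\<close> is unbounded near it. Under the integral only the single point
  \<open>y = x\<^sub>0\<close> is lost, a null set.\<close>

lemma continuous_on_ekern: "continuous_on (UNIV \<times> (- {0})) (\<lambda>(t, s). ekern b t s)"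
proof -
  have "continuous_on (UNIV \<times> {0<..}) (\<lambda>(t, s). ekern b t s)"
  proof -
    have "continuous_on (UNIV \<times> {0<..}) (\<lambda>z. exp (-((fst z)\<^sup>2 / (4 * snd z))) * snd z powr (-b))"
      by (intro continuous_intros) auto
    then show ?thesis
      by (rule continuous_on_eq) (auto simp: ekern_def)
  qed
  moreover have "continuous_on (UNIV \<times> {..<0}) (\<lambda>(t, s). ekern b t s)"
    by (rule continuous_on_eq[where f = "\<lambda>_. 0"]) (auto simp: ekern_def)
  ultimately have "continuous_on (UNIV \<times> {0<..} \<union> UNIV \<times> {..<0}) (\<lambda>(t, s). ekern b t s)"
    by (intro continuous_on_open_Un) (auto intro: open_Times)
  moreover have "UNIV \<times> {0<..} \<union> UNIV \<times> {..<0} = (UNIV \<times> (- {0}) :: (real \<times> real) set)"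
    by auto
  ultimately show ?thesis by simp
qed

lemma continuous_on_kconv:
  assumes f: "linear_growth f" and b: "1 < b"
  shows "continuous_on (UNIV \<times> {0<..}) (\<lambda>(x, t). kconv b f x t)"
  unfolding continuous_on_def
proof
  have [measurable]: "f \<in> borel_measurable borel" using f by (rule linear_growth_measurable)
  fix z\<^sub>0 :: "real \<times> real" assume "z\<^sub>0 \<in> UNIV \<times> {0<..}"
  then obtain x\<^sub>0 t\<^sub>0 where z\<^sub>0: "z\<^sub>0 = (x\<^sub>0, t\<^sub>0)" and t\<^sub>0: "0 < t\<^sub>0" by auto
  have t2: "0 < t\<^sub>0 / 2" using t\<^sub>0 by simp
  obtain g where g: "integrable lborel g"
    "\<And>x t y. \<bar>x - x\<^sub>0\<bar> \<le> 1 \<Longrightarrow> t\<^sub>0 / 2 \<le> t \<Longrightarrow> \<bar>ekern b t (y - x) * f y\<bar> \<le> g y"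
    using ekern_dominated_linear_growth[OF f b t2] by metis
  have ev: "\<forall>\<^sub>F z in at z\<^sub>0 within UNIV \<times> {0<..}. z \<in> {x\<^sub>0 - 1<..<x\<^sub>0 + 1} \<times> {t\<^sub>0 / 2<..}"
    by (rule filter_leD[OF at_le[OF subset_UNIV]], rule eventually_at_in_open')
      (use t\<^sub>0 z\<^sub>0 in \<open>auto intro!: open_Times\<close>)
  show "((\<lambda>(x, t). kconv b f x t) \<longlongrightarrow> (case z\<^sub>0 of (x, t) \<Rightarrow> kconv b f x t)) (at z\<^sub>0 within UNIV \<times> {0<..})"
    unfolding kconv_def case_prod_beta
  proof (rule tendsto_integral_dominated[OF _ _ g(1)])
    show "\<forall>\<^sub>F z in at z\<^sub>0 within UNIV \<times> {0<..}. AE y in lborel. \<bar>ekern b (snd z) (y - fst z) * f y\<bar> \<le> g y"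
      using ev by eventually_elim (auto intro!: AE_I2 g(2))
    have "((\<lambda>z. ekern b (snd z) (y - fst z) * f y) \<longlongrightarrow> ekern b (snd z\<^sub>0) (y - fst z\<^sub>0) * f y)
        (at z\<^sub>0 within UNIV \<times> {0<..})" if y: "y \<noteq> x\<^sub>0" for y
    proof -
      have op: "open (UNIV \<times> (- {0}) :: (real \<times> real) set)"
        by (intro open_Times) auto
      have "isCont (\<lambda>(t, s). ekern b t s) (snd z\<^sub>0, y - fst z\<^sub>0)"
        using continuous_on_ekern[of b] op y z\<^sub>0 by (simp add: continuous_on_eq_continuous_at)
      then have "((\<lambda>z. (\<lambda>(t, s). ekern b t s) (snd z, y - fst z)) \<longlongrightarrow>
          (\<lambda>(t, s). ekern b t s) (snd z\<^sub>0, y - fst z\<^sub>0)) (at z\<^sub>0 within UNIV \<times> {0<..})"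
        by (rule isCont_tendsto_compose) (intro tendsto_intros)
      then show ?thesis by (auto intro!: tendsto_intros)
    qed
    then show "AE y in lborel. ((\<lambda>z. ekern b (snd z) (y - fst z) * f y) \<longlongrightarrow> ekern b (snd z\<^sub>0) (y - fst z\<^sub>0) * f y)
        (at z\<^sub>0 within UNIV \<times> {0<..})"
      by (intro eventually_mono[OF AE_lborel_singleton[of x\<^sub>0]]) auto
  qed auto
qed

lemma kconv_deriv_time:
  assumes f: "linear_growth f" and b: "1 < b" and t: "0 < t"
  shows "((\<lambda>t. kconv b f x t) has_real_derivative - (t / 2) * kconv (b + 1) f x t) (at t)"
proof -
  have [measurable]: "f \<in> borel_measurable borel" using f by (rule linear_growth_measurable)
  have t2: "0 < t / 2" "1 < b + 1" using t b by auto
  obtain g where g: "integrable lborel g"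
    "\<And>x' t' y. \<bar>x' - x\<bar> \<le> 1 \<Longrightarrow> t / 2 \<le> t' \<Longrightarrow> \<bar>ekern (b + 1) t' (y - x') * f y\<bar> \<le> g y"
    using ekern_dominated_linear_growth[OF f t2(2,1)] by metis
  have "((\<lambda>t. LINT y|lborel. ekern b t (y - x) * f y) has_real_derivative
      (LINT y|lborel. - (t / 2) * (ekern (b + 1) t (y - x) * f y))) (at t)"
  proof (rule has_real_derivative_integral_dominated[where S = "{t/2<..<2 * t}" and g = "\<lambda>y. t * g y"])
    fix u y assume u: "u \<in> {t/2<..<2 * t}"
    show "((\<lambda>u. ekern b u (y - x) * f y) has_real_derivative - (u / 2) * (ekern (b + 1) u (y - x) * f y)) (at u)"
      by (rule derivative_eq_intros ekern_deriv_time | simp)+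
    show "\<bar>- (u / 2) * (ekern (b + 1) u (y - x) * f y)\<bar> \<le> t * g y"
      unfolding abs_mult[of "- (u / 2)"] using u g(2)[of x u y] by (intro mult_mono) auto
  next
    fix u assume "u \<in> {t/2<..<2 * t}"
    then show "integrable lborel (\<lambda>y. ekern b u (y - x) * f y)"
      using t by (intro integrable_kconv f b) auto
  qed (use t g(1) in auto)
  then show ?thesis by (simp add: kconv_def)
qed

text \<open>The variable \<open>x\<close> occurs in the kernel alone, which is why a merely
  measurable \<open>f\<close> has a differentiable convolution.\<close>

lemma kconv_deriv_space:
  assumes f: "linear_growth f" and b: "1 < b" and t: "0 < t"
  shows "((\<lambda>x. kconv b f x t) has_real_derivative
    b * kconv (b + 1) f x t - t\<^sup>2 / 4 * kconv (b + 2) f x t) (at x)"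
proof -
  have [measurable]: "f \<in> borel_measurable borel" using f by (rule linear_growth_measurable)
  have b1: "1 < b + 1" "1 < b + 2" using b by auto
  obtain g where g: "integrable lborel g"
    "\<And>x' t' y. \<bar>x' - x\<bar> \<le> 1 \<Longrightarrow> t \<le> t' \<Longrightarrow> \<bar>ekern (b + 1) t' (y - x') * f y\<bar> \<le> g y"
    using ekern_dominated_linear_growth[OF f b1(1) t] by metis
  obtain g' where g': "integrable lborel g'"
    "\<And>x' t' y. \<bar>x' - x\<bar> \<le> 1 \<Longrightarrow> t \<le> t' \<Longrightarrow> \<bar>ekern (b + 2) t' (y - x') * f y\<bar> \<le> g' y"
    using ekern_dominated_linear_growth[OF f b1(2) t] by metis
  have "((\<lambda>x. LINT y|lborel. ekern b t (y - x) * f y) has_real_derivative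
      (LINT y|lborel. b * (ekern (b + 1) t (y - x) * f y) - t\<^sup>2 / 4 * (ekern (b + 2) t (y - x) * f y))) (at x)"
  proof (rule has_real_derivative_integral_dominated[where S = "{x - 1<..<x + 1}"
        and g = "\<lambda>y. b * g y + t\<^sup>2 / 4 * g' y"])
    fix u y assume u: "u \<in> {x - 1<..<x + 1}"
    have b0: "0 < b" using b by simp
    have "((\<lambda>u. y - u) has_real_derivative -1) (at u)"
      by (auto intro!: derivative_eq_intros)
    from DERIV_chain2[OF ekern_deriv_space[OF b0 t] this]
    show "((\<lambda>u. ekern b t (y - u) * f y) has_real_derivative
        b * (ekern (b + 1) t (y - u) * f y) - t\<^sup>2 / 4 * (ekern (b + 2) t (y - u) * f y)) (at u)"
      by (rule DERIV_cong[OF DERIV_mult[OF _ DERIV_const]]) (simp add: algebra_simps)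
    have "\<bar>b * (ekern (b + 1) t (y - u) * f y) - t\<^sup>2 / 4 * (ekern (b + 2) t (y - u) * f y)\<bar>
       \<le> b * \<bar>ekern (b + 1) t (y - u) * f y\<bar> + t\<^sup>2 / 4 * \<bar>ekern (b + 2) t (y - u) * f y\<bar>"
      using b by (intro order_trans[OF abs_triangle_ineq4]) (simp add: abs_mult)
    also have "\<dots> \<le> b * g y + t\<^sup>2 / 4 * g' y"
      using u b g(2)[of u t y] g'(2)[of u t y] by (intro add_mono mult_left_mono) auto
    finally show "\<bar>b * (ekern (b + 1) t (y - u) * f y) - t\<^sup>2 / 4 * (ekern (b + 2) t (y - u) * f y)\<bar>
       \<le> b * g y + t\<^sup>2 / 4 * g' y" .
  next
    fix u show "integrable lborel (\<lambda>y. ekern b t (y - u) * f y)"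
      by (intro integrable_kconv f b t)
  qed (use g(1) g'(1) in auto)
  also have "(LINT y|lborel. b * (ekern (b + 1) t (y - x) * f y) - t\<^sup>2 / 4 * (ekern (b + 2) t (y - x) * f y))
      = b * kconv (b + 1) f x t - t\<^sup>2 / 4 * kconv (b + 2) f x t"
    unfolding kconv_def using integrable_kconv[OF f b1(1) t, of x] integrable_kconv[OF f b1(2) t, of x] by simp
  finally show ?thesis by (simp add: kconv_def)
qed

section \<open>The extension as a multiple of a convolution, and the differential equation\<close>

lemma extension_integrand_eq:
  "0 < s \<Longrightarrow> extension_integrand \<alpha> f x t s = ekern (1 + \<alpha>) t s * f (x + s)"
  unfolding extension_integrand_def ekern_def powr_minus_divide by simp

lemma indicator_extension_integrand:
  "indicator {0<..} s *\<^sub>R extension_integrand \<alpha> f x t s = ekern (1 + \<alpha>) t s * f (x + s)"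
  by (auto simp: extension_integrand_eq ekern_eq_0 split: split_indicator)

lemma set_integrable_extension_integrand:
  assumes f: "linear_growth f" and a: "0 < \<alpha>" and t: "0 < t"
  shows "set_integrable lebesgue {0<..} (extension_integrand \<alpha> f x t)"
proof -
  have [measurable]: "f \<in> borel_measurable borel" using f by (rule linear_growth_measurable)
  have "1 < 1 + \<alpha>" using a by simp
  from integrable_kconv[OF f this t, of x]
  have "integrable lborel (\<lambda>s. ekern (1 + \<alpha>) t ((x + 1 * s) - x) * f (x + 1 * s))"
    by (rule lborel_integrable_real_affine) simp
  then show ?thesis
    unfolding set_integrable_def indicator_extension_integrand
    by (simp add: integrable_completion)
qed

lemma extension_eq_kconv:
  assumes [measurable]: "f \<in> borel_measurable borel"
  shows "extension \<alpha> f x t = t powr (2 * \<alpha>) / (4 powr \<alpha> * Gamma \<alpha>) * kconv (1 + \<alpha>) f x t"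
proof -
  have "(LINT s:{0<..}|lebesgue. extension_integrand \<alpha> f x t s) = (LINT s|lborel. ekern (1 + \<alpha>) t s * f (x + s))"
    unfolding set_lebesgue_integral_def indicator_extension_integrand
    by (rule integral_completion) simp
  also have "\<dots> = kconv (1 + \<alpha>) f x t"
    unfolding kconv_def by (subst (2) lborel_integral_real_affine[where c = 1 and t = x]) auto
  finally show ?thesis by (simp add: extension_def)
qed

lemma has_real_derivative_powr_div:
  "0 < t \<Longrightarrow> ((\<lambda>t. t powr r) has_real_derivative r / t * t powr r) (at t)"
  by (rule DERIV_cong[OF has_real_derivative_powr]) (auto simp: powr_diff)

lemma extension_deriv_time:
  assumes f: "linear_growth f" and a: "0 < \<alpha>" and t: "0 < t"
  shows "((\<lambda>\<tau>. extension \<alpha> f x \<tau>) has_real_derivative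
     t powr (2 * \<alpha>) / (4 powr \<alpha> * Gamma \<alpha>) *
       (2 * \<alpha> / t * kconv (1 + \<alpha>) f x t - t / 2 * kconv (2 + \<alpha>) f x t)) (at t)"
proof -
  note fm = linear_growth_measurable[OF f]
  have a1: "1 < 1 + \<alpha>" using a by simp
  define c where "c = 1 / (4 powr \<alpha> * Gamma \<alpha>)"
  have "((\<lambda>t. c * t powr (2 * \<alpha>) * kconv (1 + \<alpha>) f x t) has_real_derivative
    c * (2 * \<alpha> / t * t powr (2 * \<alpha>)) * kconv (1 + \<alpha>) f x t +
      - (t / 2) * kconv (1 + \<alpha> + 1) f x t * (c * t powr (2 * \<alpha>))) (at t)"
    by (intro DERIV_mult DERIV_cmult has_real_derivative_powr_div kconv_deriv_time f a1 t)
  moreover have "1 + \<alpha> + 1 = 2 + \<alpha>" by simp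
  ultimately have "((\<lambda>t. c * t powr (2 * \<alpha>) * kconv (1 + \<alpha>) f x t) has_real_derivative
     c * t powr (2 * \<alpha>) * (2 * \<alpha> / t * kconv (1 + \<alpha>) f x t - t / 2 * kconv (2 + \<alpha>) f x t)) (at t)"
    by (elim DERIV_cong) (simp add: algebra_simps)
  then show ?thesis
    unfolding extension_eq_kconv[OF fm] c_def by simp
qed

lemma classical_solution_extension:
  assumes f: "linear_growth f" and a: "0 < \<alpha>"
  shows "classical_solution \<alpha> (extension \<alpha> f)"
proof -
  note fm = linear_growth_measurable[OF f]
  define c where "c = 1 / (4 powr \<alpha> * Gamma \<alpha>)"
  define V where "V j x t = kconv (j + \<alpha>) f x t" for j :: real and x t
  have V_cont: "continuous_on (UNIV \<times> {0<..}) (\<lambda>z. V j (fst z) (snd z))" if "1 \<le> j" for j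
    using continuous_on_kconv[OF f, of "j + \<alpha>"] that a by (simp add: V_def case_prod_beta)
  have V_t: "((\<lambda>t. V j x t) has_real_derivative - (t / 2) * V (j + 1) x t) (at t)" if "1 \<le> j" "0 < t" for j x t
    using kconv_deriv_time[OF f, of "j + \<alpha>" t x] that a by (simp add: V_def add_ac)
  have V_x: "((\<lambda>x. V 1 x t) has_real_derivative (1 + \<alpha>) * V 2 x t - t\<^sup>2 / 4 * V 3 x t) (at x)" if "0 < t" for x t
    using kconv_deriv_space[OF f, of "1 + \<alpha>" t x] that a by (simp add: V_def add_ac)
  define T where "T t = c * t powr (2 * \<alpha>)" for t :: real
  have T_t: "(T has_real_derivative 2 * \<alpha> / t * T t) (at t)" if "0 < t" for t
    unfolding T_def by (rule DERIV_cong[OF DERIV_cmult[OF has_real_derivative_powr_div[OF that]]]) simp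
  have T_cont: "continuous_on (UNIV \<times> {0<..}) (\<lambda>z::real\<times>real. T (snd z))"
    unfolding T_def by (intro continuous_intros) auto
  have U: "extension \<alpha> f x t = T t * V 1 x t" for x t
    by (simp add: extension_eq_kconv[OF fm] T_def c_def V_def)
  \<comment> \<open>\<open>DU\<close> carries the sign of the derivative from the right, which is
    minus the ordinary x-derivative. All three functions come from the product rule, as derivatives
    of \<open>V j\<close> are combinations of \<open>V\<close> with larger index.\<close>
  define DU where "DU x t = - (T t * ((1 + \<alpha>) * V 2 x t - t\<^sup>2 / 4 * V 3 x t))" for x t
  define Ut where "Ut x t = T t * (2 * \<alpha> / t * V 1 x t - t / 2 * V 2 x t)" for x t
  define Utt where "Utt x t = 2 * \<alpha> / t * T t * (2 * \<alpha> / t * V 1 x t - t / 2 * V 2 x t)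
    + T t * (- 2 * \<alpha> / t\<^sup>2 * V 1 x t - \<alpha> * V 2 x t - V 2 x t / 2 + t\<^sup>2 / 4 * V 3 x t)" for x t
  show ?thesis
    unfolding classical_solution_def
  proof (rule exI[of _ DU], rule exI[of _ Ut], rule exI[of _ Utt], intro conjI allI impI)
    show "\<forall>G\<in>{extension \<alpha> f, DU, Ut, Utt}. continuous_on (UNIV \<times> {0<..}) (\<lambda>(x, t). G x t)"
      unfolding case_prod_beta U[abs_def] DU_def Ut_def Utt_def
      by (auto intro!: continuous_intros V_cont T_cont)
    fix x t :: real assume t: "0 < t"
    have "((\<lambda>y. extension \<alpha> f y t) has_real_derivative - DU x t) (at x)"
      unfolding U DU_def minus_minus by (rule DERIV_cmult[OF V_x[OF t]])
    then have "((\<lambda>h. (extension \<alpha> f (x + h) t - extension \<alpha> f x t) / h) \<longlongrightarrow> - DU x t) (at_right 0)"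
      unfolding DERIV_def by (rule filterlim_mono) (auto simp: at_le)
    from tendsto_minus[OF this] show "has_D_right (\<lambda>y. extension \<alpha> f y t) (DU x t) x"
      unfolding has_D_right_def by (simp add: minus_divide_left)
    show "((\<lambda>\<tau>. extension \<alpha> f x \<tau>) has_real_derivative Ut x t) (at t)"
      unfolding U Ut_def
      by (rule DERIV_cong[OF DERIV_mult[OF T_t[OF t] V_t[OF _ t]]]) (simp_all add: algebra_simps)
    have "((\<lambda>t. 2 * \<alpha> / t * V 1 x t - t / 2 * V 2 x t) has_real_derivative
       (- 2 * \<alpha> / t\<^sup>2 * V 1 x t - \<alpha> * V 2 x t - V 2 x t / 2 + t\<^sup>2 / 4 * V 3 x t)) (at t)"
      using t by (auto intro!: derivative_eq_intros V_t[of 1 t x] V_t[of 2 t x] simp: field_simps power2_eq_square)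
    from DERIV_mult[OF T_t[OF t] this] show "((\<lambda>\<tau>. Ut x \<tau>) has_real_derivative Utt x t) (at t)"
      unfolding Ut_def by (rule DERIV_cong) (simp add: Utt_def)
    \<comment> \<open>Pure algebra: the coefficients of \<open>V 1\<close>, \<open>V 2\<close> and
      \<open>V 3\<close> vanish separately.\<close>
    show "- DU x t + (1 - 2 * \<alpha>) / t * Ut x t + Utt x t = 0"
      using t by (simp add: DU_def Ut_def Utt_def field_simps power2_eq_square)
  qed
qed

section \<open>Weights in $A_p^+$\<close>

text \<open>Lets Hoelder's inequality, which is stated for a finite \<open>u\<close> below the
  integral, prove that the integral is finite: if \<open>X\<close> were infinite,
  \<open>u = c + 1\<close> would be admissible.\<close>

lemma ennreal_le_if_real_le:
  assumes "0 \<le> c" "\<And>u. 0 \<le> u \<Longrightarrow> ennreal u \<le> X \<Longrightarrow> u \<le> c"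
  shows "X \<le> ennreal c"
proof (cases X)
  case (real r)
  then show ?thesis using assms(2)[of r] by (auto intro: ennreal_leI)
next
  case top
  then show ?thesis using assms(2)[of "c + 1"] assms(1) by auto
qed

lemma measurable_nn_integral_interval [measurable]:
  fixes f h :: "'a \<Rightarrow> real" and g :: "real \<Rightarrow> ennreal"
  assumes [measurable]: "f \<in> borel_measurable M" "h \<in> borel_measurable M" "g \<in> borel_measurable borel"
  shows "(\<lambda>x. \<integral>\<^sup>+y. g y * indicator {f x..h x} y \<partial>lborel) \<in> borel_measurable M"
proof -
  have "(\<integral>\<^sup>+y. g y * indicator {f x..h x} y \<partial>lborel)
      = (\<integral>\<^sup>+y. (if f x \<le> y \<and> y \<le> h x then g y else 0) \<partial>lborel)" for x
    by (intro nn_integral_cong) (auto split: split_indicator)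
  moreover have "(\<lambda>x. \<integral>\<^sup>+y. (if f x \<le> y \<and> y \<le> h x then g y else 0) \<partial>lborel) \<in> borel_measurable M"
    by measurable
  ultimately show ?thesis by simp
qed

lemma nn_integral_interval_pos:
  fixes g :: "real \<Rightarrow> real"
  assumes [measurable]: "g \<in> borel_measurable lebesgue" and "\<And>x. 0 < g x" "a < b"
  shows "0 < (\<integral>\<^sup>+x. ennreal (g x) * indicator {a..b} x \<partial>lebesgue)"
proof (rule ccontr)
  have [measurable]: "{a..b} \<in> sets lebesgue" by simp
  have gne: "ennreal (g x) \<noteq> 0" for x
    using assms(2)[of x] by (simp add: ennreal_eq_0_iff not_le)
  assume "\<not> ?thesis"
  then have "(\<integral>\<^sup>+x. ennreal (g x) * indicator {a..b} x \<partial>lebesgue) = 0" by simp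
  then have "AE x in lebesgue. ennreal (g x) * indicator {a..b} x = 0"
    by (subst (asm) nn_integral_0_iff_AE) auto
  then have "AE x in lebesgue. x \<notin> {a..b}"
    by eventually_elim (use gne in \<open>auto split: split_indicator_asm\<close>)
  then have "emeasure lebesgue {a..b} = 0"
    by (subst (asm) AE_iff_measurable[of "{a..b}"]) auto
  then show False using assms(3) by simp
qed

text \<open>Since 0 times infinity is 0 in \<open>ennreal\<close>, a finite product bounds a factor
  only if the other one is not 0. Positivity of the weight is thus what makes the
  \<open>A_p^+\<close> condition imply local integrability of \<open>w\<close> and of its dual
  weight.\<close>

lemma ennreal_powr_mult_le:
  assumes "0 < W" "0 < S" "0 < r" "0 < q" "ennreal_powr W r * ennreal_powr S q \<le> ennreal C"
  shows "W < \<infinity>" "S < \<infinity>" "enn2real W powr r * enn2real S powr q \<le> C"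
proof -
  have pos: "ennreal_powr X r' \<noteq> 0" if "0 < X" for X r'
    using that unfolding ennreal_powr_def
    by (cases X) auto
  show W: "W < \<infinity>"
  proof (rule ccontr)
    assume "\<not> W < \<infinity>"
    then have "ennreal_powr W r = \<infinity>" by (auto simp: ennreal_powr_def less_top)
    then show False using assms(5) pos[OF assms(2), of q] by (simp add: ennreal_mult_eq_top_iff ennreal_top_mult top_unique)
  qed
  show S: "S < \<infinity>"
  proof (rule ccontr)
    assume "\<not> S < \<infinity>"
    then have "ennreal_powr S q = \<infinity>" by (auto simp: ennreal_powr_def less_top)
    then show False using assms(5) pos[OF assms(1), of r] by (simp add: ennreal_mult_top top_unique)
  qed
  have "ennreal (enn2real W powr r * enn2real S powr q) \<le> ennreal C"
    using assms(5) W S unfolding ennreal_powr_def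
    by (auto simp: ennreal_mult split: if_splits)
  moreover have "0 < enn2real W" "0 < enn2real S"
    using assms(1,2) W S by (auto simp: enn2real_positive_iff)
  then have "0 < enn2real W powr r * enn2real S powr q" by simp
  ultimately show "enn2real W powr r * enn2real S powr q \<le> C"
    by (metis ennreal_le_iff2 less_le_not_le order_less_imp_le)
qed

text \<open>The \<open>A_p^+\<close> condition for a Borel weight, raised to the power
  \<open>p\<close> and cleared of the averages: \<open>1 / h\<close> and
  \<open>(1 / h) powr (p - 1)\<close> move to the right as \<open>h powr p\<close>. The exponent
  \<open>1 - conj_exponent p\<close> is written out as \<open>-1 / (p - 1)\<close>. In view of
  \<open>finite_dual\<close>, \<open>enn2real\<close> loses nothing.\<close>

locale Ap_weight =
  fixes p C :: real and w :: "real \<Rightarrow> real"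
  assumes p_gt_1: "1 < p" and C_pos: "0 < C"
    and w_measurable [measurable]: "w \<in> borel_measurable borel"
    and w_pos: "0 < w x"
    and finite_weight: "0 < h \<Longrightarrow> (\<integral>\<^sup>+x. ennreal (w x) * indicator {a - h..a} x \<partial>lborel) < \<infinity>"
    and finite_dual: "0 < h \<Longrightarrow>
      (\<integral>\<^sup>+x. ennreal (w x powr (-1 / (p - 1))) * indicator {a..a + h} x \<partial>lborel) < \<infinity>"
    and Ap: "0 < h \<Longrightarrow> (\<integral>\<^sup>+x. ennreal (w x) * indicator {a - h..a} x \<partial>lborel) *
      ennreal (enn2real (\<integral>\<^sup>+x. ennreal (w x powr (-1 / (p - 1))) * indicator {a..a + h} x \<partial>lborel) powr (p - 1))
      \<le> ennreal (C * h powr p)"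

lemma Ap_plus_imp_Ap_weight:
  assumes p: "1 < p" and Ap: "Ap_plus p w" and w': "w' \<in> borel_measurable borel" "\<And>x. 0 < w' x"
    "AE x in lborel. w x = w' x"
  obtains C where "Ap_weight p C w'"
proof -
  have e: "1 - conj_exponent p = -1 / (p - 1)"
    using p by (simp add: conj_exponent_def field_simps)
  have wm [measurable]: "w \<in> borel_measurable lebesgue" and wp: "\<And>x. 0 < w x"
    using Ap by (auto simp: Ap_plus_def weight_def)
  obtain C where C: "0 < C" "\<And>a h. 0 < h \<Longrightarrow>
      ennreal_powr (ennreal (1 / h) * (\<integral>\<^sup>+x. ennreal (w x) * indicator {a - h..a} x \<partial>lebesgue)) (1 / p) *
      ennreal_powr (ennreal (1 / h) *
         (\<integral>\<^sup>+x. ennreal (w x powr (-1 / (p - 1))) * indicator {a..a + h} x \<partial>lebesgue)) (1 / conj_exponent p)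
        \<le> ennreal C"
    using Ap unfolding Ap_plus_def e by blast
  have main: "W < \<infinity> \<and> S < \<infinity> \<and> W * ennreal (enn2real S powr (p - 1)) \<le> ennreal (C powr p * h powr p)"
    if h: "0 < h" and W: "W = (\<integral>\<^sup>+x. ennreal (w' x) * indicator {a - h..a} x \<partial>lborel)"
      and S: "S = (\<integral>\<^sup>+x. ennreal (w' x powr (-1 / (p - 1))) * indicator {a..a + h} x \<partial>lborel)" for h a W S
  proof -
    have W': "(\<integral>\<^sup>+x. ennreal (w x) * indicator {a - h..a} x \<partial>lebesgue) = W"
      unfolding nn_integral_completion W using w'(3) by (intro nn_integral_cong_AE) auto
    have S': "(\<integral>\<^sup>+x. ennreal (w x powr (-1 / (p - 1))) * indicator {a..a + h} x \<partial>lebesgue) = S"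
      unfolding nn_integral_completion S using w'(3) by (intro nn_integral_cong_AE) auto
    have WS: "0 < W" "0 < S"
      unfolding W'[symmetric] S'[symmetric] using h wp
      by (intro nn_integral_interval_pos; simp add: less_le)+
    then have pos: "0 < ennreal (1 / h) * W" "0 < ennreal (1 / h) * S"
      using h by (auto simp: ennreal_zero_less_mult_iff)
    have q: "0 < 1 / p" "0 < 1 / conj_exponent p" using p by (auto simp: conj_exponent_def)
    note * = ennreal_powr_mult_le[OF pos q C(2)[OF h, of a, unfolded W' S']]
    have fin: "W < \<infinity>" "S < \<infinity>" using *(1,2) h by (auto simp: ennreal_mult_less_top)
    define W1 where "W1 = enn2real W"
    define S1 where "S1 = enn2real S"
    have pos1: "0 < W1" "0 < S1" using WS fin by (auto simp: W1_def S1_def enn2real_positive_iff)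
    have "(W1 / h) powr (1 / p) * (S1 / h) powr (1 / conj_exponent p) \<le> C"
      using *(3) h by (simp add: enn2real_mult W1_def S1_def)
    then have "((W1 / h) powr (1 / p) * (S1 / h) powr (1 / conj_exponent p)) powr p \<le> C powr p"
      using p by (intro powr_mono2) auto
    \<comment> \<open>The dual factor receives the exponent
      \<open>p / conj_exponent p = p - 1\<close>.\<close>
    then have "(W1 / h) * (S1 / h) powr (p - 1) \<le> C powr p"
      using p h pos1 by (simp add: powr_mult powr_powr conj_exponent_def)
    then have "(W1 / h) * (S1 / h) powr (p - 1) * h powr p \<le> C powr p * h powr p"
      by (rule mult_right_mono) simp
    also have "(W1 / h) * (S1 / h) powr (p - 1) * h powr p = W1 * S1 powr (p - 1)"
      using h pos1 by (simp add: powr_divide powr_diff)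
    finally have "ennreal (W1 * S1 powr (p - 1)) \<le> ennreal (C powr p * h powr p)"
      by (rule ennreal_leI)
    then show ?thesis using fin pos1 by (simp add: ennreal_mult W1_def S1_def)
  qed
  have "Ap_weight p (C powr p) w'"
    by unfold_locales (use p C(1) w' main in \<open>auto simp del: infinity_ennreal_def\<close>)
  then show ?thesis by (rule that)
qed

section \<open>Hoelder's inequality and linear growth of functions in L^p(w)\<close>

context Ap_weight
begin

definition Lp_mass :: "(real \<Rightarrow> real) \<Rightarrow> ennreal" where
  "Lp_mass f = (\<integral>\<^sup>+x. ennreal (\<bar>f x\<bar> powr p * w x) \<partial>lborel)"

definition dual_mass :: "real \<Rightarrow> real \<Rightarrow> real" where
  "dual_mass a b = enn2real (\<integral>\<^sup>+x. ennreal (w x powr (-1 / (p - 1))) * indicator {a..b} x \<partial>lborel)"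

lemma measurable_dual_mass [measurable]:
  assumes [measurable]: "f \<in> borel_measurable M" "g \<in> borel_measurable M"
  shows "(\<lambda>x. dual_mass (f x) (g x)) \<in> borel_measurable M"
  unfolding dual_mass_def by measurable

lemma dual_mass_finite:
  assumes "a < b"
  shows "(\<integral>\<^sup>+x. ennreal (w x powr (-1 / (p - 1))) * indicator {a..b} x \<partial>lborel) = ennreal (dual_mass a b)"
  using finite_dual[of "b - a" a] assms by (simp add: dual_mass_def)

lemma dual_mass_pos:
  assumes "a < b"
  shows "0 < dual_mass a b"
proof -
  have "0 < (\<integral>\<^sup>+x. ennreal (w x powr (-1 / (p - 1))) * indicator {a..b} x \<partial>lebesgue)"
    using w_pos assms by (intro nn_integral_interval_pos measurable_completion) (auto simp: less_le)
  then show ?thesis unfolding nn_integral_completion dual_mass_finite[OF assms] by simp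
qed

lemma dual_mass_mono:
  assumes "a \<le> a'" "a' < b'" "b' \<le> b"
  shows "dual_mass a' b' \<le> dual_mass a b"
proof -
  have "ennreal (dual_mass a' b') \<le> ennreal (dual_mass a b)"
    using assms
    by (subst (1 2) dual_mass_finite[symmetric]) (auto intro!: nn_integral_mono split: split_indicator)
  then show ?thesis by (simp add: dual_mass_def)
qed

text \<open>Jensen's inequality for the measure with density
  \<open>\<sigma> = w powr (-1 / (p - 1))\<close> and the function
  \<open>\<bar>f x\<bar> / \<sigma> x\<close>. The exponent satisfies
  \<open>\<sigma> powr (1 - p) = w\<close>, which turns the integrand on the right into
  \<open>\<bar>f x\<bar> powr p * w x\<close>.\<close>

lemma Hoelder_interval:
  assumes [measurable]: "f \<in> borel_measurable borel" and ab: "a < b"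
    and u: "0 \<le> u" "ennreal u \<le> (\<integral>\<^sup>+x. ennreal \<bar>f x\<bar> * indicator {a..b} x \<partial>lborel)"
  shows "ennreal (u powr p) \<le> ennreal (dual_mass a b powr (p - 1)) *
    (\<integral>\<^sup>+x. ennreal (\<bar>f x\<bar> powr p * w x) * indicator {a..b} x \<partial>lborel)"
proof -
  define \<sigma> where "\<sigma> x = w x powr (-1 / (p - 1))" for x
  have [measurable]: "\<sigma> \<in> borel_measurable borel" unfolding \<sigma>_def by measurable
  have \<sigma>: "0 < \<sigma> x" for x using w_pos[of x] by (auto simp: \<sigma>_def less_le)
  have \<sigma>p: "\<sigma> x / \<sigma> x powr p = w x" for x
  proof -
    have "\<sigma> x / \<sigma> x powr p = \<sigma> x powr (1 - p)" using \<sigma>[of x] by (simp add: powr_diff)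
    also have "\<dots> = w x powr ((-1 / (p - 1)) * (1 - p))" by (simp add: \<sigma>_def powr_powr)
    also have "(-1 / (p - 1)) * (1 - p) = 1" using p_gt_1 by (simp add: field_simps)
    finally show ?thesis using w_pos[of x] by simp
  qed
  have "ennreal (u powr p) \<le> ennreal (dual_mass a b powr (p - 1)) *
    (\<integral>\<^sup>+x. ennreal (\<sigma> x * indicator {a..b} x * (\<bar>f x\<bar> / \<sigma> x) powr p) \<partial>lborel)"
  proof (rule jensen_nn_integral[OF p_gt_1])
    have "(\<integral>\<^sup>+x. ennreal (\<sigma> x * indicator {a..b} x) \<partial>lborel) = ennreal (dual_mass a b)"
      by (subst dual_mass_finite[OF ab, symmetric])
        (auto simp: \<sigma>_def intro!: nn_integral_cong split: split_indicator)
    then show "(\<integral>\<^sup>+x. ennreal (\<sigma> x * indicator {a..b} x) \<partial>lborel) \<le> ennreal (dual_mass a b)" by simp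
    show "0 < dual_mass a b" using ab by (rule dual_mass_pos)
    have "(\<integral>\<^sup>+x. ennreal \<bar>f x\<bar> * indicator {a..b} x \<partial>lborel)
        = (\<integral>\<^sup>+x. ennreal (\<sigma> x * indicator {a..b} x * (\<bar>f x\<bar> / \<sigma> x)) \<partial>lborel)"
      using \<sigma> by (intro nn_integral_cong) (auto split: split_indicator simp: less_imp_neq[symmetric])
    then show "ennreal u \<le> (\<integral>\<^sup>+x. ennreal (\<sigma> x * indicator {a..b} x * (\<bar>f x\<bar> / \<sigma> x)) \<partial>lborel)"
      using u(2) by simp
  qed (use \<sigma> u(1) in \<open>auto simp: less_imp_le\<close>)
  also have "(\<integral>\<^sup>+x. ennreal (\<sigma> x * indicator {a..b} x * (\<bar>f x\<bar> / \<sigma> x) powr p) \<partial>lborel)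
      = (\<integral>\<^sup>+x. ennreal (\<bar>f x\<bar> powr p * w x) * indicator {a..b} x \<partial>lborel)"
  proof (intro nn_integral_cong)
    fix x
    have "\<sigma> x * (\<bar>f x\<bar> / \<sigma> x) powr p = \<bar>f x\<bar> powr p * w x"
      using \<sigma>[of x] by (subst \<sigma>p[symmetric]) (simp add: powr_divide)
    then show "ennreal (\<sigma> x * indicator {a..b} x * (\<bar>f x\<bar> / \<sigma> x) powr p)
        = ennreal (\<bar>f x\<bar> powr p * w x) * indicator {a..b} x"
      by (auto split: split_indicator)
  qed
  finally show ?thesis .
qed

text \<open>Hoelder's inequality reduces the claim to the dual mass of
  \<open>[a, a + 1 + h]\<close>. In the \<open>A_p^+\<close> condition at \<open>a\<close> the mass
  of \<open>w\<close> on \<open>[a - (1 + h), a]\<close> is bounded below by the mass on the fixed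
  interval \<open>[a - 1, a]\<close>, so the dual mass to the power \<open>p - 1\<close> is at most
  a constant times \<open>(1 + h) powr p\<close>. Lengthening the interval by 1 makes this lower
  bound possible.\<close>

lemma linear_growth_if_Lp:
  assumes fm [measurable]: "f \<in> borel_measurable borel" and fin: "Lp_mass f < \<infinity>"
  shows "linear_growth f"
  unfolding linear_growth_def
proof (intro conjI allI)
  fix a
  define N where "N = enn2real (Lp_mass f)"
  define W where "W = enn2real (\<integral>\<^sup>+x. ennreal (w x) * indicator {a - 1..a} x \<partial>lborel)"
  have W: "(\<integral>\<^sup>+x. ennreal (w x) * indicator {a - 1..a} x \<partial>lborel) = ennreal W"
    using finite_weight[of 1 a] by (simp add: W_def)
  have "0 < (\<integral>\<^sup>+x. ennreal (w x) * indicator {a - 1..a} x \<partial>lebesgue)"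
    using w_pos by (intro nn_integral_interval_pos measurable_completion) auto
  then have W_pos: "0 < W" unfolding nn_integral_completion W by simp
  have N: "0 \<le> N" "Lp_mass f = ennreal N" using fin by (auto simp: N_def)
  \<comment> \<open>Chosen so that \<open>C * (1 + h) powr p / W * N\<close> is the p-th power of
    \<open>K * (1 + h)\<close>.\<close>
  define K where "K = (C * N / W) powr (1 / p)"
  show "\<exists>K\<ge>0. \<forall>h\<ge>0. (\<integral>\<^sup>+y. ennreal \<bar>f y\<bar> * indicator {a..a+h} y \<partial>lborel) \<le> ennreal (K * (1 + h))"
  proof (intro exI[of _ K] conjI allI impI)
    show "0 \<le> K" by (simp add: K_def)
    fix h :: real assume h: "0 \<le> h"
    show "(\<integral>\<^sup>+y. ennreal \<bar>f y\<bar> * indicator {a..a+h} y \<partial>lborel) \<le> ennreal (K * (1 + h))"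
    proof (rule ennreal_le_if_real_le)
      show "0 \<le> K * (1 + h)" using h by (simp add: K_def)
      fix u :: real assume u: "0 \<le> u" "ennreal u \<le> (\<integral>\<^sup>+y. ennreal \<bar>f y\<bar> * indicator {a..a+h} y \<partial>lborel)"
      let ?S = "dual_mass a (a + (1 + h))"
      note u(2)
      also have "(\<integral>\<^sup>+y. ennreal \<bar>f y\<bar> * indicator {a..a+h} y \<partial>lborel)
          \<le> (\<integral>\<^sup>+y. ennreal \<bar>f y\<bar> * indicator {a..a+(1+h)} y \<partial>lborel)"
        by (intro nn_integral_mono) (auto split: split_indicator)
      finally have "ennreal (u powr p) \<le> ennreal (?S powr (p - 1)) *
          (\<integral>\<^sup>+x. ennreal (\<bar>f x\<bar> powr p * w x) * indicator {a..a+(1+h)} x \<partial>lborel)"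
        using h u(1) by (intro Hoelder_interval) auto
      also have "\<dots> \<le> ennreal (?S powr (p - 1)) * Lp_mass f"
        unfolding Lp_mass_def by (intro mult_left_mono nn_integral_mono) (auto split: split_indicator)
      finally have "ennreal (u powr p) \<le> ennreal (?S powr (p - 1) * N)"
        using N by (simp add: ennreal_mult)
      then have 1: "u powr p \<le> ?S powr (p - 1) * N"
        using N by (subst (asm) ennreal_le_iff) auto
      have "ennreal W * ennreal (?S powr (p - 1))
          \<le> (\<integral>\<^sup>+x. ennreal (w x) * indicator {a - (1 + h)..a} x \<partial>lborel) * ennreal (?S powr (p - 1))"
        unfolding W[symmetric] using h
        by (intro mult_right_mono nn_integral_mono) (auto split: split_indicator)
      also have "\<dots> \<le> ennreal (C * (1 + h) powr p)"
        using Ap[of "1 + h" a] h by (simp add: dual_mass_def)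
      finally have "W * ?S powr (p - 1) \<le> C * (1 + h) powr p"
        using W_pos C_pos by (simp add: ennreal_mult[symmetric])
      then have "?S powr (p - 1) \<le> C * (1 + h) powr p / W"
        using W_pos by (simp add: field_simps)
      then have "u powr p \<le> C * (1 + h) powr p / W * N"
        using 1 N mult_right_mono by (blast intro: order_trans)
      also have "\<dots> = (K * (1 + h)) powr p"
        using h p_gt_1 N W_pos C_pos by (simp add: K_def powr_mult powr_powr)
      finally show "u \<le> K * (1 + h)"
        using powr_less_mono2[of p "K * (1 + h)" u] p_gt_1 h by (force simp: K_def)
    qed
  qed
qed (use fm in auto)

end

section \<open>The uniform bound in $L^p(w)$\<close>

text \<open>
  The extension is dominated by a superposition of averages of \<open>f\<close> over the intervals
  $[x + r, x + 2r]$. As these are separated from \<open>x\<close>, Hoelder's inequality, Tonelli's theorem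
  and a single application of the $A_p^+$ condition bound each average in $L^p(w)$; no maximal function is needed.
\<close>

definition gap_avg :: "(real \<Rightarrow> real) \<Rightarrow> real \<Rightarrow> real \<Rightarrow> real" where
  "gap_avg f r x = enn2real (\<integral>\<^sup>+y. ennreal \<bar>f y\<bar> * indicator {x + r..x + 2 * r} y \<partial>lborel) / \<bar>r\<bar>"

lemma gap_avg_nonneg: "0 \<le> gap_avg f r x"
  by (simp add: gap_avg_def)

lemma measurable_gap_avg [measurable]:
  assumes [measurable]: "f \<in> borel_measurable borel" "g \<in> borel_measurable M" "h \<in> borel_measurable M"
  shows "(\<lambda>z. gap_avg f (g z) (h z)) \<in> borel_measurable M"
  unfolding gap_avg_def by measurable

lemma linear_growth_abs: "linear_growth f \<Longrightarrow> linear_growth (\<lambda>x. \<bar>f x\<bar>)"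
  unfolding linear_growth_def by (auto intro: borel_measurable_abs)

lemma linear_growth_finite:
  assumes "linear_growth f"
  shows "(\<integral>\<^sup>+y. ennreal \<bar>f y\<bar> * indicator {a..b} y \<partial>lborel) < \<infinity>"
proof -
  obtain K where K: "\<And>h. 0 \<le> h \<Longrightarrow> (\<integral>\<^sup>+y. ennreal \<bar>f y\<bar> * indicator {a..a+h} y \<partial>lborel) \<le> ennreal (K * (1 + h))"
    using assms unfolding linear_growth_def by metis
  have "(\<integral>\<^sup>+y. ennreal \<bar>f y\<bar> * indicator {a..b} y \<partial>lborel)
      \<le> (\<integral>\<^sup>+y. ennreal \<bar>f y\<bar> * indicator {a..a+\<bar>b - a\<bar>} y \<partial>lborel)"
    by (intro nn_integral_mono) (auto split: split_indicator)
  also have "\<dots> \<le> ennreal (K * (1 + \<bar>b - a\<bar>))" by (rule K) simp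
  finally show ?thesis by (simp add: order_le_less_trans)
qed

text \<open>Parabolic scaling: the exponent \<open>t\<^sup>2 / (4 * s)\<close> becomes
  \<open>1 / (4 * s)\<close> when \<open>s\<close> is measured in units of
  \<open>t\<^sup>2\<close>.\<close>

lemma ekern_scale:
  assumes "0 < t" "0 < s"
  shows "ekern b t (t\<^sup>2 * s) = t powr (-2 * b) * ekern b 1 s"
proof -
  have "(t\<^sup>2) powr (-b) = t powr (-2 * b)"
    using assms by (simp add: powr_powr flip: powr_numeral)
  moreover have "0 < t\<^sup>2 * s" using assms by simp
  ultimately show ?thesis
    using assms by (simp add: ekern_def powr_mult mult_le_0_iff)
qed

definition ext_const :: "real \<Rightarrow> real" where
  "ext_const \<alpha> = 1 / (4 powr \<alpha> * Gamma \<alpha>)"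

lemma ext_const_pos: "0 < \<alpha> \<Longrightarrow> 0 < ext_const \<alpha>"
  by (simp add: ext_const_def Gamma_real_pos)

lemma extension_abs_eq_nn_integral:
  assumes f: "linear_growth f" and a: "0 < \<alpha>" and t: "0 < t"
  shows "ennreal (extension \<alpha> (\<lambda>x. \<bar>f x\<bar>) x t) =
    ennreal (ext_const \<alpha> * t powr (2 * \<alpha>)) * (\<integral>\<^sup>+y. ennreal (ekern (1 + \<alpha>) t (y - x) * \<bar>f y\<bar>) \<partial>lborel)"
proof -
  have [measurable]: "f \<in> borel_measurable borel" using f by (rule linear_growth_measurable)
  have "integrable lborel (\<lambda>y. ekern (1 + \<alpha>) t (y - x) * \<bar>f y\<bar>)"
    using a t by (intro integrable_kconv linear_growth_abs f) auto
  then have "(\<integral>\<^sup>+y. ennreal (ekern (1 + \<alpha>) t (y - x) * \<bar>f y\<bar>) \<partial>lborel) = ennreal (kconv (1 + \<alpha>) (\<lambda>x. \<bar>f x\<bar>) x t)"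
    unfolding kconv_def by (rule nn_integral_eq_integral) (simp add: ekern_nonneg)
  moreover have "extension \<alpha> (\<lambda>x. \<bar>f x\<bar>) x t = (ext_const \<alpha> * t powr (2 * \<alpha>)) * kconv (1 + \<alpha>) (\<lambda>x. \<bar>f x\<bar>) x t"
    by (subst extension_eq_kconv) (auto simp: ext_const_def)
  ultimately show ?thesis
    using ext_const_pos[OF a] by (simp add: ennreal_mult')
qed

lemma extension_abs_nonneg:
  assumes f: "linear_growth f" and a: "0 < \<alpha>"
  shows "0 \<le> extension \<alpha> (\<lambda>x. \<bar>f x\<bar>) x t"
  unfolding extension_eq_kconv[OF linear_growth_measurable[OF linear_growth_abs[OF f]]] kconv_def
  using Gamma_real_pos[OF a] by (intro mult_nonneg_nonneg integral_nonneg_AE) (auto simp: ekern_nonneg)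

lemma abs_extension_le:
  assumes f: "linear_growth f" and a: "0 < \<alpha>"
  shows "\<bar>extension \<alpha> f x t\<bar> \<le> extension \<alpha> (\<lambda>x. \<bar>f x\<bar>) x t"
proof -
  note fm = linear_growth_measurable[OF f] linear_growth_measurable[OF linear_growth_abs[OF f]]
  have "\<bar>kconv (1 + \<alpha>) f x t\<bar> \<le> kconv (1 + \<alpha>) (\<lambda>x. \<bar>f x\<bar>) x t"
    using integral_abs_bound[of lborel "\<lambda>y. ekern (1 + \<alpha>) t (y - x) * f y"]
    by (simp add: kconv_def abs_mult ekern_nonneg)
  then show ?thesis
    unfolding extension_eq_kconv[OF fm(1)] extension_eq_kconv[OF fm(2)]
    using Gamma_real_pos[OF a] by (simp add: abs_mult divide_right_mono mult_left_mono)
qed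

text \<open>On \<open>[d/2, d]\<close> the integrand is at least its value at \<open>d\<close>, and
  the interval has length \<open>d / 2\<close>. With \<open>d\<close> read as the distance of two
  points, a decaying kernel is thereby dominated by a superposition of the kernels of averages over
  the distances from \<open>r\<close> to \<open>2 * r\<close>.\<close>

lemma gap_kernel_lower_bound:
  fixes b d :: real
  assumes "0 < b" "0 < d"
  shows "ennreal ((1 + d) powr (-b) / 2) \<le> (\<integral>\<^sup>+r. ennreal ((1 + r) powr (-b) / r) * indicator {d/2..d} r \<partial>lborel)"
proof -
  have "ennreal ((1 + d) powr (-b) / 2) = ennreal ((1 + d) powr (-b) / d) * ennreal (d / 2)"
    using assms by (simp add: ennreal_mult'[symmetric])
  also have "\<dots> = (\<integral>\<^sup>+r. ennreal ((1 + d) powr (-b) / d) * indicator {d/2..d} r \<partial>lborel)"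
    using assms by (subst nn_integral_cmult_indicator) auto
  also have "\<dots> \<le> (\<integral>\<^sup>+r. ennreal ((1 + r) powr (-b) / r) * indicator {d/2..d} r \<partial>lborel)"
  proof (rule nn_integral_mono)
    fix r
    have "(1 + d) powr (-b) / d \<le> (1 + r) powr (-b) / r" if "d / 2 \<le> r" "r \<le> d"
      using that assms by (intro frac_le powr_mono2') auto
    then show "ennreal ((1 + d) powr (-b) / d) * indicator {d/2..d} r
        \<le> ennreal ((1 + r) powr (-b) / r) * indicator {d/2..d} r"
      by (auto split: split_indicator intro: ennreal_leI)
  qed
  finally show ?thesis .
qed

text \<open>After Tonelli's theorem this is a comparison of kernels for each \<open>y\<close>. With
  \<open>d = (y - x) / t\<^sup>2\<close>, the point \<open>y\<close> lies in
  \<open>{x + t\<^sup>2 * r..x + 2 * (t\<^sup>2 * r)}\<close> exactly if \<open>r\<close> lies in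
  \<open>{d/2..d}\<close>. The constant is chosen before \<open>f\<close>, \<open>x\<close> and
  \<open>t\<close>, which later makes the bound in \<open>L^p(w)\<close> uniform.\<close>

lemma extension_abs_le_gap_avg:
  assumes a: "0 < \<alpha>"
  shows "\<exists>A>0. \<forall>f x t. linear_growth f \<longrightarrow> 0 < t \<longrightarrow>
    ennreal (extension \<alpha> (\<lambda>x. \<bar>f x\<bar>) x t) \<le> ennreal A *
     (\<integral>\<^sup>+r. ennreal (indicator {0<..} r * (1 + r) powr (-1 - \<alpha>) * gap_avg f (t\<^sup>2 * r) x) \<partial>lborel)"
proof -
  obtain M where M: "0 \<le> M" "\<And>t s. 1 \<le> t \<Longrightarrow> 0 < s \<Longrightarrow> ekern (1 + \<alpha>) t s \<le> M * (1 + s) powr (-(1 + \<alpha>))"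
    using ekern_bound[of "1 + \<alpha>" 1] a by (metis add_pos_pos zero_less_one)
  \<comment> \<open>The 2 compensates the 1/2 in \<open>gap_kernel_lower_bound\<close>;
    \<open>M + 1\<close> replaces \<open>M\<close> to make \<open>A\<close> positive.\<close>
  define A where "A = 2 * ext_const \<alpha> * (M + 1)"
  have A: "0 < A" using ext_const_pos[OF a] M by (simp add: A_def)
  show ?thesis
  proof (intro exI[of _ A] conjI A allI impI)
    fix f :: "real \<Rightarrow> real" and x t :: real
    assume f: "linear_growth f" and t: "0 < t"
    have [measurable]: "f \<in> borel_measurable borel" using f by (rule linear_growth_measurable)
    let ?H = "\<lambda>r y. ennreal (indicator {0<..} r * (1 + r) powr (-1 - \<alpha>) / (t\<^sup>2 * r)) *
      (ennreal \<bar>f y\<bar> * indicator {x + t\<^sup>2 * r..x + 2 * (t\<^sup>2 * r)} y)"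
    have avg: "ennreal (indicator {0<..} r * (1 + r) powr (-1 - \<alpha>) * gap_avg f (t\<^sup>2 * r) x)
      = (\<integral>\<^sup>+y. ?H r y \<partial>lborel)" for r
    proof (cases "0 < r")
      case True
      define I where "I = (\<integral>\<^sup>+y. ennreal \<bar>f y\<bar> * indicator {x + t\<^sup>2 * r..x + 2 * (t\<^sup>2 * r)} y \<partial>lborel)"
      have "I = ennreal (enn2real I)"
        unfolding I_def using linear_growth_finite[OF f, of "x + t\<^sup>2 * r" "x + 2 * (t\<^sup>2 * r)"] by simp
      moreover have "(1 + r) powr (-1 - \<alpha>) * gap_avg f (t\<^sup>2 * r) x
          = (1 + r) powr (-1 - \<alpha>) / (t\<^sup>2 * r) * enn2real I"
        using True t by (simp add: gap_avg_def I_def[symmetric] abs_mult)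
      moreover have "(\<integral>\<^sup>+y. ?H r y \<partial>lborel)
          = ennreal ((1 + r) powr (-1 - \<alpha>) / (t\<^sup>2 * r)) * I"
        unfolding I_def using True by (subst nn_integral_cmult) auto
      moreover have "ennreal ((1 + r) powr (-1 - \<alpha>) / (t\<^sup>2 * r) * enn2real I)
          = ennreal ((1 + r) powr (-1 - \<alpha>) / (t\<^sup>2 * r)) * ennreal (enn2real I)"
        by (rule ennreal_mult') (use True in auto)
      moreover have "indicator {0<..} r = (1::real)" using True by simp
      ultimately show ?thesis by (simp only: mult_1)
    qed simp
    have "ennreal A * (\<integral>\<^sup>+r. ennreal (indicator {0<..} r * (1 + r) powr (-1 - \<alpha>) * gap_avg f (t\<^sup>2 * r) x) \<partial>lborel)
      = ennreal A * (\<integral>\<^sup>+r. \<integral>\<^sup>+y. ?H r y \<partial>lborel \<partial>lborel)"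
      unfolding avg ..
    also have "\<dots> = ennreal A * (\<integral>\<^sup>+y. \<integral>\<^sup>+r. ?H r y \<partial>lborel \<partial>lborel)"
    proof (rule arg_cong[where f = "\<lambda>X. ennreal A * X"], rule lborel_pair.Fubini')
      have [measurable]: "Measurable.pred (borel \<Otimes>\<^sub>M borel) (\<lambda>z::real \<times> real. fst z \<in> {x + t\<^sup>2 * snd z..x + 2 * (t\<^sup>2 * snd z)})"
        unfolding atLeastAtMost_iff by measurable
      show "(\<lambda>(y, r). ?H r y) \<in> borel_measurable (lborel \<Otimes>\<^sub>M lborel)"
        by measurable
    qed
    finally have rhs: "ennreal A * (\<integral>\<^sup>+r. ennreal (indicator {0<..} r * (1 + r) powr (-1 - \<alpha>) * gap_avg f (t\<^sup>2 * r) x) \<partial>lborel)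
      = ennreal A * (\<integral>\<^sup>+y. \<integral>\<^sup>+r. ?H r y \<partial>lborel \<partial>lborel)" .
    have "ennreal (extension \<alpha> (\<lambda>x. \<bar>f x\<bar>) x t) =
      ennreal (ext_const \<alpha> * t powr (2 * \<alpha>)) * (\<integral>\<^sup>+y. ennreal (ekern (1 + \<alpha>) t (y - x) * \<bar>f y\<bar>) \<partial>lborel)"
      by (rule extension_abs_eq_nn_integral[OF f a t])
    also have "\<dots> = (\<integral>\<^sup>+y. ennreal (ext_const \<alpha> * t powr (2 * \<alpha>)) * ennreal (ekern (1 + \<alpha>) t (y - x) * \<bar>f y\<bar>) \<partial>lborel)"
      by (rule nn_integral_cmult[symmetric]) measurable
    also have "\<dots> \<le> (\<integral>\<^sup>+y. ennreal A * (\<integral>\<^sup>+r. ?H r y \<partial>lborel) \<partial>lborel)"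
    proof (rule nn_integral_mono)
      fix y
      show "ennreal (ext_const \<alpha> * t powr (2 * \<alpha>)) * ennreal (ekern (1 + \<alpha>) t (y - x) * \<bar>f y\<bar>)
        \<le> ennreal A * (\<integral>\<^sup>+r. ?H r y \<partial>lborel)"
      proof (cases "y \<le> x")
        case False
        define d where "d = (y - x) / t\<^sup>2"
        have d: "0 < d" "y - x = t\<^sup>2 * d" using False t by (auto simp: d_def)
        have "ekern (1 + \<alpha>) t (y - x) = t powr (-2 * (1 + \<alpha>)) * ekern (1 + \<alpha>) 1 d"
          unfolding d(2) by (rule ekern_scale[OF t d(1)])
        also have "\<dots> \<le> t powr (-2 * (1 + \<alpha>)) * ((M + 1) * (1 + d) powr (-(1 + \<alpha>)))"
        proof (rule mult_left_mono)
          have "ekern (1 + \<alpha>) 1 d \<le> M * (1 + d) powr (-(1 + \<alpha>))" using M(2)[of 1 d] d by simp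
          also have "\<dots> \<le> (M + 1) * (1 + d) powr (-(1 + \<alpha>))" by (intro mult_right_mono) auto
          finally show "ekern (1 + \<alpha>) 1 d \<le> (M + 1) * (1 + d) powr (-(1 + \<alpha>))" .
        qed simp
        finally have "ext_const \<alpha> * t powr (2 * \<alpha>) * ekern (1 + \<alpha>) t (y - x)
            \<le> ext_const \<alpha> * t powr (2 * \<alpha>) * (t powr (-2 * (1 + \<alpha>)) * ((M + 1) * (1 + d) powr (-(1 + \<alpha>))))"
          using ext_const_pos[OF a] by (intro mult_left_mono) auto
        also have "\<dots> = ext_const \<alpha> * (t powr (2 * \<alpha>) * t powr (-2 * (1 + \<alpha>))) * ((M + 1) * (1 + d) powr (-(1 + \<alpha>)))"
          by simp
        \<comment> \<open>What remains of the powers of \<open>t\<close> is exactly the factor that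
          an average over an interval of length \<open>t\<^sup>2 * r\<close> provides.\<close>
        also have "t powr (2 * \<alpha>) * t powr (-2 * (1 + \<alpha>)) = t powr (- 2)"
          by (subst powr_add[symmetric]) (simp add: algebra_simps)
        also have "\<dots> = 1 / t\<^sup>2"
          using t by (simp add: powr_minus field_simps)
        also have "ext_const \<alpha> * (1 / t\<^sup>2) * ((M + 1) * (1 + d) powr (-(1 + \<alpha>)))
            = A / t\<^sup>2 * ((1 + d) powr (-(1 + \<alpha>)) / 2)"
          by (simp add: A_def)
        finally have "ennreal (ext_const \<alpha> * t powr (2 * \<alpha>) * ekern (1 + \<alpha>) t (y - x))
            \<le> ennreal (A / t\<^sup>2) * ennreal ((1 + d) powr (-(1 + \<alpha>)) / 2)"
          using A by (subst ennreal_mult[symmetric]) (auto intro: ennreal_leI)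
        also have "\<dots> \<le> ennreal (A / t\<^sup>2) *
            (\<integral>\<^sup>+r. ennreal ((1 + r) powr (-(1 + \<alpha>)) / r) * indicator {d/2..d} r \<partial>lborel)"
          by (intro mult_left_mono gap_kernel_lower_bound) (use a d in auto)
        finally have 1: "ennreal (ext_const \<alpha> * t powr (2 * \<alpha>) * ekern (1 + \<alpha>) t (y - x)) \<le> ennreal (A / t\<^sup>2) *
            (\<integral>\<^sup>+r. ennreal ((1 + r) powr (-(1 + \<alpha>)) / r) * indicator {d/2..d} r \<partial>lborel)" .
        have iff: "r \<in> {d/2..d} \<longleftrightarrow> y \<in> {x + t\<^sup>2 * r..x + 2 * (t\<^sup>2 * r)}" for r
        proof -
          have "y = x + t\<^sup>2 * d" using d(2) by simp
          then show ?thesis using t by (auto simp: field_simps)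
        qed
        have "ennreal (ext_const \<alpha> * t powr (2 * \<alpha>)) * ennreal (ekern (1 + \<alpha>) t (y - x) * \<bar>f y\<bar>)
          = ennreal (ext_const \<alpha> * t powr (2 * \<alpha>) * ekern (1 + \<alpha>) t (y - x)) * ennreal \<bar>f y\<bar>"
          using ext_const_pos[OF a] by (simp add: ennreal_mult'[symmetric] ekern_nonneg mult.assoc)
        also have "\<dots> \<le> ennreal (A / t\<^sup>2) *
            (\<integral>\<^sup>+r. ennreal ((1 + r) powr (-(1 + \<alpha>)) / r) * indicator {d/2..d} r \<partial>lborel) * ennreal \<bar>f y\<bar>"
          using 1 by (rule mult_right_mono) simp
        also have "\<dots> = (\<integral>\<^sup>+r. ennreal (A / t\<^sup>2) * (ennreal ((1 + r) powr (-(1 + \<alpha>)) / r) * indicator {d/2..d} r) * ennreal \<bar>f y\<bar> \<partial>lborel)"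
          by (subst nn_integral_cmult[symmetric], simp, subst nn_integral_multc[symmetric]) auto
        also have "\<dots> = (\<integral>\<^sup>+r. ennreal A * (?H r y) \<partial>lborel)"
        proof (rule nn_integral_cong)
          fix r
          show "ennreal (A / t\<^sup>2) * (ennreal ((1 + r) powr (-(1 + \<alpha>)) / r) * indicator {d/2..d} r) * ennreal \<bar>f y\<bar>
            = ennreal A * (?H r y)"
          proof (cases "r \<in> {d/2..d}")
            case True
            then have r: "0 < r" using d by auto
            have i1: "indicator {d/2..d} r = (1::ennreal)"
              using True by (rule indicator_simps(1))
            have i2: "indicator {x + t\<^sup>2 * r..x + 2 * (t\<^sup>2 * r)} y = (1::ennreal)"
              using True unfolding iff by (rule indicator_simps(1))
            have i3: "indicator {0<..} r = (1::real)" using r by simp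
            have e: "-(1 + \<alpha>) = -1 - \<alpha>" by simp
            have "ennreal (A / t\<^sup>2) * ennreal ((1 + r) powr (-1 - \<alpha>) / r)
                = ennreal A * ennreal ((1 + r) powr (-1 - \<alpha>) / (t\<^sup>2 * r))"
              using A r t by (subst (1 2) ennreal_mult'[symmetric]) auto
            then show ?thesis
              unfolding i1 i2 i3 e mult_1 mult_1_right by (simp only: mult.assoc[symmetric])
          next
            case False
            have i1: "indicator {d/2..d} r = (0::ennreal)"
              using False by (rule indicator_simps(2))
            have i2: "indicator {x + t\<^sup>2 * r..x + 2 * (t\<^sup>2 * r)} y = (0::ennreal)"
              using False unfolding iff by (rule indicator_simps(2))
            show ?thesis unfolding i1 i2 by simp
          qed
        qed
        also have "\<dots> = ennreal A * (\<integral>\<^sup>+r. ?H r y \<partial>lborel)"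
        proof (rule nn_integral_cmult)
          have [measurable]: "Measurable.pred borel (\<lambda>r::real. y \<in> {x + t\<^sup>2 * r..x + 2 * (t\<^sup>2 * r)})"
            unfolding atLeastAtMost_iff by measurable
          show "(\<lambda>r. ?H r y) \<in> borel_measurable lborel"
            by measurable
        qed
        finally show ?thesis .
      qed (simp add: ekern_eq_0)
    qed
    also have "\<dots> = ennreal A * (\<integral>\<^sup>+y. \<integral>\<^sup>+r. ?H r y \<partial>lborel \<partial>lborel)"
    proof (rule nn_integral_cmult)
      have [measurable]: "Measurable.pred (borel \<Otimes>\<^sub>M borel) (\<lambda>z::real \<times> real. fst z \<in> {x + t\<^sup>2 * snd z..x + 2 * (t\<^sup>2 * snd z)})"
        unfolding atLeastAtMost_iff by measurable
      show "(\<lambda>y. \<integral>\<^sup>+r. ?H r y \<partial>lborel) \<in> borel_measurable lborel"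
        by measurable
    qed
    finally show "ennreal (extension \<alpha> (\<lambda>x. \<bar>f x\<bar>) x t) \<le> ennreal A *
     (\<integral>\<^sup>+r. ennreal (indicator {0<..} r * (1 + r) powr (-1 - \<alpha>) * gap_avg f (t\<^sup>2 * r) x) \<partial>lborel)"
      unfolding rhs .
  qed
qed

lemma borel_measurable_extension:
  assumes f: "linear_growth f" and a: "0 < \<alpha>" and t: "0 < t"
  shows "(\<lambda>x. extension \<alpha> f x t) \<in> borel_measurable borel"
proof -
  have [measurable]: "f \<in> borel_measurable borel" using f by (rule linear_growth_measurable)
  show ?thesis
    unfolding extension_eq_kconv[OF linear_growth_measurable[OF f]] kconv_def by measurable
qed

section \<open>Bounds in L^p(w) for the averages and for the extension\<close>

context Ap_weight
begin

lemma Lp_mass_gap_avg: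
  assumes [measurable]: "f \<in> borel_measurable borel" and r: "0 < r"
  shows "Lp_mass (gap_avg f r) \<le> ennreal (C * 2 powr p) * Lp_mass f"
proof -
  let ?G = "\<lambda>y. ennreal (\<bar>f y\<bar> powr p * w y)"
  let ?H = "\<lambda>x y. ennreal (w x) * indicator {y - 2 * r..y - r} x * (ennreal (dual_mass (y - r) (y + r) powr (p - 1)) * ?G y)"
  have pointwise: "ennreal (\<bar>gap_avg f r x\<bar> powr p * w x) \<le> ennreal (r powr (-p)) * (\<integral>\<^sup>+y. ?H x y \<partial>lborel)" for x
  proof -
    define u where "u = enn2real (\<integral>\<^sup>+y. ennreal \<bar>f y\<bar> * indicator {x + r..x + 2 * r} y \<partial>lborel)"
    have u: "0 \<le> u" "ennreal u \<le> (\<integral>\<^sup>+y. ennreal \<bar>f y\<bar> * indicator {x + r..x + 2 * r} y \<partial>lborel)"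
      by (auto simp: u_def ennreal_enn2real_if)
    have "ennreal (\<bar>gap_avg f r x\<bar> powr p * w x) = ennreal (r powr (-p)) * (ennreal (w x) * ennreal (u powr p))"
    proof -
      have "gap_avg f r x = u / r" using r by (simp add: gap_avg_def u_def)
      then have "\<bar>gap_avg f r x\<bar> powr p = r powr (-p) * u powr p"
        using r u(1) powr_divide[of u r p] powr_minus_divide[of r p] by (simp del: powr_divide)
      then show ?thesis
        using w_pos[of x] by (simp add: ennreal_mult'[symmetric] mult_ac)
    qed
    also have "\<dots> \<le> ennreal (r powr (-p)) * (ennreal (w x) * (ennreal (dual_mass (x + r) (x + 2 * r) powr (p - 1)) *
        (\<integral>\<^sup>+y. ?G y * indicator {x + r..x + 2 * r} y \<partial>lborel)))"
      using u r by (intro mult_left_mono Hoelder_interval) auto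
    also have "\<dots> = ennreal (r powr (-p)) * (\<integral>\<^sup>+y. ennreal (w x) * (ennreal (dual_mass (x + r) (x + 2 * r) powr (p - 1)) *
        (?G y * indicator {x + r..x + 2 * r} y)) \<partial>lborel)"
      by (simp add: nn_integral_cmult)
    also have "\<dots> \<le> ennreal (r powr (-p)) * (\<integral>\<^sup>+y. ?H x y \<partial>lborel)"
    proof (rule mult_left_mono, rule nn_integral_mono)
      fix y
      show "ennreal (w x) * (ennreal (dual_mass (x + r) (x + 2 * r) powr (p - 1)) *
        (?G y * indicator {x + r..x + 2 * r} y)) \<le> ?H x y"
      proof (cases "y \<in> {x + r..x + 2 * r}")
        case True
        \<comment> \<open>The averaging interval is enlarged to \<open>[y - r, y + r]\<close>, which
          does not depend on \<open>x\<close>. After Tonelli's theorem the inner integral over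
          \<open>x\<close> then involves the weight only.\<close>
        then have "dual_mass (x + r) (x + 2 * r) \<le> dual_mass (y - r) (y + r)"
          using r by (intro dual_mass_mono) auto
        then have "ennreal (dual_mass (x + r) (x + 2 * r) powr (p - 1)) \<le> ennreal (dual_mass (y - r) (y + r) powr (p - 1))"
          using p_gt_1 by (intro ennreal_leI powr_mono2) (auto simp: dual_mass_def)
        then show ?thesis
          using True by (auto intro!: mult_left_mono mult_right_mono)
      qed simp
    qed simp
    finally show ?thesis .
  qed
  have [measurable]: "Measurable.pred (borel \<Otimes>\<^sub>M borel) (\<lambda>z::real \<times> real. fst z \<in> {snd z - 2 * r..snd z - r})"
    "Measurable.pred (borel \<Otimes>\<^sub>M borel) (\<lambda>z::real \<times> real. snd z \<in> {fst z - 2 * r..fst z - r})"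
    unfolding atLeastAtMost_iff by measurable
  have "Lp_mass (gap_avg f r) \<le> (\<integral>\<^sup>+x. ennreal (r powr (-p)) * (\<integral>\<^sup>+y. ?H x y \<partial>lborel) \<partial>lborel)"
    unfolding Lp_mass_def by (intro nn_integral_mono pointwise)
  also have "\<dots> = ennreal (r powr (-p)) * (\<integral>\<^sup>+x. \<integral>\<^sup>+y. ?H x y \<partial>lborel \<partial>lborel)"
    by (rule nn_integral_cmult) measurable
  also have "(\<integral>\<^sup>+x. \<integral>\<^sup>+y. ?H x y \<partial>lborel \<partial>lborel) = (\<integral>\<^sup>+y. \<integral>\<^sup>+x. ?H x y \<partial>lborel \<partial>lborel)"
    by (rule lborel_pair.Fubini') measurable
  also have "\<dots> \<le> (\<integral>\<^sup>+y. ennreal (C * (2 * r) powr p) * ?G y \<partial>lborel)"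
  proof (rule nn_integral_mono)
    fix y
    have "(\<integral>\<^sup>+x. ?H x y \<partial>lborel)
      = (\<integral>\<^sup>+x. ennreal (w x) * indicator {y - 2 * r..y - r} x \<partial>lborel) * (ennreal (dual_mass (y - r) (y + r) powr (p - 1)) * ?G y)"
      by (rule nn_integral_multc) measurable
    \<comment> \<open>The point \<open>y - r\<close> separates \<open>x\<close> from the enlarged
      interval: \<open>[y - 2 * r, y - r]\<close> is part of the left half
      \<open>[y - 3 * r, y - r]\<close> of an \<open>A_p^+\<close> pair with
      \<open>h = 2 * r\<close>, whose right half is \<open>[y - r, y + r]\<close>.\<close>
    also have "\<dots> \<le> (\<integral>\<^sup>+x. ennreal (w x) * indicator {(y - r) - 2 * r..y - r} x \<partial>lborel) *
        (ennreal (dual_mass (y - r) ((y - r) + 2 * r) powr (p - 1)) * ?G y)"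
      using r by (intro mult_mono nn_integral_mono) (auto split: split_indicator simp: add.commute)
    also have "\<dots> \<le> ennreal (C * (2 * r) powr p) * ?G y"
      unfolding mult.assoc[symmetric] using Ap[of "2 * r" "y - r"] r
      by (intro mult_right_mono) (auto simp: dual_mass_def)
    finally show "(\<integral>\<^sup>+x. ?H x y \<partial>lborel) \<le> ennreal (C * (2 * r) powr p) * ?G y" .
  qed
  also have "\<dots> = ennreal (C * (2 * r) powr p) * Lp_mass f"
    unfolding Lp_mass_def by (rule nn_integral_cmult) measurable
  also have "ennreal (r powr (-p)) * (ennreal (C * (2 * r) powr p) * Lp_mass f) = ennreal (C * 2 powr p) * Lp_mass f"
  proof -
    have "r powr (-p) * (C * (2 * r) powr p) = C * 2 powr p"
      using r by (simp add: powr_mult powr_minus)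
    then show ?thesis
      by (simp only: mult.assoc[symmetric] ennreal_mult'[OF powr_ge_zero, symmetric])
  qed
  finally show ?thesis by (simp add: mult_left_mono)
qed

lemma Lp_mass_extension_bound:
  assumes a: "0 < \<alpha>"
  shows "\<exists>D\<ge>0. \<forall>f t. linear_growth f \<longrightarrow> 0 < t \<longrightarrow>
    Lp_mass (\<lambda>x. extension \<alpha> (\<lambda>x. \<bar>f x\<bar>) x t) \<le> ennreal D * Lp_mass f"
proof -
  obtain A where A: "0 < A" "\<And>f x t. linear_growth f \<Longrightarrow> 0 < t \<Longrightarrow>
    ennreal (extension \<alpha> (\<lambda>x. \<bar>f x\<bar>) x t) \<le> ennreal A *
     (\<integral>\<^sup>+r. ennreal (indicator {0<..} r * (1 + r) powr (-1 - \<alpha>) * gap_avg f (t\<^sup>2 * r) x) \<partial>lborel)"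
    using extension_abs_le_gap_avg[OF a] by blast
  \<comment> \<open>The integral of \<open>(1 + r) powr (-1 - \<alpha>)\<close> over the half-line,
    that is the total mass of the superposition.\<close>
  define K where "K = 1 / \<alpha>"
  have K: "0 < K" using a by (simp add: K_def)
  define k where "k r = indicator {0<..} r * (1 + r) powr (-1 - \<alpha>)" for r :: real
  have [measurable]: "k \<in> borel_measurable borel" unfolding k_def by measurable
  have k_nn: "0 \<le> k r" for r by (simp add: k_def)
  have k_int: "(\<integral>\<^sup>+r. ennreal (k r) \<partial>lborel) \<le> ennreal K"
  proof -
    have "(\<integral>\<^sup>+r. ennreal (k r) \<partial>lborel) \<le> (\<integral>\<^sup>+u. ennreal ((1 + u) powr (-1 - \<alpha>)) * indicator {0..} u \<partial>lborel)"
      by (intro nn_integral_mono) (auto simp: k_def split: split_indicator)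
    also have "\<dots> = ennreal K" using a by (subst nn_integral_powr_tail) (auto simp: K_def)
    finally show ?thesis .
  qed
  \<comment> \<open>\<open>A powr p\<close> comes from dividing the extension by \<open>A\<close>,
    \<open>K powr (p - 1)\<close> from Jensen's inequality in \<open>r\<close>, and the last
    \<open>K\<close> from integrating the bound \<open>C * 2 powr p\<close> for each average against
    \<open>k\<close>.\<close>
  define D where "D = A powr p * K powr (p - 1) * (K * (C * 2 powr p))"
  show ?thesis
  proof (intro exI[of _ D] conjI allI impI)
    show "0 \<le> D" using K C_pos by (simp add: D_def)
    fix f :: "real \<Rightarrow> real" and t :: real
    assume f: "linear_growth f" and t: "0 < t"
    have [measurable]: "f \<in> borel_measurable borel" using f by (rule linear_growth_measurable)
    let ?U = "\<lambda>x. extension \<alpha> (\<lambda>x. \<bar>f x\<bar>) x t"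
    let ?a = "\<lambda>r x. gap_avg f (t\<^sup>2 * r) x"
    have pointwise: "ennreal (\<bar>?U x\<bar> powr p * w x) \<le> ennreal (A powr p * K powr (p - 1)) *
        (\<integral>\<^sup>+r. ennreal (k r) * ennreal (\<bar>?a r x\<bar> powr p * w x) \<partial>lborel)" for x
    proof -
      have U: "0 \<le> ?U x" by (rule extension_abs_nonneg[OF f a])
      have "ennreal (?U x / A) = ennreal (1 / A) * ennreal (?U x)"
        using A U by (simp add: ennreal_mult'[symmetric])
      also have "\<dots> \<le> ennreal (1 / A) * (ennreal A * (\<integral>\<^sup>+r. ennreal (k r * ?a r x) \<partial>lborel))"
        using A(2)[OF f t, of x] by (intro mult_left_mono) (auto simp: k_def)
      also have "\<dots> = (\<integral>\<^sup>+r. ennreal (k r * ?a r x) \<partial>lborel)"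
        using A(1) by (simp add: mult.assoc[symmetric] ennreal_mult'[symmetric])
      finally have "ennreal ((?U x / A) powr p) \<le> ennreal (K powr (p - 1)) *
          (\<integral>\<^sup>+r. ennreal (k r * ?a r x powr p) \<partial>lborel)"
        using U A(1) by (intro jensen_nn_integral[OF p_gt_1] k_nn gap_avg_nonneg k_int K) auto
      then have "ennreal (A powr p * w x) * ennreal ((?U x / A) powr p) \<le> ennreal (A powr p * w x) * (ennreal (K powr (p - 1)) *
          (\<integral>\<^sup>+r. ennreal (k r * ?a r x powr p) \<partial>lborel))"
        by (rule mult_left_mono) simp
      also have "\<dots> = ennreal (A powr p * K powr (p - 1)) *
          (ennreal (w x) * (\<integral>\<^sup>+r. ennreal (k r * ?a r x powr p) \<partial>lborel))"
      proof -
        have "ennreal (a * b) * (ennreal c * J) = ennreal (a * c) * (ennreal b * J)"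
          if "0 \<le> a" "0 \<le> b" "0 \<le> c" for a b c J
          using that by (simp add: ennreal_mult mult_ac)
        then show ?thesis using w_pos[of x] by simp
      qed
      also have "ennreal (w x) * (\<integral>\<^sup>+r. ennreal (k r * ?a r x powr p) \<partial>lborel)
          = (\<integral>\<^sup>+r. ennreal (k r) * ennreal (\<bar>?a r x\<bar> powr p * w x) \<partial>lborel)"
      proof (subst nn_integral_cmult[symmetric])
        show "(\<integral>\<^sup>+r. ennreal (w x) * ennreal (k r * ?a r x powr p) \<partial>lborel)
          = (\<integral>\<^sup>+r. ennreal (k r) * ennreal (\<bar>?a r x\<bar> powr p * w x) \<partial>lborel)"
          using w_pos[of x] k_nn gap_avg_nonneg
          by (intro nn_integral_cong) (simp add: ennreal_mult'[symmetric] mult_ac)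
      qed measurable
      also have "ennreal (A powr p * w x) * ennreal ((?U x / A) powr p) = ennreal (\<bar>?U x\<bar> powr p * w x)"
        using U A(1) w_pos[of x] by (simp add: ennreal_mult'[symmetric] powr_divide)
      finally show ?thesis .
    qed
    have "Lp_mass ?U \<le> (\<integral>\<^sup>+x. ennreal (A powr p * K powr (p - 1)) *
        (\<integral>\<^sup>+r. ennreal (k r) * ennreal (\<bar>?a r x\<bar> powr p * w x) \<partial>lborel) \<partial>lborel)"
      unfolding Lp_mass_def by (intro nn_integral_mono pointwise)
    also have "\<dots> = ennreal (A powr p * K powr (p - 1)) *
        (\<integral>\<^sup>+x. \<integral>\<^sup>+r. ennreal (k r) * ennreal (\<bar>?a r x\<bar> powr p * w x) \<partial>lborel \<partial>lborel)"
      by (rule nn_integral_cmult) measurable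
    also have "(\<integral>\<^sup>+x. \<integral>\<^sup>+r. ennreal (k r) * ennreal (\<bar>?a r x\<bar> powr p * w x) \<partial>lborel \<partial>lborel)
        = (\<integral>\<^sup>+r. \<integral>\<^sup>+x. ennreal (k r) * ennreal (\<bar>?a r x\<bar> powr p * w x) \<partial>lborel \<partial>lborel)"
      by (rule lborel_pair.Fubini') measurable
    also have "\<dots> \<le> (\<integral>\<^sup>+r. ennreal (k r) * (ennreal (C * 2 powr p) * Lp_mass f) \<partial>lborel)"
    proof (rule nn_integral_mono)
      fix r
      have "(\<integral>\<^sup>+x. ennreal (k r) * ennreal (\<bar>?a r x\<bar> powr p * w x) \<partial>lborel)
          = ennreal (k r) * Lp_mass (gap_avg f (t\<^sup>2 * r))"
        unfolding Lp_mass_def by (rule nn_integral_cmult) measurable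
      also have "\<dots> \<le> ennreal (k r) * (ennreal (C * 2 powr p) * Lp_mass f)"
      proof (cases "0 < r")
        case True
        then show ?thesis using t by (intro mult_left_mono Lp_mass_gap_avg) auto
      qed (simp add: k_def)
      finally show "(\<integral>\<^sup>+x. ennreal (k r) * ennreal (\<bar>?a r x\<bar> powr p * w x) \<partial>lborel)
        \<le> ennreal (k r) * (ennreal (C * 2 powr p) * Lp_mass f)" .
    qed
    also have "\<dots> = (\<integral>\<^sup>+r. ennreal (k r) \<partial>lborel) * (ennreal (C * 2 powr p) * Lp_mass f)"
      by (rule nn_integral_multc) measurable
    also have "\<dots> \<le> ennreal K * (ennreal (C * 2 powr p) * Lp_mass f)"
      using k_int by (rule mult_right_mono) simp
    finally have "Lp_mass ?U \<le> ennreal (A powr p * K powr (p - 1)) * (ennreal K * (ennreal (C * 2 powr p) * Lp_mass f))"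
      by (simp add: mult_left_mono)
    also have "\<dots> = ennreal D * Lp_mass f"
      using K C_pos by (simp add: D_def mult.assoc[symmetric] ennreal_mult'[symmetric])
    finally show "Lp_mass ?U \<le> ennreal D * Lp_mass f" .
  qed
qed

end

section \<open>Convergence almost everywhere\<close>

lemma integral_FTC_atLeast_real:
  fixes F f :: "real \<Rightarrow> real"
  assumes deriv: "\<And>x. a \<le> x \<Longrightarrow> (F has_real_derivative f x) (at x)"
    and cont: "\<And>x. a \<le> x \<Longrightarrow> isCont f x"
    and [measurable]: "f \<in> borel_measurable borel"
    and int: "integrable lborel (\<lambda>x. indicator {a..} x * f x)"
    and lim: "(F \<longlongrightarrow> T) at_top"
  shows "(LINT x|lborel. indicator {a..} x * f x) = T - F a"
proof (rule LIMSEQ_unique)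
  show "(\<lambda>n. LINT x|lborel. f x * indicator {a..a + real n} x) \<longlonglongrightarrow> (LINT x|lborel. indicator {a..} x * f x)"
  proof (rule integral_dominated_convergence[where w = "\<lambda>x. \<bar>indicator {a..} x * f x\<bar>"])
    show "AE x in lborel. (\<lambda>n. f x * indicator {a..a + real n} x) \<longlonglongrightarrow> indicator {a..} x * f x"
    proof (rule AE_I2)
      fix x
      have "\<forall>\<^sub>F n in sequentially. indicator {a..a + real n} x = (indicator {a..} x :: real)"
        using eventually_ge_at_top[of "nat \<lceil>x - a\<rceil>"]
        by eventually_elim (auto simp: indicator_def nat_ceiling_le_eq)
      then show "(\<lambda>n. f x * indicator {a..a + real n} x) \<longlonglongrightarrow> indicator {a..} x * f x"
        by (intro tendsto_eventually) (auto elim!: eventually_mono)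
    qed
  qed (use int in \<open>auto split: split_indicator\<close>)
  have "(LINT x|lborel. f x * indicator {a..a + real n} x) = F (a + real n) - F a" for n
    by (rule integral_FTC_Icc_real) (use deriv cont in auto)
  moreover have "(\<lambda>n. F (a + real n) - F a) \<longlonglongrightarrow> T - F a"
    by (intro tendsto_diff tendsto_const filterlim_compose[OF lim]
      filterlim_tendsto_add_at_top[OF tendsto_const] filterlim_real_sequentially)
  ultimately show "(\<lambda>n. LINT x|lborel. f x * indicator {a..a + real n} x) \<longlonglongrightarrow> T - F a"
    by simp
qed

lemma integral_layer_cake:
  fixes m g :: "real \<Rightarrow> real"
  assumes [measurable]: "m \<in> borel_measurable borel" "g \<in> borel_measurable borel"
    and fin: "(\<integral>\<^sup>+u. ennreal \<bar>m u\<bar> * (\<integral>\<^sup>+s. ennreal \<bar>g s\<bar> * indicator {0..u} s \<partial>lborel) \<partial>lborel) < \<infinity>"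
  shows "(LINT s|lborel. indicator {0..} s * (LINT u|lborel. indicator {s..} u * m u) * g s)
    = (LINT u|lborel. m u * (LINT s|lborel. indicator {0..u} s * g s))"
proof -
  have [measurable]: "Measurable.pred (borel \<Otimes>\<^sub>M borel) (\<lambda>x::real\<times>real. snd x \<in> {0..fst x})"
    unfolding atLeastAtMost_iff by measurable
  define F where "F u s = m u * (indicator {0..u} s * g s)" for u s
  have "integrable (lborel \<Otimes>\<^sub>M lborel) (case_prod F)"
  proof (rule integrableI_bounded)
    show Fm: "case_prod F \<in> borel_measurable (lborel \<Otimes>\<^sub>M lborel)"
      unfolding F_def by measurable
    have "(\<integral>\<^sup>+z. ennreal (norm (case_prod F z)) \<partial>(lborel \<Otimes>\<^sub>M lborel))
      = (\<integral>\<^sup>+u. \<integral>\<^sup>+s. ennreal (norm (case_prod F (u, s))) \<partial>lborel \<partial>lborel)"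
      by (rule lborel.nn_integral_fst[symmetric]) (use Fm in measurable)
    also have "\<dots> = (\<integral>\<^sup>+u. ennreal \<bar>m u\<bar> * (\<integral>\<^sup>+s. ennreal \<bar>g s\<bar> * indicator {0..u} s \<partial>lborel) \<partial>lborel)"
      by (intro nn_integral_cong, subst nn_integral_cmult[symmetric])
        (auto simp: F_def abs_mult ennreal_mult' intro!: nn_integral_cong split: split_indicator)
    finally show "(\<integral>\<^sup>+z. ennreal (norm (case_prod F z)) \<partial>(lborel \<Otimes>\<^sub>M lborel)) < \<infinity>"
      using fin by simp
  qed
  from lborel_pair.Fubini_integral[OF this]
  have "(LINT s|lborel. LINT u|lborel. F u s) = (LINT u|lborel. LINT s|lborel. F u s)" .
  moreover have "(LINT u|lborel. F u s) = indicator {0..} s * (LINT u|lborel. indicator {s..} u * m u) * g s" for s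
  proof -
    have "F u s = (indicator {0..} s * g s) * (indicator {s..} u * m u)" for u
      by (auto simp: F_def split: split_indicator)
    then show ?thesis by simp
  qed
  moreover have "(LINT s|lborel. F u s) = m u * (LINT s|lborel. indicator {0..u} s * g s)" for u
    by (simp add: F_def)
  ultimately show ?thesis by simp
qed

text \<open>The substitution \<open>u = 1 / (4 * s)\<close> in the Gamma integral: the Jacobian
  \<open>1 / (4 * s\<^sup>2)\<close> and the power \<open>u powr (\<alpha> - 1)\<close> combine to
  \<open>4 powr (-\<alpha>) * s powr (-(1 + \<alpha>))\<close>. This explains the normalising
  constant of the extension.\<close>

lemma integral_ekern:
  assumes a: "0 < \<alpha>"
  shows "(LINT s|lborel. ekern (1 + \<alpha>) 1 s) = 4 powr \<alpha> * Gamma \<alpha>"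
proof -
  let ?f = "\<lambda>u. u powr (\<alpha> - 1) / exp u"
  let ?g = "\<lambda>s. 1 / (4 * s) :: real"
  let ?g' = "\<lambda>s. - (1 / (4 * s\<^sup>2)) :: real"
  have f_int: "(?f has_integral Gamma \<alpha>) {0<..}"
    using Gamma_integral_real[OF a]
    by (subst has_integral_spike_set_eq[of _ "{0..}"])
      (auto intro: negligible_subset[OF negligible_sing[of 0]])
  then have 1: "?f absolutely_integrable_on {0<..}" "integral {0<..} ?f = Gamma \<alpha>"
    by (auto intro!: nonnegative_absolutely_integrable_1 simp: has_integral_integrable integral_unique)
  have img: "?g ` {0<..} = {0<..}"
  proof -
    have "x \<in> ?g ` {0<..}" if "0 < x" for x
      using that by (intro image_eqI[of _ _ "1 / (4 * x)"]) auto
    then show ?thesis by auto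
  qed
  have deriv: "(?g has_field_derivative ?g' x) (at x within {0<..})" if "x \<in> {0<..}" for x
    using that by (auto intro!: derivative_eq_intros simp: power2_eq_square)
  have inj: "inj_on ?g {0<..}"
    by (auto intro!: inj_onI)
  have S: "{0<..} \<in> sets (lebesgue :: real measure)" by simp
  have *: "(\<lambda>s. \<bar>?g' s\<bar> * ?f (?g s)) absolutely_integrable_on {0<..}"
    "integral {0<..} (\<lambda>s. \<bar>?g' s\<bar> * ?f (?g s)) = Gamma \<alpha>"
    using has_absolute_integral_change_of_variables_1'[OF S deriv inj, of ?f "Gamma \<alpha>", unfolded img] 1
    by blast+
  have eq: "indicator {0<..} s *\<^sub>R (\<bar>?g' s\<bar> * ?f (?g s)) = ekern (1 + \<alpha>) 1 s / 4 powr \<alpha>" for s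
  proof (cases "0 < s")
    case True
    have "\<bar>?g' s\<bar> * ?f (?g s) = 4 powr (-\<alpha>) * (s powr (-(1 + \<alpha>)) * exp (-(1 / (4 * s))))"
    proof -
      have "(1 / (4 * s)) powr (\<alpha> - 1) = 4 powr (1 - \<alpha>) * s powr (1 - \<alpha>)"
        using True by (simp add: powr_divide powr_mult powr_diff field_simps)
      also have "\<dots> = 4 * 4 powr (-\<alpha>) * (s\<^sup>2 * s powr (-(1 + \<alpha>)))"
        using True by (simp add: powr_diff powr_minus powr_add field_simps power2_eq_square)
      finally show ?thesis
        using True by (simp add: exp_minus field_simps)
    qed
    then show ?thesis
      using True by (simp add: ekern_def powr_minus field_simps)
  qed (simp add: ekern_def)
  have "(LINT s:{0<..}|lebesgue. \<bar>?g' s\<bar> * ?f (?g s)) = Gamma \<alpha>"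
    using set_lebesgue_integral_eq_integral(2)[OF *(1)] *(2) by simp
  then have "(LINT s|lebesgue. ekern (1 + \<alpha>) 1 s / 4 powr \<alpha>) = Gamma \<alpha>"
    unfolding set_lebesgue_integral_def eq .
  then have "(LINT s|lborel. ekern (1 + \<alpha>) 1 s) / 4 powr \<alpha> = Gamma \<alpha>"
    by (subst (asm) integral_completion) auto
  then show ?thesis by (simp add: field_simps)
qed

lemma ekern_tendsto_at_top:
  assumes "0 < b"
  shows "(ekern b t \<longlongrightarrow> 0) at_top"
proof (rule tendsto_sandwich[of "\<lambda>_. 0" _ _ "\<lambda>s. s powr (-b)"])
  show "((\<lambda>s. s powr (-b)) \<longlongrightarrow> 0) at_top"
    using assms by (intro tendsto_neg_powr filterlim_ident) auto
  show "\<forall>\<^sub>F s in at_top. ekern b t s \<le> s powr (-b)"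
    using eventually_gt_at_top[of 0] by eventually_elim (rule ekern_le_powr)
qed (auto simp: ekern_nonneg)

lemma linear_growth_one: "linear_growth (\<lambda>_. 1)"
  unfolding linear_growth_def
proof (intro conjI allI exI[of _ 1] impI)
  fix a h :: real assume "0 \<le> h"
  then show "(\<integral>\<^sup>+y. ennreal \<bar>1\<bar> * indicator {a..a+h} y \<partial>lborel) \<le> ennreal (1 * (1 + h))"
    by simp
qed auto

lemma integrable_ekern:
  assumes "1 < b" "0 < t"
  shows "integrable lborel (ekern b t)"
  using integrable_kconv[OF linear_growth_one assms, of 0] by simp

lemma ekern_bound_one:
  assumes "0 < b"
  shows "\<exists>M\<ge>0. \<forall>s>0. ekern b 1 s \<le> M * (1 + s) powr (-b)"
proof -
  obtain M where "0 \<le> M" "\<And>t s. 1 \<le> t \<Longrightarrow> 0 < s \<Longrightarrow> ekern b t s \<le> M * (1 + s) powr (-b)"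
    using ekern_bound[OF assms zero_less_one] by metis
  then show ?thesis by (intro exI[of _ M]) auto
qed

text \<open>The bracket is minus the s-derivative of \<open>ekern b t\<close>, which vanishes at
  infinity. As the kernel is differentiable on the whole line, \<open>s \<le> 0\<close> is allowed
  and gives the value 0; the case \<open>s = 0\<close> is the cancellation behind the flux
  kernel.\<close>

lemma integral_indicator_ekern_deriv:
  assumes b: "0 < b" and t: "0 < t"
  shows "(LINT u|lborel. indicator {s..} u * (b * ekern (b + 1) t u - t\<^sup>2 / 4 * ekern (b + 2) t u)) = ekern b t s"
proof -
  have "(LINT u|lborel. indicator {s..} u * (t\<^sup>2 / 4 * ekern (b + 2) t u - b * ekern (b + 1) t u)) = 0 - ekern b t s"
  proof (rule integral_FTC_atLeast_real)
    show "(ekern b t has_real_derivative t\<^sup>2 / 4 * ekern (b + 2) t x - b * ekern (b + 1) t x) (at x)" for x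
      using assms by (rule ekern_deriv_space)
    have "isCont (ekern b' t) x" if "0 < b'" for b' x
      using ekern_deriv_space[OF that t] by (rule DERIV_isCont)
    then show "isCont (\<lambda>x. t\<^sup>2 / 4 * ekern (b + 2) t x - b * ekern (b + 1) t x) x" for x
      using b by (intro continuous_intros) auto
    have "integrable lborel (\<lambda>u. t\<^sup>2 / 4 * ekern (b + 2) t u - b * ekern (b + 1) t u)"
      using assms by (intro Bochner_Integration.integrable_diff integrable_mult_right integrable_ekern) auto
    from integrable_mult_indicator[OF _ this, of "{s..}"]
    show "integrable lborel (\<lambda>u. indicator {s..} u * (t\<^sup>2 / 4 * ekern (b + 2) t u - b * ekern (b + 1) t u))"
      by simp
    show "(ekern b t \<longlongrightarrow> 0) at_top" using b by (rule ekern_tendsto_at_top)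
  qed measurable
  moreover have "(LINT u|lborel. indicator {s..} u * (b * ekern (b + 1) t u - t\<^sup>2 / 4 * ekern (b + 2) t u))
    = - (LINT u|lborel. indicator {s..} u * (t\<^sup>2 / 4 * ekern (b + 2) t u - b * ekern (b + 1) t u))"
    by (subst integral_minus[symmetric]) (simp add: algebra_simps)
  ultimately show ?thesis by simp
qed

section \<open>Right averages and the extension as their superposition\<close>

definition ravg :: "(real \<Rightarrow> real) \<Rightarrow> real \<Rightarrow> real \<Rightarrow> real" where
  "ravg f x h = (LINT y|lborel. indicator {x..x + h} y * f y) / h"

lemma linear_growth_integrable:
  assumes f: "linear_growth f"
  shows "integrable lborel (\<lambda>y. indicator {a..b} y * f y)"
proof (rule integrableI_bounded)
  show "(\<lambda>y. indicator {a..b} y * f y) \<in> borel_measurable lborel"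
    using linear_growth_measurable[OF f] by measurable
  have "(\<integral>\<^sup>+y. ennreal (norm (indicator {a..b} y * f y)) \<partial>lborel)
    = (\<integral>\<^sup>+y. ennreal \<bar>f y\<bar> * indicator {a..b} y \<partial>lborel)"
    by (intro nn_integral_cong) (auto split: split_indicator)
  then show "(\<integral>\<^sup>+y. ennreal (norm (indicator {a..b} y * f y)) \<partial>lborel) < \<infinity>"
    using linear_growth_finite[OF f] by simp
qed

text \<open>The cubes in \<open>integrable_ccontinuous_explicit\<close> have \<open>x\<close> as
  their lower corner, so in dimension one that differentiation theorem is already the one for right
  averages.\<close>

lemma ravg_tendsto_AE:
  assumes f: "linear_growth f"
  shows "AE x in lebesgue. ((\<lambda>h. ravg f x h) \<longlongrightarrow> f x) (at_right 0)"
proof -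
  have si: "set_integrable lborel {a..b} f" for a b
    using linear_growth_integrable[OF f] by (simp add: set_integrable_def)
  have "f integrable_on cbox a b" for a b
    using set_borel_integral_eq_integral(1)[OF si] by simp
  then obtain N where N: "negligible N" "\<And>x e. x \<notin> N \<Longrightarrow> 0 < e \<Longrightarrow>
      \<exists>d>0. \<forall>h. 0 < h \<and> h < d \<longrightarrow> norm (integral (cbox x (x + h *\<^sub>R One)) f /\<^sub>R h ^ DIM(real) - f x) < e"
    using integrable_ccontinuous_explicit by blast
  have "((\<lambda>h. ravg f x h) \<longlongrightarrow> f x) (at_right 0)" if x: "x \<notin> N" for x
    unfolding tendsto_iff
  proof (intro allI impI)
    fix e :: real assume "0 < e"
    then obtain d where d: "0 < d" "\<And>h. 0 < h \<Longrightarrow> h < d \<Longrightarrow>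
        norm (integral (cbox x (x + h *\<^sub>R One)) f /\<^sub>R h ^ DIM(real) - f x) < e"
      using N(2)[OF x] by blast
    show "\<forall>\<^sub>F h in at_right 0. dist (ravg f x h) (f x) < e"
      unfolding eventually_at_right_field
    proof (intro exI[of _ d] conjI allI impI d(1))
      fix h assume h: "0 < h" "h < d"
      have "integral {x..x + h} f = (LINT y|lborel. indicator {x..x + h} y * f y)"
        using set_borel_integral_eq_integral(2)[OF si[of x "x + h"]] by (simp add: set_lebesgue_integral_def)
      then show "dist (ravg f x h) (f x) < e"
        using d(2)[OF h] by (simp add: dist_norm ravg_def divide_inverse mult.commute)
    qed
  qed
  moreover have "AE x in lebesgue. x \<notin> N"
    using N(1) by (intro AE_not_in) (simp add: negligible_iff_null_sets)
  ultimately show ?thesis by (auto elim: eventually_mono)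
qed

text \<open>Scaling by \<open>t\<^sup>2\<close> reduces to the kernel at time 1, which is the tail
  integral of minus its own derivative \<open>m\<close>. Exchanging the integrals leaves integrals
  of \<open>f\<close> over intervals starting at \<open>x\<close>, that is
  \<open>u * ravg f x (t\<^sup>2 * u)\<close>. As \<open>m\<close> changes sign, the exchange needs
  absolute convergence, which linear growth supplies.\<close>

lemma extension_eq_ravg:
  assumes f: "linear_growth f" and a: "0 < \<alpha>" and t: "0 < t"
  shows "extension \<alpha> f x t = ext_const \<alpha> * (LINT u|lborel.
    ((1 + \<alpha>) * ekern (2 + \<alpha>) 1 u - ekern (3 + \<alpha>) 1 u / 4) * (u * ravg f x (t\<^sup>2 * u)))"
proof -
  have [measurable]: "f \<in> borel_measurable borel" using f by (rule linear_growth_measurable)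
  let ?b = "1 + \<alpha>"
  let ?I = "\<lambda>u. (\<integral>\<^sup>+s. ennreal \<bar>f (x + t\<^sup>2 * s)\<bar> * indicator {0..u} s \<partial>lborel)"
  define m where "m u = ?b * ekern (2 + \<alpha>) 1 u - ekern (3 + \<alpha>) 1 u / 4" for u
  have [measurable]: "m \<in> borel_measurable borel" unfolding m_def by measurable
  have m_eq: "m u = ?b * ekern (?b + 1) 1 u - 1\<^sup>2 / 4 * ekern (?b + 2) 1 u" for u
    by (simp add: m_def add_ac)
  have m_tail: "(LINT u|lborel. indicator {s..} u * m u) = ekern ?b 1 s" for s
    unfolding m_eq by (rule integral_indicator_ekern_deriv) (use a in auto)
  have inner: "(LINT s|lborel. indicator {0..u} s * f (x + t\<^sup>2 * s)) = u * ravg f x (t\<^sup>2 * u)" for u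
  proof (cases "0 < u")
    case True
    have "(LINT y|lborel. indicator {x..x + t\<^sup>2 * u} y * f y)
      = \<bar>t\<^sup>2\<bar> *\<^sub>R (LINT s|lborel. indicator {x..x + t\<^sup>2 * u} (x + t\<^sup>2 * s) * f (x + t\<^sup>2 * s))"
      using t by (intro lborel_integral_real_affine) auto
    also have "(\<lambda>s. indicator {x..x + t\<^sup>2 * u} (x + t\<^sup>2 * s) * f (x + t\<^sup>2 * s)) = (\<lambda>s. indicator {0..u} s * f (x + t\<^sup>2 * s))"
      using t by (auto simp: fun_eq_iff indicator_def zero_le_mult_iff)
    finally show ?thesis using True t by (simp add: ravg_def field_simps)
  next
    case False
    then have "(\<lambda>s. indicator {0..u} s * f (x + t\<^sup>2 * s)) = (\<lambda>s. indicator {u} s * (if u = 0 then f x else 0))"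
      by (auto simp: fun_eq_iff indicator_def)
    moreover have "(LINT s|lborel. indicator {u} s * (if u = 0 then f x else 0)) = 0"
      by (subst integral_mult_left_zero) auto
    ultimately have "(LINT s|lborel. indicator {0..u} s * f (x + t\<^sup>2 * s)) = 0" by simp
    moreover have "u = 0 \<or> ravg f x (t\<^sup>2 * u) = 0"
      using False t by (auto simp: ravg_def mult_less_0_iff not_less le_less)
    ultimately show ?thesis by auto
  qed
  have "kconv ?b f x t = t powr (-2 * \<alpha>) * (LINT s|lborel. ekern ?b 1 s * f (x + t\<^sup>2 * s))"
  proof -
    have "kconv ?b f x t = \<bar>t\<^sup>2\<bar> *\<^sub>R (LINT s|lborel. ekern ?b t (x + t\<^sup>2 * s - x) * f (x + t\<^sup>2 * s))"
      unfolding kconv_def using t by (intro lborel_integral_real_affine) auto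
    also have "(\<lambda>s. ekern ?b t (x + t\<^sup>2 * s - x) * f (x + t\<^sup>2 * s)) = (\<lambda>s. t powr (-2 * ?b) * (ekern ?b 1 s * f (x + t\<^sup>2 * s)))"
    proof
      fix s
      show "ekern ?b t (x + t\<^sup>2 * s - x) * f (x + t\<^sup>2 * s) = t powr (-2 * ?b) * (ekern ?b 1 s * f (x + t\<^sup>2 * s))"
        using ekern_scale[OF t, of s ?b] t
        by (cases "0 < s") (auto simp: ekern_eq_0 mult_le_0_iff not_less)
    qed
    also have "\<bar>t\<^sup>2\<bar> *\<^sub>R (LINT s|lborel. t powr (-2 * ?b) * (ekern ?b 1 s * f (x + t\<^sup>2 * s)))
      = (t\<^sup>2 * t powr (-2 * ?b)) * (LINT s|lborel. ekern ?b 1 s * f (x + t\<^sup>2 * s))" by simp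
    also have "t\<^sup>2 * t powr (-2 * ?b) = t powr (-2 * \<alpha>)"
    proof -
      have "t\<^sup>2 * t powr (-2 * ?b) = t powr 2 * t powr (-2 * ?b)" using t by simp
      also have "\<dots> = t powr (-2 * \<alpha>)" by (subst powr_add[symmetric]) (simp add: algebra_simps)
      finally show ?thesis .
    qed
    finally show ?thesis .
  qed
  then have "extension \<alpha> f x t = ext_const \<alpha> * (t powr (2 * \<alpha>) * t powr (-2 * \<alpha>)) * (LINT s|lborel. ekern ?b 1 s * f (x + t\<^sup>2 * s))"
    by (subst extension_eq_kconv) (auto simp: ext_const_def)
  also have "t powr (2 * \<alpha>) * t powr (-2 * \<alpha>) = 1"
    using t by (subst powr_add[symmetric]) simp
  also have "(\<lambda>s. ekern ?b 1 s * f (x + t\<^sup>2 * s))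
      = (\<lambda>s. indicator {0..} s * (LINT u|lborel. indicator {s..} u * m u) * f (x + t\<^sup>2 * s))"
    unfolding m_tail by (auto simp: fun_eq_iff ekern_eq_0 split: split_indicator)
  also have "(LINT s|lborel. indicator {0..} s * (LINT u|lborel. indicator {s..} u * m u) * f (x + t\<^sup>2 * s))
      = (LINT u|lborel. m u * (LINT s|lborel. indicator {0..u} s * f (x + t\<^sup>2 * s)))"
  proof (rule integral_layer_cake)
    obtain K where K: "0 \<le> K" "\<And>h. 0 \<le> h \<Longrightarrow>
        (\<integral>\<^sup>+y. ennreal \<bar>f y\<bar> * indicator {x..x+h} y \<partial>lborel) \<le> ennreal (K * (1 + h))"
      using f unfolding linear_growth_def by blast
    obtain M2 where M2: "0 \<le> M2" "\<And>s. 0 < s \<Longrightarrow> ekern (2 + \<alpha>) 1 s \<le> M2 * (1 + s) powr (-(2 + \<alpha>))"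
      using ekern_bound_one[of "2 + \<alpha>"] a by (meson add_pos_pos zero_less_numeral)
    obtain M3 where M3: "0 \<le> M3" "\<And>s. 0 < s \<Longrightarrow> ekern (3 + \<alpha>) 1 s \<le> M3 * (1 + s) powr (-(3 + \<alpha>))"
      using ekern_bound_one[of "3 + \<alpha>"] a by (meson add_pos_pos zero_less_numeral)
    define M where "M = ?b * M2 + M3 / 4"
    have M: "0 \<le> M" using a M2 M3 by (simp add: M_def)
    have m_bound: "\<bar>m u\<bar> \<le> M * (1 + u) powr (-(2 + \<alpha>))" if "0 < u" for u
    proof -
      have "\<bar>m u\<bar> \<le> ?b * ekern (2 + \<alpha>) 1 u + ekern (3 + \<alpha>) 1 u / 4"
        unfolding m_def using a by (intro order_trans[OF abs_triangle_ineq4]) (simp add: abs_mult ekern_nonneg)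
      also have "\<dots> \<le> ?b * (M2 * (1 + u) powr (-(2 + \<alpha>))) + (M3 * (1 + u) powr (-(2 + \<alpha>))) / 4"
      proof (intro add_mono mult_left_mono divide_right_mono M2(2)[OF that])
        have "ekern (3 + \<alpha>) 1 u \<le> M3 * (1 + u) powr (-(3 + \<alpha>))" by (rule M3(2)[OF that])
        also have "\<dots> \<le> M3 * (1 + u) powr (-(2 + \<alpha>))"
          using that M3(1) by (intro mult_left_mono powr_mono) auto
        finally show "ekern (3 + \<alpha>) 1 u \<le> M3 * (1 + u) powr (-(2 + \<alpha>))" .
      qed (use a in auto)
      also have "\<dots> = M * (1 + u) powr (-(2 + \<alpha>))" by (simp add: M_def algebra_simps)
      finally show ?thesis .
    qed
    \<comment> \<open>Absorbs the change of variables: \<open>K * (1 + t\<^sup>2 * u)\<close> is at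
      most \<open>K * (1 + t\<^sup>2) * (1 + u)\<close>, and the Jacobian \<open>t\<^sup>2\<close>
      is divided out. The factor \<open>1 + u\<close> lowers the decay of \<open>m\<close> from
      order \<open>2 + \<alpha>\<close> to \<open>1 + \<alpha>\<close>, which is still
      integrable.\<close>
    define K' where "K' = K * (1 + t\<^sup>2) / t\<^sup>2"
    have K': "0 \<le> K'" using K(1) by (simp add: K'_def)
    have g_int: "?I u \<le> ennreal (K' * (1 + u))" if "0 < u" for u
    proof -
      have "ennreal (t\<^sup>2) * ?I u
        = ennreal \<bar>t\<^sup>2\<bar> * (\<integral>\<^sup>+s. ennreal \<bar>f (x + t\<^sup>2 * s)\<bar> * indicator {x..x + t\<^sup>2 * u} (x + t\<^sup>2 * s) \<partial>lborel)"
        using t by (auto simp: indicator_def zero_le_mult_iff intro!: arg_cong2[where f = times] nn_integral_cong)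
      also have "\<dots> = (\<integral>\<^sup>+y. ennreal \<bar>f y\<bar> * indicator {x..x + t\<^sup>2 * u} y \<partial>lborel)"
        using t by (intro nn_integral_real_affine[symmetric]) auto
      also have "\<dots> \<le> ennreal (K * (1 + t\<^sup>2 * u))"
        using that by (intro K(2)) auto
      also have "\<dots> \<le> ennreal (t\<^sup>2 * (K' * (1 + u)))"
      proof (rule ennreal_leI)
        have "K * (1 + t\<^sup>2 * u) \<le> K * ((1 + t\<^sup>2) * (1 + u))"
          using K(1) that by (intro mult_left_mono) (auto simp: algebra_simps)
        then show "K * (1 + t\<^sup>2 * u) \<le> t\<^sup>2 * (K' * (1 + u))"
          using t by (simp add: K'_def)
      qed
      finally have "ennreal (t\<^sup>2) * ?I u
          \<le> ennreal (t\<^sup>2) * ennreal (K' * (1 + u))"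
        by (simp add: ennreal_mult')
      then show ?thesis
        using t by (subst (asm) ennreal_mult_le_mult_iff) auto
    qed
    have "(\<integral>\<^sup>+u. ennreal \<bar>m u\<bar> * ?I u \<partial>lborel)
      \<le> (\<integral>\<^sup>+u. ennreal (M * K') * (ennreal ((1 + u) powr (-1 - \<alpha>)) * indicator {0..} u) \<partial>lborel)"
    proof (rule nn_integral_mono)
      fix u
      show "ennreal \<bar>m u\<bar> * ?I u
        \<le> ennreal (M * K') * (ennreal ((1 + u) powr (-1 - \<alpha>)) * indicator {0..} u)"
      proof (cases "0 < u")
        case True
        have "ennreal \<bar>m u\<bar> * ?I u
          \<le> ennreal (M * (1 + u) powr (-(2 + \<alpha>))) * ennreal (K' * (1 + u))"
          by (intro mult_mono ennreal_leI m_bound g_int True) auto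
        also have "\<dots> = ennreal (M * K' * ((1 + u) powr (-(2 + \<alpha>)) * (1 + u)))"
          using M K' by (subst ennreal_mult'[symmetric]) (auto simp: mult_ac)
        also have "(1 + u) powr (-(2 + \<alpha>)) * (1 + u) = (1 + u) powr (-(2 + \<alpha>)) * (1 + u) powr 1"
          using True by simp
        also have "\<dots> = (1 + u) powr (-1 - \<alpha>)"
          by (subst powr_add[symmetric]) (simp add: algebra_simps)
        finally show ?thesis using True M K' by (simp add: ennreal_mult')
      qed (simp add: m_def ekern_eq_0)
    qed
    also have "\<dots> = ennreal (M * K') * ennreal ((1 + 0) powr (-\<alpha>) / \<alpha>)"
      using a by (subst nn_integral_cmult) (auto simp: nn_integral_powr_tail)
    also have "\<dots> < \<infinity>" by (simp add: ennreal_mult_less_top)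
    finally show "(\<integral>\<^sup>+u. ennreal \<bar>m u\<bar> * ?I u \<partial>lborel) < \<infinity>" .
  qed measurable
  finally show ?thesis unfolding inner m_def by simp
qed

text \<open>Multiplication by \<open>u\<close> lowers the exponent of each kernel by 1. The averages
  are thus weighted with a fixed function of \<open>u\<close>, integrable for
  \<open>\<alpha> > 0\<close> because its exponents exceed 1.\<close>

lemma moment_ekern:
  "((1 + \<alpha>) * ekern (2 + \<alpha>) 1 u - ekern (3 + \<alpha>) 1 u / 4) * (u * v) =
   ((1 + \<alpha>) * ekern (1 + \<alpha>) 1 u - ekern (2 + \<alpha>) 1 u / 4) * v"
proof (cases "0 < u")
  case True
  have e: "u * ekern (2 + \<alpha>) 1 u = ekern (1 + \<alpha>) 1 u" "u * ekern (3 + \<alpha>) 1 u = ekern (2 + \<alpha>) 1 u"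
    using ekern_shift[OF True, of "1 + \<alpha>" 1 1] ekern_shift[OF True, of "2 + \<alpha>" 1 1] True
    by (simp_all add: powr_minus field_simps)
  have "((1 + \<alpha>) * ekern (2 + \<alpha>) 1 u - ekern (3 + \<alpha>) 1 u / 4) * (u * v)
      = ((1 + \<alpha>) * (u * ekern (2 + \<alpha>) 1 u) - (u * ekern (3 + \<alpha>) 1 u) / 4) * v"
    by (simp add: algebra_simps)
  then show ?thesis unfolding e .
qed (simp add: ekern_eq_0)

lemma kconv_one: "kconv b (\<lambda>_. 1) 0 1 = (LINT s|lborel. ekern b 1 s)"
  by (simp add: kconv_def)

lemma ravg_one: "0 < h \<Longrightarrow> ravg (\<lambda>_. 1) x h = 1"
  by (simp add: ravg_def)

lemma extension_one_eq:
  assumes a: "0 < \<alpha>" and t: "0 < t"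
  shows "extension \<alpha> (\<lambda>_. 1) x t = ext_const \<alpha> * (LINT u|lborel.
    (1 + \<alpha>) * ekern (1 + \<alpha>) 1 u - ekern (2 + \<alpha>) 1 u / 4)"
proof -
  have *: "((1 + \<alpha>) * ekern (1 + \<alpha>) 1 u - ekern (2 + \<alpha>) 1 u / 4) * ravg (\<lambda>_. 1) x (t\<^sup>2 * u)
    = (1 + \<alpha>) * ekern (1 + \<alpha>) 1 u - ekern (2 + \<alpha>) 1 u / 4" for u
    using t by (cases "0 < u") (simp_all add: ravg_one ekern_eq_0)
  show ?thesis
    unfolding extension_eq_ravg[OF linear_growth_one a t] moment_ekern * ..
qed

text \<open>All right averages of the constant 1 are 1, so by the formula in terms of averages the
  value depends neither on \<open>x\<close> nor on \<open>t\<close>; at \<open>x = 0\<close>,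
  \<open>t = 1\<close> it is the Gamma integral divided by its own value.\<close>

lemma extension_one:
  assumes a: "0 < \<alpha>" and t: "0 < t"
  shows "extension \<alpha> (\<lambda>_. 1) x t = 1"
proof -
  have "extension \<alpha> (\<lambda>_. 1) x t = extension \<alpha> (\<lambda>_. 1) 0 1"
    using extension_one_eq[OF a t, of x] extension_one_eq[OF a zero_less_one, of 0] by (rule trans[OF _ sym])
  also have "\<dots> = 1"
    using Gamma_real_pos[OF a]
    by (subst extension_eq_kconv) (auto simp: kconv_one integral_ekern[OF a])
  finally show ?thesis .
qed

text \<open>Convergence bounds the averages for \<open>h < d\<close>, linear growth for
  \<open>h \<ge> d\<close>, where \<open>K * (1 + h) / h\<close> is at most
  \<open>K * (1 / d + 1)\<close>. A majorant for dominated convergence in \<open>u\<close> is thus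
  available at every point where the averages converge.\<close>

lemma ravg_bounded:
  assumes f: "linear_growth f" and lim: "((\<lambda>h. ravg f x h) \<longlongrightarrow> L) (at_right 0)"
  shows "\<exists>K\<ge>0. \<forall>h>0. \<bar>ravg f x h\<bar> \<le> K"
proof -
  obtain K where K: "0 \<le> K" "\<And>h. 0 \<le> h \<Longrightarrow>
      (\<integral>\<^sup>+y. ennreal \<bar>f y\<bar> * indicator {x..x+h} y \<partial>lborel) \<le> ennreal (K * (1 + h))"
    using f unfolding linear_growth_def by blast
  have "\<forall>\<^sub>F h in at_right 0. \<bar>ravg f x h\<bar> < \<bar>L\<bar> + 1"
    using tendsto_rabs[OF lim] by (rule order_tendstoD) simp
  then obtain d where d: "0 < d" "\<And>h. 0 < h \<Longrightarrow> h < d \<Longrightarrow> \<bar>ravg f x h\<bar> < \<bar>L\<bar> + 1"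
    unfolding eventually_at_right_field by blast
  show ?thesis
  proof (intro exI[of _ "\<bar>L\<bar> + 1 + K * (1 / d + 1)"] conjI allI impI)
    show "0 \<le> \<bar>L\<bar> + 1 + K * (1 / d + 1)" using K(1) d(1) by simp
    fix h :: real assume h: "0 < h"
    show "\<bar>ravg f x h\<bar> \<le> \<bar>L\<bar> + 1 + K * (1 / d + 1)"
    proof (cases "h < d")
      case True
      have "\<bar>ravg f x h\<bar> \<le> \<bar>L\<bar> + 1" using d(2)[OF h True] by simp
      also have "\<dots> \<le> \<bar>L\<bar> + 1 + K * (1 / d + 1)" using K(1) d(1) by simp
      finally show ?thesis .
    next
      case False
      have "ennreal (LINT y|lborel. \<bar>indicator {x..x + h} y * f y\<bar>)
          = (\<integral>\<^sup>+y. ennreal \<bar>indicator {x..x + h} y * f y\<bar> \<partial>lborel)"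
        using linear_growth_integrable[OF f, of x "x + h"] by (intro nn_integral_eq_integral[symmetric]) auto
      also have "\<dots> = (\<integral>\<^sup>+y. ennreal \<bar>f y\<bar> * indicator {x..x+h} y \<partial>lborel)"
        by (intro nn_integral_cong) (auto split: split_indicator)
      also have "\<dots> \<le> ennreal (K * (1 + h))" using h by (intro K(2)) simp
      finally have "(LINT y|lborel. \<bar>indicator {x..x + h} y * f y\<bar>) \<le> K * (1 + h)"
        using K(1) h by (subst (asm) ennreal_le_iff) auto
      then have "\<bar>LINT y|lborel. indicator {x..x + h} y * f y\<bar> \<le> K * (1 + h)"
        by (rule order_trans[OF integral_abs_bound])
      then have "\<bar>ravg f x h\<bar> \<le> K * (1 + h) / h"
        using h by (simp add: ravg_def abs_div divide_right_mono)
      also have "\<dots> = K * (1 / h + 1)" using h by (simp add: field_simps)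
      also have "\<dots> \<le> K * (1 / d + 1)"
        using False d(1) K(1) by (intro mult_left_mono add_mono divide_left_mono) auto
      finally show ?thesis by simp
    qed
  qed
qed

lemma extension_tendsto_AE:
  assumes f: "linear_growth f" and a: "0 < \<alpha>"
  shows "AE x in lebesgue. ((\<lambda>t. extension \<alpha> f x t) \<longlongrightarrow> f x) (at_right 0)"
  using ravg_tendsto_AE[OF f]
proof eventually_elim
  case (elim x)
  have [measurable]: "f \<in> borel_measurable borel" using f by (rule linear_growth_measurable)
  obtain K where K: "0 \<le> K" "\<And>h. 0 < h \<Longrightarrow> \<bar>ravg f x h\<bar> \<le> K"
    using ravg_bounded[OF f elim] by blast
  define \<mu> where "\<mu> u = (1 + \<alpha>) * ekern (1 + \<alpha>) 1 u - ekern (2 + \<alpha>) 1 u / 4" for u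
  have \<mu>_int: "integrable lborel \<mu>"
    unfolding \<mu>_def using a
    by (intro Bochner_Integration.integrable_diff integrable_mult_right integrable_divide integrable_ekern) auto
  have [measurable]: "\<mu> \<in> borel_measurable borel" unfolding \<mu>_def by measurable
  have [measurable]: "(\<lambda>u. ravg f x (t\<^sup>2 * u)) \<in> borel_measurable borel" for t
  proof -
    have "Measurable.pred (borel \<Otimes>\<^sub>M borel) (\<lambda>z::real\<times>real. snd z \<in> {x..x + t\<^sup>2 * fst z})"
      unfolding atLeastAtMost_iff by measurable
    then show ?thesis unfolding ravg_def by measurable
  qed
  have "((\<lambda>t. LINT u|lborel. \<mu> u * ravg f x (t\<^sup>2 * u)) \<longlongrightarrow> (LINT u|lborel. \<mu> u * f x)) (at 0 within {0<..})"
  proof (rule tendsto_integral_dominated)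
    show "integrable lborel (\<lambda>u. \<bar>\<mu> u\<bar> * K)" using \<mu>_int by auto
    show "\<forall>\<^sub>F t in at_right 0. AE u in lborel. \<bar>\<mu> u * ravg f x (t\<^sup>2 * u)\<bar> \<le> \<bar>\<mu> u\<bar> * K"
      unfolding eventually_at_right_field
    proof (intro exI[of _ 1] conjI allI impI AE_I2)
      fix t u :: real assume t: "0 < t"
      show "\<bar>\<mu> u * ravg f x (t\<^sup>2 * u)\<bar> \<le> \<bar>\<mu> u\<bar> * K"
      proof (cases "0 < u")
        case True
        then show ?thesis using K(2)[of "t\<^sup>2 * u"] t by (simp add: abs_mult mult_left_mono)
      qed (simp add: \<mu>_def ekern_eq_0)
    qed simp
    show "AE u in lborel. ((\<lambda>t. \<mu> u * ravg f x (t\<^sup>2 * u)) \<longlongrightarrow> \<mu> u * f x) (at_right 0)"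
    proof (rule AE_I2)
      fix u
      show "((\<lambda>t. \<mu> u * ravg f x (t\<^sup>2 * u)) \<longlongrightarrow> \<mu> u * f x) (at_right 0)"
      proof (cases "0 < u")
        case True
        have "filterlim (\<lambda>t. t\<^sup>2 * u) (at_right 0) (at_right 0)"
          unfolding filterlim_at
        proof
          show "\<forall>\<^sub>F t in at_right 0. t\<^sup>2 * u \<in> {0<..} \<and> t\<^sup>2 * u \<noteq> 0"
            using eventually_at_right_less[of 0] by eventually_elim (use True in auto)
          have "((\<lambda>t. t\<^sup>2 * u) \<longlongrightarrow> 0\<^sup>2 * u) (at_right 0)"
            by (intro tendsto_intros)
          then show "((\<lambda>t. t\<^sup>2 * u) \<longlongrightarrow> 0) (at_right 0)" by simp
        qed
        from filterlim_compose[OF elim this] show ?thesis by (intro tendsto_mult tendsto_const)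
      qed (simp add: \<mu>_def ekern_eq_0)
    qed
  qed measurable
  then have lim: "((\<lambda>t. ext_const \<alpha> * (LINT u|lborel. \<mu> u * ravg f x (t\<^sup>2 * u)))
      \<longlongrightarrow> ext_const \<alpha> * (LINT u|lborel. \<mu> u * f x)) (at_right 0)"
    by (rule tendsto_mult_left)
  \<comment> \<open>The mass of the signed weight is not computed directly: it is the extension of
    the constant 1.\<close>
  have "ext_const \<alpha> * (LINT u|lborel. \<mu> u) = 1"
    using extension_one_eq[OF a zero_less_one, of 0] extension_one[OF a zero_less_one, of 0]
    by (simp only: \<mu>_def)
  then have val: "ext_const \<alpha> * (LINT u|lborel. \<mu> u * f x) = f x"
    by (simp add: mult.assoc[symmetric])
  have ev: "\<forall>\<^sub>F t in at_right 0. ext_const \<alpha> * (LINT u|lborel. \<mu> u * ravg f x (t\<^sup>2 * u)) = extension \<alpha> f x t"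
    using eventually_at_right_less[of 0]
    by eventually_elim (simp add: extension_eq_ravg[OF f a] moment_ekern \<mu>_def)
  show ?case
    using Lim_transform_eventually[OF lim ev] unfolding val .
qed

section \<open>Convergence in $L^p(w)$\<close>

lemma extension_diff:
  assumes f: "linear_growth f" and g: "linear_growth g" and a: "0 < \<alpha>" and t: "0 < t"
  shows "extension \<alpha> (\<lambda>x. f x - g x) x t = extension \<alpha> f x t - extension \<alpha> g x t"
proof -
  note [measurable] = linear_growth_measurable[OF f] linear_growth_measurable[OF g]
  have "1 < 1 + \<alpha>" using a by simp
  then have "kconv (1 + \<alpha>) (\<lambda>x. f x - g x) x t = kconv (1 + \<alpha>) f x t - kconv (1 + \<alpha>) g x t"
    unfolding kconv_def using integrable_kconv[OF f _ t] integrable_kconv[OF g _ t]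
    by (subst Bochner_Integration.integral_diff[symmetric]) (auto simp: right_diff_distrib)
  then show ?thesis
    by (subst (1 2 3) extension_eq_kconv) (auto simp: right_diff_distrib)
qed

lemma linear_growth_bounded:
  assumes [measurable]: "g \<in> borel_measurable borel" and N: "\<And>x. \<bar>g x\<bar> \<le> N"
  shows "linear_growth g"
  unfolding linear_growth_def
proof (intro conjI allI exI[of _ N] impI)
  show "0 \<le> N" using N[of 0] by linarith
  fix a h :: real assume h: "0 \<le> h"
  have "(\<integral>\<^sup>+y. ennreal \<bar>g y\<bar> * indicator {a..a+h} y \<partial>lborel) \<le> (\<integral>\<^sup>+y. ennreal N * indicator {a..a+h} y \<partial>lborel)"
    using N by (intro nn_integral_mono mult_right_mono ennreal_leI) auto
  also have "\<dots> = ennreal N * ennreal h"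
    using h by (subst nn_integral_cmult_indicator) auto
  also have "\<dots> \<le> ennreal (N * (1 + h))"
    using h \<open>0 \<le> N\<close> by (subst ennreal_mult[symmetric]) (auto intro!: ennreal_leI mult_left_mono)
  finally show "(\<integral>\<^sup>+y. ennreal \<bar>g y\<bar> * indicator {a..a+h} y \<partial>lborel) \<le> ennreal (N * (1 + h))" .
qed simp

lemma extension_abs_le_bound:
  assumes [measurable]: "g \<in> borel_measurable borel" and N: "\<And>x. \<bar>g x\<bar> \<le> N" and a: "0 < \<alpha>" and t: "0 < t"
  shows "extension \<alpha> (\<lambda>x. \<bar>g x\<bar>) x t \<le> N"
proof -
  have g: "linear_growth g" by (rule linear_growth_bounded) (use N in auto)
  have a1: "1 < 1 + \<alpha>" using a by simp
  have "kconv (1 + \<alpha>) (\<lambda>x. \<bar>g x\<bar>) x t \<le> (LINT y|lborel. N * (ekern (1 + \<alpha>) t (y - x) * 1))"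
    unfolding kconv_def
  proof (rule integral_mono)
    show "integrable lborel (\<lambda>y. ekern (1 + \<alpha>) t (y - x) * \<bar>g y\<bar>)"
      by (intro integrable_kconv linear_growth_abs g a1 t)
    show "integrable lborel (\<lambda>y. N * (ekern (1 + \<alpha>) t (y - x) * 1))"
      by (intro integrable_mult_right integrable_kconv linear_growth_one a1 t)
    show "ekern (1 + \<alpha>) t (y - x) * \<bar>g y\<bar> \<le> N * (ekern (1 + \<alpha>) t (y - x) * 1)" for y
      using N[of y] by (simp add: mult.commute mult_right_mono ekern_nonneg)
  qed
  also have "\<dots> = N * kconv (1 + \<alpha>) (\<lambda>_. 1) x t"
    by (simp add: kconv_def)
  finally have "t powr (2 * \<alpha>) / (4 powr \<alpha> * Gamma \<alpha>) * kconv (1 + \<alpha>) (\<lambda>x. \<bar>g x\<bar>) x t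
      \<le> t powr (2 * \<alpha>) / (4 powr \<alpha> * Gamma \<alpha>) * (N * kconv (1 + \<alpha>) (\<lambda>_. 1) x t)"
    using Gamma_real_pos[OF a] by (intro mult_left_mono) auto
  also have "\<dots> = N * extension \<alpha> (\<lambda>_. 1) x t"
    by (subst extension_eq_kconv) auto
  finally show ?thesis
    using extension_one[OF a t, of x] by (subst extension_eq_kconv) auto
qed

text \<open>If \<open>g\<close> vanishes up to distance 1 to the right of \<open>x\<close>, only
  \<open>s \<ge> 1\<close> matters, and there the exponential factor at time 1 is at least
  \<open>exp (-1/4)\<close>. The kernel at time 1 thus dominates the kernels at all times
  \<open>t \<le> 1\<close> up to the factor \<open>exp (1/4)\<close>.\<close>

lemma extension_abs_far:
  assumes g: "linear_growth g" and supp: "\<And>y. y < x + 1 \<Longrightarrow> g y = 0"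
    and a: "0 < \<alpha>" and t: "0 < t" "t \<le> 1"
  shows "extension \<alpha> (\<lambda>x. \<bar>g x\<bar>) x t \<le> exp (1/4) * extension \<alpha> (\<lambda>x. \<bar>g x\<bar>) x 1"
proof -
  note [measurable] = linear_growth_measurable[OF g]
  have a1: "1 < 1 + \<alpha>" using a by simp
  have "kconv (1 + \<alpha>) (\<lambda>x. \<bar>g x\<bar>) x t \<le> (LINT y|lborel. exp (1/4) * (ekern (1 + \<alpha>) 1 (y - x) * \<bar>g y\<bar>))"
    unfolding kconv_def
  proof (rule integral_mono)
    show "integrable lborel (\<lambda>y. ekern (1 + \<alpha>) t (y - x) * \<bar>g y\<bar>)"
      by (intro integrable_kconv linear_growth_abs g a1 t)
    show "integrable lborel (\<lambda>y. exp (1/4) * (ekern (1 + \<alpha>) 1 (y - x) * \<bar>g y\<bar>))"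
      by (intro integrable_mult_right integrable_kconv linear_growth_abs g a1) simp
    fix y
    show "ekern (1 + \<alpha>) t (y - x) * \<bar>g y\<bar> \<le> exp (1/4) * (ekern (1 + \<alpha>) 1 (y - x) * \<bar>g y\<bar>)"
    proof (cases "y < x + 1")
      case False
      then have s: "1 \<le> y - x" by simp
      have "ekern (1 + \<alpha>) t (y - x) \<le> (y - x) powr (-(1 + \<alpha>))"
        using s by (intro ekern_le_powr) simp
      also have "\<dots> = exp (1 / (4 * (y - x))) * ekern (1 + \<alpha>) 1 (y - x)"
        using s by (simp add: ekern_def exp_minus)
      also have "\<dots> \<le> exp (1/4) * ekern (1 + \<alpha>) 1 (y - x)"
        using s by (intro mult_right_mono) (auto simp: ekern_nonneg field_simps)
      finally show ?thesis by (simp add: mult.assoc[symmetric] mult_right_mono)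
    qed (simp add: supp)
  qed
  also have "\<dots> = exp (1/4) * kconv (1 + \<alpha>) (\<lambda>x. \<bar>g x\<bar>) x 1"
    by (simp add: kconv_def)
  finally have le: "kconv (1 + \<alpha>) (\<lambda>x. \<bar>g x\<bar>) x t \<le> exp (1/4) * kconv (1 + \<alpha>) (\<lambda>x. \<bar>g x\<bar>) x 1" .
  have nn: "0 \<le> kconv (1 + \<alpha>) (\<lambda>x. \<bar>g x\<bar>) x t"
    unfolding kconv_def by (intro integral_nonneg_AE AE_I2) (simp add: ekern_nonneg)
  have "t powr (2 * \<alpha>) * kconv (1 + \<alpha>) (\<lambda>x. \<bar>g x\<bar>) x t \<le> 1 * kconv (1 + \<alpha>) (\<lambda>x. \<bar>g x\<bar>) x t"
    using t a nn by (intro mult_right_mono) (auto intro: powr_le1)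
  also have "\<dots> \<le> exp (1/4) * kconv (1 + \<alpha>) (\<lambda>x. \<bar>g x\<bar>) x 1" using le by simp
  finally have "t powr (2 * \<alpha>) * kconv (1 + \<alpha>) (\<lambda>x. \<bar>g x\<bar>) x t / (4 powr \<alpha> * Gamma \<alpha>)
      \<le> exp (1/4) * kconv (1 + \<alpha>) (\<lambda>x. \<bar>g x\<bar>) x 1 / (4 powr \<alpha> * Gamma \<alpha>)"
    using Gamma_real_pos[OF a] by (intro divide_right_mono) auto
  then show ?thesis
    by (subst (1 2) extension_eq_kconv) auto
qed

lemma extension_eq_0_right:
  assumes [measurable]: "g \<in> borel_measurable borel" and "\<And>y. x \<le> y \<Longrightarrow> g y = 0"
  shows "extension \<alpha> g x t = 0"
proof -
  have *: "ekern (1 + \<alpha>) t (y - x) * g y = 0" for y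
    using assms(2)[of y] by (cases "x \<le> y") (simp_all add: ekern_eq_0)
  have "kconv (1 + \<alpha>) g x t = 0" unfolding kconv_def * by simp
  then show ?thesis by (subst extension_eq_kconv) auto
qed

lemma powr_sum3_le:
  fixes a b c p :: real
  assumes "0 \<le> a" "0 \<le> b" "0 \<le> c" "0 < p"
  shows "(a + b + c) powr p \<le> 3 powr p * (a powr p + b powr p + c powr p)"
proof -
  define M where "M = max a (max b c)"
  have M: "a \<le> M" "b \<le> M" "c \<le> M" "M \<in> {a, b, c}" by (auto simp: M_def max_def)
  have "(a + b + c) powr p \<le> (3 * M) powr p"
    using M assms by (intro powr_mono2) auto
  also have "\<dots> = 3 powr p * M powr p" using M assms by (auto simp: powr_mult)
  also have "M powr p \<le> a powr p + b powr p + c powr p" using M(4) by auto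
  finally show ?thesis by simp
qed

section \<open>Bounded functions of bounded support, truncation, and the limit in L^p(w)\<close>

context Ap_weight
begin

lemma Lp_mass_eq_integral:
  assumes "integrable lborel (\<lambda>x. \<bar>f x\<bar> powr p * w x)"
  shows "Lp_mass f = ennreal (LINT x|lborel. \<bar>f x\<bar> powr p * w x)"
  unfolding Lp_mass_def using assms w_pos by (intro nn_integral_eq_integral) (auto simp: less_imp_le)

lemma integrable_if_Lp_mass_finite:
  assumes [measurable]: "f \<in> borel_measurable borel" and "Lp_mass f < \<infinity>"
  shows "integrable lborel (\<lambda>x. \<bar>f x\<bar> powr p * w x)"
proof (rule integrableI_bounded)
  have "ennreal (norm (\<bar>f x\<bar> powr p * w x)) = ennreal (\<bar>f x\<bar> powr p * w x)" for x
    using w_pos[of x] by simp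
  then show "(\<integral>\<^sup>+x. ennreal (norm (\<bar>f x\<bar> powr p * w x)) \<partial>lborel) < \<infinity>"
    using assms(2) by (simp add: Lp_mass_def)
qed measurable

lemma Lp_mass_mono: "(\<And>x. \<bar>f x\<bar> \<le> \<bar>g x\<bar>) \<Longrightarrow> Lp_mass f \<le> Lp_mass g"
  unfolding Lp_mass_def using w_pos p_gt_1
  by (intro nn_integral_mono ennreal_leI mult_right_mono powr_mono2) (auto simp: less_imp_le)

lemma Lp_mass_sum3_le:
  assumes [measurable]: "f \<in> borel_measurable borel" "g \<in> borel_measurable borel" "h \<in> borel_measurable borel"
  shows "Lp_mass (\<lambda>x. f x + g x + h x) \<le> ennreal (3 powr p) * (Lp_mass f + Lp_mass g + Lp_mass h)"
proof -
  have "Lp_mass (\<lambda>x. f x + g x + h x) \<le> (\<integral>\<^sup>+x. ennreal (3 powr p) * (ennreal (\<bar>f x\<bar> powr p * w x) +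
      ennreal (\<bar>g x\<bar> powr p * w x) + ennreal (\<bar>h x\<bar> powr p * w x)) \<partial>lborel)"
    unfolding Lp_mass_def
  proof (rule nn_integral_mono)
    fix x
    have "\<bar>f x + g x + h x\<bar> powr p \<le> (\<bar>f x\<bar> + \<bar>g x\<bar> + \<bar>h x\<bar>) powr p"
      using p_gt_1 by (intro powr_mono2) auto
    also have "\<dots> \<le> 3 powr p * (\<bar>f x\<bar> powr p + \<bar>g x\<bar> powr p + \<bar>h x\<bar> powr p)"
      using p_gt_1 by (intro powr_sum3_le) auto
    finally have "\<bar>f x + g x + h x\<bar> powr p * w x \<le> 3 powr p * (\<bar>f x\<bar> powr p + \<bar>g x\<bar> powr p + \<bar>h x\<bar> powr p) * w x"
      using w_pos[of x] by (intro mult_right_mono) auto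
    also have "\<dots> = 3 powr p * (\<bar>f x\<bar> powr p * w x + \<bar>g x\<bar> powr p * w x + \<bar>h x\<bar> powr p * w x)"
      by (simp add: algebra_simps)
    finally have "ennreal (\<bar>f x + g x + h x\<bar> powr p * w x)
        \<le> ennreal (3 powr p * (\<bar>f x\<bar> powr p * w x + \<bar>g x\<bar> powr p * w x + \<bar>h x\<bar> powr p * w x))"
      by (rule ennreal_leI)
    also have "\<dots> = ennreal (3 powr p) * (ennreal (\<bar>f x\<bar> powr p * w x) +
      ennreal (\<bar>g x\<bar> powr p * w x) + ennreal (\<bar>h x\<bar> powr p * w x))"
      using w_pos[of x] by (simp add: ennreal_mult' ennreal_plus)
    finally show "ennreal (\<bar>f x + g x + h x\<bar> powr p * w x) \<le> ennreal (3 powr p) * (ennreal (\<bar>f x\<bar> powr p * w x) +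
      ennreal (\<bar>g x\<bar> powr p * w x) + ennreal (\<bar>h x\<bar> powr p * w x))" .
  qed
  also have "\<dots> = ennreal (3 powr p) * (Lp_mass f + Lp_mass g + Lp_mass h)"
    by (simp add: nn_integral_cmult nn_integral_add Lp_mass_def)
  finally show ?thesis .
qed

lemma integrable_weight_interval: "integrable lborel (\<lambda>x. indicator {a..b} x * w x)"
proof (rule integrableI_bounded)
  have "(\<integral>\<^sup>+x. ennreal (norm (indicator {a..b} x * w x)) \<partial>lborel)
      \<le> (\<integral>\<^sup>+x. ennreal (w x) * indicator {b - (\<bar>b - a\<bar> + 1)..b} x \<partial>lborel)"
    using w_pos by (intro nn_integral_mono) (auto split: split_indicator simp: less_imp_le)
  also have "\<dots> < \<infinity>" by (rule finite_weight) auto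
  finally show "(\<integral>\<^sup>+x. ennreal (norm (indicator {a..b} x * w x)) \<partial>lborel) < \<infinity>" .
qed measurable

lemma Lp_mass_finite_bounded_support:
  assumes [measurable]: "g \<in> borel_measurable borel" and N: "\<And>x. \<bar>g x\<bar> \<le> N" "\<And>x. N < \<bar>x\<bar> \<Longrightarrow> g x = 0"
  shows "Lp_mass g < \<infinity>"
proof -
  have "Lp_mass g \<le> (\<integral>\<^sup>+x. ennreal (N powr p) * ennreal (norm (indicator {-N..N} x * w x)) \<partial>lborel)"
    unfolding Lp_mass_def
  proof (rule nn_integral_mono)
    fix x
    show "ennreal (\<bar>g x\<bar> powr p * w x) \<le> ennreal (N powr p) * ennreal (norm (indicator {-N..N} x * w x))"
    proof (cases "x \<in> {-N..N}")
      case True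
      then show ?thesis
        using w_pos[of x] N(1)[of x] p_gt_1
        by (auto simp: ennreal_mult'[symmetric] intro!: ennreal_leI mult_right_mono powr_mono2)
    next
      case False
      then have "g x = 0" by (intro N(2)) auto
      then show ?thesis by simp
    qed
  qed
  also have "\<dots> = ennreal (N powr p) * (\<integral>\<^sup>+x. ennreal (norm (indicator {-N..N} x * w x)) \<partial>lborel)"
    by (rule nn_integral_cmult) measurable
  also have "\<dots> < \<infinity>"
    using integrable_weight_interval[of "-N" N] by (simp add: integrable_iff_bounded ennreal_mult_less_top)
  finally show ?thesis .
qed

text \<open>Dominated convergence in \<open>x\<close>, with a majorant for three regions: right of
  the support the extension is 0; on \<open>[-N - 1, N]\<close> the difference is bounded by
  \<open>2 * N\<close>; further left the extension at time 1 dominates, and it lies in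
  \<open>L^p(w)\<close> by the uniform bound. The unit margin on the left is the distance required
  by \<open>extension_abs_far\<close>.\<close>

lemma extension_Lp_tendsto_bounded_support:
  assumes gm [measurable]: "g \<in> borel_measurable borel"
    and N: "\<And>x. \<bar>g x\<bar> \<le> N" "\<And>x. N < \<bar>x\<bar> \<Longrightarrow> g x = 0" and a: "0 < \<alpha>"
  shows "((\<lambda>t. Lp_mass (\<lambda>x. extension \<alpha> g x t - g x)) \<longlongrightarrow> 0) (at_right 0)"
proof -
  have N0: "0 \<le> N" using N(1)[of 0] by linarith
  have g: "linear_growth g" using N(1) by (rule linear_growth_bounded[OF gm])
  note g' = linear_growth_abs[OF g]
  have Lg: "Lp_mass g < \<infinity>" using N by (rule Lp_mass_finite_bounded_support[OF gm])
  obtain D where D: "0 \<le> D" "\<And>f t. linear_growth f \<Longrightarrow> 0 < t \<Longrightarrow>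
    Lp_mass (\<lambda>x. extension \<alpha> (\<lambda>x. \<bar>f x\<bar>) x t) \<le> ennreal D * Lp_mass f"
    using Lp_mass_extension_bound[OF a] by blast
  define G where "G x = extension \<alpha> (\<lambda>x. \<bar>g x\<bar>) x 1" for x
  have Gm [measurable]: "G \<in> borel_measurable borel"
    unfolding G_def by (rule borel_measurable_extension[OF g' a]) simp
  have G0: "0 \<le> G x" for x unfolding G_def by (rule extension_abs_nonneg[OF g a])
  have "Lp_mass G \<le> ennreal D * Lp_mass g"
    unfolding G_def by (rule D(2)[OF g]) simp
  also have "\<dots> < \<infinity>" using Lg by (simp add: ennreal_mult_less_top)
  finally have G_int: "integrable lborel (\<lambda>x. \<bar>G x\<bar> powr p * w x)"
    by (rule integrable_if_Lp_mass_finite[OF Gm])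
  \<comment> \<open>Set to 0 for \<open>t \<le> 0\<close>: dominated convergence asks for
    measurability at every parameter, while measurability of the extension is known for
    \<open>t > 0\<close>.\<close>
  define F where "F t x = \<bar>if 0 < t then extension \<alpha> g x t - g x else 0\<bar> powr p * w x" for t x
  have Fm [measurable]: "F t \<in> borel_measurable borel" for t
  proof (cases "0 < t")
    case True
    have [measurable]: "(\<lambda>x. extension \<alpha> g x t) \<in> borel_measurable borel"
      by (rule borel_measurable_extension[OF g a True])
    show ?thesis unfolding F_def using True by simp measurable
  qed (simp add: F_def[abs_def])
  define H where "H x = (2 * N) powr p * (indicator {-N-1..N} x * w x) + exp (1/4) powr p * (\<bar>G x\<bar> powr p * w x)" for x
  have H_int: "integrable lborel H"
    unfolding H_def using integrable_weight_interval[of "-N-1" N] G_int by auto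
  have bound: "\<bar>F t x\<bar> \<le> H x" if t: "0 < t" "t \<le> 1" for t x
  proof -
    have U_le: "\<bar>extension \<alpha> g x t\<bar> \<le> N"
      using abs_extension_le[OF g a, of x t] extension_abs_le_bound[OF gm N(1) a t(1), of x] by linarith
    have w0: "0 \<le> w x" using w_pos[of x] by simp
    consider "N < x" | "x \<in> {-N-1..N}" | "x < -N-1" by fastforce
    then show ?thesis
    proof cases
      case 1
      then have "extension \<alpha> g x t = 0" "g x = 0"
        using N(2) N0 by (auto intro!: extension_eq_0_right)
      then show ?thesis using t w0 by (simp add: F_def H_def)
    next
      case 2
      have "\<bar>extension \<alpha> g x t - g x\<bar> powr p \<le> (2 * N) powr p"
        using U_le N(1)[of x] p_gt_1 by (intro powr_mono2) auto
      then have "\<bar>extension \<alpha> g x t - g x\<bar> powr p * w x \<le> (2 * N) powr p * w x"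
        using w0 by (rule mult_right_mono)
      then show ?thesis using 2 t w0 by (simp add: F_def H_def add_increasing2)
    next
      case 3
      have gx: "g x = 0" using 3 N0 by (intro N(2)) auto
      have "\<bar>extension \<alpha> g x t\<bar> \<le> extension \<alpha> (\<lambda>x. \<bar>g x\<bar>) x t"
        by (rule abs_extension_le[OF g a])
      also have "\<dots> \<le> exp (1/4) * G x"
        unfolding G_def using 3 N0 by (intro extension_abs_far[OF g _ a t] N(2)) auto
      finally have "\<bar>extension \<alpha> g x t\<bar> powr p \<le> (exp (1/4) * G x) powr p"
        using p_gt_1 by (intro powr_mono2) auto
      also have "\<dots> = exp (1/4) powr p * \<bar>G x\<bar> powr p"
        using G0[of x] by (simp add: powr_mult)
      finally have "\<bar>extension \<alpha> g x t\<bar> powr p * w x \<le> exp (1/4) powr p * \<bar>G x\<bar> powr p * w x"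
        using w0 by (rule mult_right_mono)
      then show ?thesis using 3 t w0 gx by (simp add: F_def H_def mult.assoc)
    qed
  qed
  have "((\<lambda>t. LINT x|lborel. F t x) \<longlongrightarrow> integral\<^sup>L lborel (\<lambda>_::real. 0)) (at 0 within {0<..})"
  proof (rule tendsto_integral_dominated[OF _ _ H_int])
    show "\<forall>\<^sub>F t in at_right 0. AE x in lborel. \<bar>F t x\<bar> \<le> H x"
      unfolding eventually_at_right_field
      by (intro exI[of _ 1]) (auto intro!: AE_I2 bound)
    have "AE x in lborel. ((\<lambda>t. extension \<alpha> g x t) \<longlongrightarrow> g x) (at_right 0)"
      using extension_tendsto_AE[OF g a] by (simp add: AE_completion_iff)
    then show "AE x in lborel. ((\<lambda>t. F t x) \<longlongrightarrow> 0) (at_right 0)"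
    proof eventually_elim
      case (elim x)
      have "((\<lambda>t. \<bar>extension \<alpha> g x t - g x\<bar>) \<longlongrightarrow> 0) (at_right 0)"
        using tendsto_rabs[OF tendsto_diff[OF elim tendsto_const[of "g x"]]] by simp
      then have "((\<lambda>t. \<bar>extension \<alpha> g x t - g x\<bar> powr p * w x) \<longlongrightarrow> 0 powr p * w x) (at_right 0)"
        using p_gt_1 by (intro tendsto_mult tendsto_powr' tendsto_const) auto
      moreover have "\<forall>\<^sub>F t in at_right 0. \<bar>extension \<alpha> g x t - g x\<bar> powr p * w x = F t x"
        using eventually_at_right_less[of 0] by eventually_elim (simp add: F_def)
      ultimately show ?case using Lim_transform_eventually by fastforce
    qed
  qed auto
  then have "((\<lambda>t. ennreal (LINT x|lborel. F t x)) \<longlongrightarrow> ennreal 0) (at_right 0)"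
    by (intro tendsto_ennrealI) simp
  moreover have "\<forall>\<^sub>F t in at_right 0. ennreal (LINT x|lborel. F t x) = Lp_mass (\<lambda>x. extension \<alpha> g x t - g x)"
    unfolding eventually_at_right_field
  proof (intro exI[of _ 1] conjI allI impI)
    fix t :: real assume t: "0 < t" "t < 1"
    have F_eq: "F t = (\<lambda>x. \<bar>extension \<alpha> g x t - g x\<bar> powr p * w x)"
      using t by (simp add: F_def[abs_def])
    have "integrable lborel (F t)"
      by (rule Bochner_Integration.integrable_bound[OF H_int])
        (use t in \<open>auto intro!: AE_I2 order_trans[OF bound abs_ge_self]\<close>)
    then show "ennreal (LINT x|lborel. F t x) = Lp_mass (\<lambda>x. extension \<alpha> g x t - g x)"
      unfolding F_eq by (rule Lp_mass_eq_integral[symmetric])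
  qed simp
  ultimately have "((\<lambda>t. Lp_mass (\<lambda>x. extension \<alpha> g x t - g x)) \<longlongrightarrow> ennreal 0) (at_right 0)"
    by (rule Lim_transform_eventually)
  then show ?thesis by simp
qed

lemma Lp_mass_truncation:
  assumes fm [measurable]: "f \<in> borel_measurable borel" and fin: "Lp_mass f < \<infinity>"
  shows "(\<lambda>n. Lp_mass (\<lambda>x. f x - (if \<bar>x\<bar> \<le> real n \<and> \<bar>f x\<bar> \<le> real n then f x else 0))) \<longlonglongrightarrow> 0"
proof -
  let ?T = "\<lambda>n x. if \<bar>x\<bar> \<le> real n \<and> \<bar>f x\<bar> \<le> real n then f x else 0"
  have "(\<lambda>n. \<integral>\<^sup>+x. ennreal (\<bar>f x - ?T n x\<bar> powr p * w x) \<partial>lborel) \<longlonglongrightarrow> (\<integral>\<^sup>+x. 0 \<partial>(lborel :: real measure))"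
  proof (rule nn_integral_dominated_convergence[where w = "\<lambda>x. ennreal (\<bar>f x\<bar> powr p * w x)"])
    show "AE x in lborel. ennreal (\<bar>f x - ?T n x\<bar> powr p * w x) \<le> ennreal (\<bar>f x\<bar> powr p * w x)" for n
      using w_pos by (intro AE_I2) (auto simp: less_imp_le)
    show "AE x in lborel. (\<lambda>n. ennreal (\<bar>f x - ?T n x\<bar> powr p * w x)) \<longlonglongrightarrow> 0"
    proof (rule AE_I2)
      fix x
      obtain n\<^sub>0 :: nat where n\<^sub>0: "max \<bar>x\<bar> \<bar>f x\<bar> \<le> real n\<^sub>0" using real_arch_simple by blast
      have "\<forall>\<^sub>F n in sequentially. ennreal (\<bar>f x - ?T n x\<bar> powr p * w x) = 0"
        using eventually_ge_at_top[of n\<^sub>0] by eventually_elim (use n\<^sub>0 in auto)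
      then show "(\<lambda>n. ennreal (\<bar>f x - ?T n x\<bar> powr p * w x)) \<longlonglongrightarrow> 0"
        by (rule tendsto_eventually)
    qed
  qed (use fin in \<open>auto simp: Lp_mass_def\<close>)
  then show ?thesis by (simp add: Lp_mass_def)
qed

lemma extension_Lp_tendsto:
  assumes fm [measurable]: "f \<in> borel_measurable borel" and fin: "Lp_mass f < \<infinity>" and a: "0 < \<alpha>"
  shows "((\<lambda>t. Lp_mass (\<lambda>x. extension \<alpha> f x t - f x)) \<longlongrightarrow> 0) (at_right 0)"
proof -
  obtain D where D: "0 \<le> D" "\<And>f t. linear_growth f \<Longrightarrow> 0 < t \<Longrightarrow>
    Lp_mass (\<lambda>x. extension \<alpha> (\<lambda>x. \<bar>f x\<bar>) x t) \<le> ennreal D * Lp_mass f"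
    using Lp_mass_extension_bound[OF a] by blast
  define T where "T n x = (if \<bar>x\<bar> \<le> real n \<and> \<bar>f x\<bar> \<le> real n then f x else 0)" for n x
  have Tm [measurable]: "T n \<in> borel_measurable borel" for n unfolding T_def by measurable
  let ?R = "\<lambda>n. Lp_mass (\<lambda>x. f x - T n x)"
  let ?E = "\<lambda>n t. Lp_mass (\<lambda>x. extension \<alpha> (T n) x t - T n x)"
  have T_bound: "\<bar>T n x\<bar> \<le> real n" "real n < \<bar>x\<bar> \<Longrightarrow> T n x = 0" for n x by (auto simp: T_def)
  have f: "linear_growth f" using fin by (rule linear_growth_if_Lp[OF fm])
  have T: "linear_growth (T n)" for n using T_bound(1) by (rule linear_growth_bounded[OF Tm])
  have fT: "linear_growth (\<lambda>x. f x - T n x)" for n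
  proof (rule linear_growth_if_Lp)
    have "?R n \<le> Lp_mass f" by (rule Lp_mass_mono) (auto simp: T_def)
    then show "?R n < \<infinity>" using fin by (rule le_less_trans)
  qed measurable
  \<comment> \<open>The term with \<open>?R n\<close> does not depend on \<open>t\<close>:
    \<open>D\<close> accounts for the extension of the tail \<open>f - T n\<close>, the summand 1
    for the tail itself. So \<open>n\<close> can be fixed first and \<open>t\<close> sent to 0
    afterwards.\<close>
  have split: "Lp_mass (\<lambda>x. extension \<alpha> f x t - f x) \<le> ennreal (3 powr p) *
      (ennreal (D + 1) * ?R n + ?E n t)"
    if t: "0 < t" for t n
  proof -
    have [measurable]: "(\<lambda>x. extension \<alpha> (\<lambda>x. f x - T n x) x t) \<in> borel_measurable borel"
      "(\<lambda>x. extension \<alpha> (T n) x t) \<in> borel_measurable borel"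
      by (rule borel_measurable_extension[OF fT a t] borel_measurable_extension[OF T a t])+
    have "Lp_mass (\<lambda>x. extension \<alpha> f x t - f x) =
       Lp_mass (\<lambda>x. extension \<alpha> (\<lambda>x. f x - T n x) x t + (extension \<alpha> (T n) x t - T n x) + (T n x - f x))"
      by (simp add: extension_diff[OF f T a t])
    also have "\<dots> \<le> ennreal (3 powr p) * (Lp_mass (\<lambda>x. extension \<alpha> (\<lambda>x. f x - T n x) x t) +
        ?E n t + Lp_mass (\<lambda>x. T n x - f x))"
      by (rule Lp_mass_sum3_le) measurable
    also have "Lp_mass (\<lambda>x. T n x - f x) = ?R n"
      by (simp add: Lp_mass_def abs_minus_commute)
    also have "Lp_mass (\<lambda>x. extension \<alpha> (\<lambda>x. f x - T n x) x t) \<le> Lp_mass (\<lambda>x. extension \<alpha> (\<lambda>x. \<bar>f x - T n x\<bar>) x t)"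
      by (rule Lp_mass_mono) (rule order_trans[OF abs_extension_le[OF fT a] abs_ge_self])
    also have "\<dots> \<le> ennreal D * ?R n"
      by (rule D(2)[OF fT t])
    finally have "Lp_mass (\<lambda>x. extension \<alpha> f x t - f x) \<le> ennreal (3 powr p) * (ennreal D * ?R n +
        ?E n t + ?R n)"
      by (simp add: mult_left_mono add_mono)
    also have "ennreal D * ?R n + ?E n t + ?R n
       = ennreal (D + 1) * ?R n + ?E n t"
      using D(1) by (simp add: ennreal_plus distrib_right add_ac)
    finally show ?thesis .
  qed
  show ?thesis
  proof (rule order_tendstoI)
    fix e :: ennreal assume e: "0 < e"
    have "(\<lambda>n. ennreal (3 powr p) * (ennreal (D + 1) * ?R n)) \<longlonglongrightarrow> ennreal (3 powr p) * (ennreal (D + 1) * 0)"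
      using Lp_mass_truncation[OF fm fin] unfolding T_def by (intro tendsto_mult_ennreal tendsto_const) auto
    then have "\<forall>\<^sub>F n in sequentially. ennreal (3 powr p) * (ennreal (D + 1) * ?R n) < e"
      using e by (intro order_tendstoD) auto
    then obtain n where n: "ennreal (3 powr p) * (ennreal (D + 1) * ?R n) < e"
      by (auto simp: eventually_sequentially)
    have "((\<lambda>t. ?E n t) \<longlongrightarrow> 0) (at_right 0)"
      by (rule extension_Lp_tendsto_bounded_support[OF Tm T_bound a])
    then have "((\<lambda>t. ennreal (3 powr p) * (ennreal (D + 1) * ?R n + ?E n t))
      \<longlongrightarrow> ennreal (3 powr p) * (ennreal (D + 1) * ?R n + 0)) (at_right 0)"
      by (intro tendsto_mult_ennreal tendsto_add tendsto_const) auto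
    then have "\<forall>\<^sub>F t in at_right 0. ennreal (3 powr p) * (ennreal (D + 1) * ?R n + ?E n t) < e"
      using n by (intro order_tendstoD) auto
    then show "\<forall>\<^sub>F t in at_right 0. Lp_mass (\<lambda>x. extension \<alpha> f x t - f x) < e"
      using eventually_at_right_less[of 0] by eventually_elim (use split le_less_trans in blast)
  qed auto
qed

end

section \<open>The distributional limit\<close>

text \<open>Up to the factor \<open>1 / \<bar>Gamma (-\<alpha>)\<bar>\<close>, the fractional
  derivative with the absolute value inside the integral. With values in \<open>ennreal\<close>,
  everything needed of a test function becomes a finiteness condition.\<close>

definition dpsi :: "real \<Rightarrow> (real \<Rightarrow> real) \<Rightarrow> real \<Rightarrow> ennreal" where
  "dpsi \<alpha> \<phi> y = (\<integral>\<^sup>+s. ennreal (indicator {0<..} s * \<bar>\<phi> (y - s) - \<phi> y\<bar> * s powr (-1 - \<alpha>)) \<partial>lborel)"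

text \<open>The convolution kernel of \<open>t powr (1 - 2 * \<alpha>)\<close> times the
  t-derivative of the extension. It equals \<open>-2 * ext_const \<alpha>\<close> times the
  s-derivative of \<open>ekern \<alpha> t\<close>.\<close>

definition flux_kern :: "real \<Rightarrow> real \<Rightarrow> real \<Rightarrow> real" where
  "flux_kern \<alpha> t s = ext_const \<alpha> * (2 * \<alpha> * ekern (1 + \<alpha>) t s - t\<^sup>2 / 2 * ekern (2 + \<alpha>) t s)"

lemma measurable_dpsi [measurable]:
  assumes [measurable]: "\<phi> \<in> borel_measurable borel"
  shows "dpsi \<alpha> \<phi> \<in> borel_measurable borel"
  unfolding dpsi_def by measurable

lemma measurable_flux_kern [measurable]:
  assumes [measurable]: "f \<in> borel_measurable M" "g \<in> borel_measurable M"
  shows "(\<lambda>x. flux_kern \<alpha> (f x) (g x)) \<in> borel_measurable M"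
  unfolding flux_kern_def by measurable

lemma flux_kern_eq_0: "s \<le> 0 \<Longrightarrow> flux_kern \<alpha> t s = 0"
  by (simp add: flux_kern_def ekern_eq_0)

lemma integrable_flux_kern:
  assumes "0 < \<alpha>" "0 < t"
  shows "integrable lborel (flux_kern \<alpha> t)"
  unfolding flux_kern_def using assms
  by (intro integrable_mult_right Bochner_Integration.integrable_diff integrable_ekern) auto

lemma integral_flux_kern:
  assumes "0 < \<alpha>" "0 < t"
  shows "(LINT s|lborel. flux_kern \<alpha> t s) = 0"
proof -
  have "flux_kern \<alpha> t s = 2 * ext_const \<alpha> * (indicator {0..} s * (\<alpha> * ekern (\<alpha> + 1) t s - t\<^sup>2 / 4 * ekern (\<alpha> + 2) t s))" for s
    by (cases "0 \<le> s") (auto simp: flux_kern_def ekern_eq_0 algebra_simps)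
  then show ?thesis
    using integral_indicator_ekern_deriv[OF assms, of 0] by (simp add: ekern_eq_0)
qed

text \<open>The bound has to be uniform in \<open>t\<close>. With
  \<open>z = t\<^sup>2 / (4 * s)\<close> the second kernel with its factor
  \<open>t\<^sup>2 / 2\<close> is \<open>2 * z * exp (-z)\<close> times
  \<open>s powr (-1 - \<alpha>)\<close>, and \<open>z * exp (-z) \<le> 1\<close>.\<close>

lemma flux_kern_bound:
  assumes a: "0 < \<alpha>" and s: "0 < s"
  shows "\<bar>flux_kern \<alpha> t s\<bar> \<le> ext_const \<alpha> * (2 * \<alpha> + 2) * s powr (-1 - \<alpha>)"
proof -
  let ?z = "t\<^sup>2 / (4 * s)"
  have z: "?z * exp (-?z) \<le> 1"
  proof -
    have "u \<le> exp u" for u :: real using exp_ge_add_one_self[of u] by linarith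
    then have "?z * exp (-?z) \<le> exp ?z * exp (-?z)" by (rule mult_right_mono) simp
    then show ?thesis by (simp only: mult_exp_exp) simp
  qed
  have "ekern (2 + \<alpha>) t s = s powr (-1) * (exp (-?z) * s powr (-(1 + \<alpha>)))"
    using s ekern_shift[OF s, of "1 + \<alpha>" 1 t] by (simp add: ekern_def add_ac)
  then have "t\<^sup>2 / 2 * ekern (2 + \<alpha>) t s = 2 * (?z * exp (-?z)) * s powr (-1 - \<alpha>)"
    using s by (simp add: powr_minus field_simps)
  also have "\<dots> \<le> 2 * 1 * s powr (-1 - \<alpha>)"
    using z by (intro mult_right_mono mult_left_mono) auto
  finally have 2: "t\<^sup>2 / 2 * ekern (2 + \<alpha>) t s \<le> 2 * s powr (-1 - \<alpha>)" by simp
  have 1: "ekern (1 + \<alpha>) t s \<le> s powr (-1 - \<alpha>)"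
    using ekern_le_powr[OF s, of "1 + \<alpha>" t] by simp
  have "\<bar>2 * \<alpha> * ekern (1 + \<alpha>) t s - t\<^sup>2 / 2 * ekern (2 + \<alpha>) t s\<bar>
      \<le> 2 * \<alpha> * ekern (1 + \<alpha>) t s + t\<^sup>2 / 2 * ekern (2 + \<alpha>) t s"
    using a by (intro order_trans[OF abs_triangle_ineq4]) (simp add: abs_mult ekern_nonneg)
  also have "\<dots> \<le> 2 * \<alpha> * s powr (-1 - \<alpha>) + 2 * s powr (-1 - \<alpha>)"
    using 1 2 a by (intro add_mono mult_left_mono) auto
  also have "\<dots> = (2 * \<alpha> + 2) * s powr (-1 - \<alpha>)" by (simp add: algebra_simps)
  finally show ?thesis
    using ext_const_pos[OF a] by (simp add: flux_kern_def abs_mult mult.assoc mult_left_mono)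
qed

lemma flux_kern_tendsto:
  "((\<lambda>t. flux_kern \<alpha> t s) \<longlongrightarrow> 2 * \<alpha> * ext_const \<alpha> * (indicator {0<..} s * s powr (-1 - \<alpha>))) (at_right 0)"
proof (cases "0 < s")
  case True
  have E: "((\<lambda>t. ekern b t s) \<longlongrightarrow> s powr (-b)) (at_right 0)" for b
  proof -
    have "((\<lambda>t. exp (-(t\<^sup>2 / (4 * s))) * s powr (-b)) \<longlongrightarrow> exp (-(0\<^sup>2 / (4 * s))) * s powr (-b)) (at_right 0)"
      using True by (intro tendsto_intros) auto
    then show ?thesis using True by (simp add: ekern_def)
  qed
  have "((\<lambda>t. flux_kern \<alpha> t s) \<longlongrightarrow>
      ext_const \<alpha> * (2 * \<alpha> * s powr (-(1 + \<alpha>)) - 0\<^sup>2 / 2 * s powr (-(2 + \<alpha>)))) (at_right 0)"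
    unfolding flux_kern_def by (intro tendsto_intros E) auto
  then show ?thesis using True by (simp add: mult_ac)
qed (simp add: flux_kern_eq_0)

lemma flux_eq_conv:
  assumes f: "linear_growth f" and a: "0 < \<alpha>" and t: "0 < t"
  shows "t powr (1 - 2 * \<alpha>) * deriv (\<lambda>\<tau>. extension \<alpha> f x \<tau>) t = (LINT y|lborel. flux_kern \<alpha> t (y - x) * f y)"
proof -
  have b: "1 < 1 + \<alpha>" "1 < 2 + \<alpha>" using a by auto
  note int = integrable_kconv[OF f b(1) t, of x] integrable_kconv[OF f b(2) t, of x]
  have "deriv (\<lambda>\<tau>. extension \<alpha> f x \<tau>) t = t powr (2 * \<alpha>) / (4 powr \<alpha> * Gamma \<alpha>) *
       (2 * \<alpha> / t * kconv (1 + \<alpha>) f x t - t / 2 * kconv (2 + \<alpha>) f x t)"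
    by (rule DERIV_imp_deriv[OF extension_deriv_time[OF f a t]])
  then have "t powr (1 - 2 * \<alpha>) * deriv (\<lambda>\<tau>. extension \<alpha> f x \<tau>) t = (t powr (1 - 2 * \<alpha>) * t powr (2 * \<alpha>)) *
      (ext_const \<alpha> * (2 * \<alpha> / t * kconv (1 + \<alpha>) f x t - t / 2 * kconv (2 + \<alpha>) f x t))"
    by (simp add: ext_const_def)
  also have "t powr (1 - 2 * \<alpha>) * t powr (2 * \<alpha>) = t"
    using t by (subst powr_add[symmetric]) simp
  also have "t * (ext_const \<alpha> * (2 * \<alpha> / t * kconv (1 + \<alpha>) f x t - t / 2 * kconv (2 + \<alpha>) f x t))
      = ext_const \<alpha> * (2 * \<alpha> * kconv (1 + \<alpha>) f x t - t\<^sup>2 / 2 * kconv (2 + \<alpha>) f x t)"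
    using t by (simp add: field_simps power2_eq_square)
  also have "\<dots> = (LINT y|lborel. ext_const \<alpha> * (2 * \<alpha> * (ekern (1 + \<alpha>) t (y - x) * f y) - t\<^sup>2 / 2 * (ekern (2 + \<alpha>) t (y - x) * f y)))"
    unfolding kconv_def using int
    by (simp only: integral_mult_right_zero Bochner_Integration.integral_diff[OF integrable_mult_right[OF int(1)] integrable_mult_right[OF int(2)]])
  also have "\<dots> = (LINT y|lborel. flux_kern \<alpha> t (y - x) * f y)"
    by (intro Bochner_Integration.integral_cong) (simp_all add: flux_kern_def algebra_simps)
  finally show ?thesis .
qed

text \<open>The identity that dictates \<open>c_const\<close>:
  \<open>2 * \<alpha> * ext_const \<alpha>\<close> is the coefficient of
  \<open>s powr (-1 - \<alpha>)\<close> in the limit of the flux kernel, and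
  \<open>Gamma (1 - \<alpha>) = - \<alpha> * Gamma (-\<alpha>)\<close> converts the product into the
  normalisation of \<open>frac_D_left\<close>.\<close>

lemma frac_const:
  assumes "0 < \<alpha>" "\<alpha> < 1"
  shows "- c_const \<alpha> * (2 * \<alpha> * ext_const \<alpha>) = 1 / Gamma (-\<alpha>)"
proof -
  have "-\<alpha> \<notin> \<int>\<^sub>\<le>\<^sub>0"
  proof
    assume "-\<alpha> \<in> \<int>\<^sub>\<le>\<^sub>0"
    then obtain n :: int where "-\<alpha> = of_int n" by (auto elim!: nonpos_Ints_cases)
    then have "-1 < n" "n < 0" using assms by linarith+
    then show False by linarith
  qed
  then have G: "Gamma (1 - \<alpha>) = -\<alpha> * Gamma (-\<alpha>)"
    using Gamma_plus1[of "-\<alpha>"] by (simp add: add.commute)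
  have "4 powr (\<alpha> - 1/2) = 4 powr \<alpha> / (2::real)"
    by (simp add: powr_diff powr_half_sqrt)
  moreover have "0 < Gamma \<alpha>" "0 < Gamma (1 - \<alpha>)" using assms by (auto intro: Gamma_real_pos)
  moreover have "Gamma (-\<alpha>) \<noteq> 0" using G \<open>0 < Gamma (1 - \<alpha>)\<close> by auto
  moreover have "Gamma \<alpha> \<noteq> 0" using \<open>0 < Gamma \<alpha>\<close> by simp
  ultimately show ?thesis
    using assms G by (simp add: c_const_def ext_const_def field_simps)
qed

lemma frac_D_left_eq:
  assumes [measurable]: "\<phi> \<in> borel_measurable borel"
  shows "frac_D_left \<alpha> \<phi> y = 1 / Gamma (-\<alpha>) *
    (LINT s|lborel. (indicator {0<..} s * s powr (-1 - \<alpha>)) * (\<phi> (y - s) - \<phi> y))"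
proof -
  have "(LINT s:{0<..}|lebesgue. (\<phi> (y - s) - \<phi> y) / s powr (1 + \<alpha>))
      = (LINT s|lebesgue. (indicator {0<..} s * s powr (-1 - \<alpha>)) * (\<phi> (y - s) - \<phi> y))"
    unfolding set_lebesgue_integral_def
  proof (rule Bochner_Integration.integral_cong[OF refl])
    fix s
    have "s powr (-1 - \<alpha>) = 1 / s powr (1 + \<alpha>)"
      using powr_minus_divide[of s "1 + \<alpha>"] by simp
    then show "indicat_real {0<..} s *\<^sub>R ((\<phi> (y - s) - \<phi> y) / s powr (1 + \<alpha>))
      = (indicator {0<..} s * s powr (-1 - \<alpha>)) * (\<phi> (y - s) - \<phi> y)" by simp
  qed
  also have "\<dots> = (LINT s|lborel. (indicator {0<..} s * s powr (-1 - \<alpha>)) * (\<phi> (y - s) - \<phi> y))"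
    by (rule integral_completion) measurable
  finally show ?thesis by (simp add: frac_D_left_def)
qed

text \<open>Fubini's theorem moves the convolution from \<open>f\<close> to \<open>\<phi>\<close>.
  As the flux kernel has integral 0, \<open>\<phi> (y - s)\<close> may be replaced by
  \<open>\<phi> (y - s) - \<phi> y\<close>; then a constant times
  \<open>dpsi \<alpha> \<phi> y\<close> is a majorant for all \<open>t\<close>. Dominated
  convergence is used twice, in \<open>s\<close> for fixed \<open>y\<close> and then in
  \<open>y\<close>.\<close>

lemma distributional_limit_single:
  assumes f: "linear_growth f" and a: "0 < \<alpha>" "\<alpha> < 1"
    and \<phi>m [measurable]: "\<phi> \<in> borel_measurable borel"
    and dfin: "\<And>y. dpsi \<alpha> \<phi> y < \<infinity>"
    and fin: "(\<integral>\<^sup>+y. ennreal \<bar>f y\<bar> * (dpsi \<alpha> \<phi> y + ennreal \<bar>\<phi> y\<bar>) \<partial>lborel) < \<infinity>"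
  shows "integrable lborel (\<lambda>x. f x * frac_D_left \<alpha> \<phi> x)" (is ?A)
    and "\<And>t. 0 < t \<Longrightarrow> integrable lborel (\<lambda>x. t powr (1 - 2 * \<alpha>) * deriv (\<lambda>\<tau>. extension \<alpha> f x \<tau>) t * \<phi> x)"
    and "((\<lambda>t. - c_const \<alpha> * (LINT x|lborel. t powr (1 - 2 * \<alpha>) * deriv (\<lambda>\<tau>. extension \<alpha> f x \<tau>) t * \<phi> x))
           \<longlongrightarrow> (LINT x|lborel. f x * frac_D_left \<alpha> \<phi> x)) (at_right 0)" (is ?B)
proof -
  have fm [measurable]: "f \<in> borel_measurable borel" using f by (rule linear_growth_measurable)
  let ?W = "\<lambda>t x. t powr (1 - 2 * \<alpha>) * deriv (\<lambda>\<tau>. extension \<alpha> f x \<tau>) t"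
  let ?d = "\<lambda>y s. \<bar>\<phi> (y - s) - \<phi> y\<bar>"
  define P where "P y = enn2real (dpsi \<alpha> \<phi> y)" for y
  have [measurable]: "P \<in> borel_measurable borel" unfolding P_def by measurable
  have P0: "0 \<le> P y" for y by (simp add: P_def)
  have P: "dpsi \<alpha> \<phi> y = ennreal (P y)" for y using dfin[of y] by (simp add: P_def)
  define Q where "Q = ext_const \<alpha> * (2 * \<alpha> + 2)"
  have Q: "0 \<le> Q" using a ext_const_pos[of \<alpha>] by (simp add: Q_def)
  define k where "k s = indicator {0<..} s * s powr (-1 - \<alpha>)" for s :: real
  have [measurable]: "k \<in> borel_measurable borel" unfolding k_def by measurable
  have k0: "0 \<le> k s" for s by (simp add: k_def)
  have dpsi_k: "dpsi \<alpha> \<phi> y = (\<integral>\<^sup>+s. ennreal (k s * ?d y s) \<partial>lborel)" for y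
    unfolding dpsi_def k_def by (simp add: mult_ac)
  have flux_k: "\<bar>flux_kern \<alpha> t s\<bar> \<le> Q * k s" for t s
    using flux_kern_bound[OF a(1), of s t] by (cases "0 < s") (auto simp: Q_def k_def flux_kern_eq_0)
  have k_int: "integrable lborel (\<lambda>s. k s * ?d y s)" for y
  proof (rule integrableI_bounded)
    show "(\<integral>\<^sup>+s. ennreal (norm (k s * ?d y s)) \<partial>lborel) < \<infinity>"
      using dfin[of y] k0 by (simp add: dpsi_k abs_mult)
  qed measurable
  have P_eq: "(LINT s|lborel. k s * ?d y s) = P y" for y
    unfolding P_def dpsi_k by (rule integral_eq_nn_integral) (auto simp: k0)
  have fP: "integrable lborel (\<lambda>y. \<bar>f y\<bar> * P y)" "integrable lborel (\<lambda>y. \<bar>f y\<bar> * \<bar>\<phi> y\<bar>)"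
  proof -
    have "(\<integral>\<^sup>+y. ennreal (norm (\<bar>f y\<bar> * P y)) \<partial>lborel) \<le> (\<integral>\<^sup>+y. ennreal \<bar>f y\<bar> * (dpsi \<alpha> \<phi> y + ennreal \<bar>\<phi> y\<bar>) \<partial>lborel)"
      "(\<integral>\<^sup>+y. ennreal (norm (\<bar>f y\<bar> * \<bar>\<phi> y\<bar>)) \<partial>lborel) \<le> (\<integral>\<^sup>+y. ennreal \<bar>f y\<bar> * (dpsi \<alpha> \<phi> y + ennreal \<bar>\<phi> y\<bar>) \<partial>lborel)"
      using P0 by (auto intro!: nn_integral_mono mult_left_mono simp: abs_mult ennreal_mult' P)
    then show "integrable lborel (\<lambda>y. \<bar>f y\<bar> * P y)" "integrable lborel (\<lambda>y. \<bar>f y\<bar> * \<bar>\<phi> y\<bar>)"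
      using fin by (auto intro!: integrableI_bounded dest: le_less_trans)
  qed
  define I where "I y = (LINT s|lborel. k s * (\<phi> (y - s) - \<phi> y))" for y
  have [measurable]: "I \<in> borel_measurable borel" unfolding I_def by measurable
  have I_bound: "\<bar>I y\<bar> \<le> P y" for y
  proof -
    have "\<bar>I y\<bar> \<le> (LINT s|lborel. \<bar>k s * (\<phi> (y - s) - \<phi> y)\<bar>)"
      unfolding I_def by (rule integral_abs_bound)
    also have "\<dots> = P y" by (simp add: abs_mult k0 P_eq)
    finally show ?thesis .
  qed
  have frac: "frac_D_left \<alpha> \<phi> y = 1 / Gamma (-\<alpha>) * I y" for y
    unfolding frac_D_left_eq[OF \<phi>m] I_def k_def ..
  have fI: "integrable lborel (\<lambda>y. f y * I y)"
    by (rule Bochner_Integration.integrable_bound[OF fP(1)])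
      (auto simp: abs_mult P0 intro!: AE_I2 mult_left_mono I_bound)
  then show ?A
    unfolding frac by (simp add: mult.left_commute)
  define J where "J t y = (LINT s|lborel. flux_kern \<alpha> t s * (\<phi> (y - s) - \<phi> y))" for t y
  have [measurable]: "J t \<in> borel_measurable borel" for t unfolding J_def by measurable
  have J_bound: "\<bar>J t y\<bar> \<le> Q * P y" for t y
  proof -
    have "\<bar>J t y\<bar> \<le> (LINT s|lborel. \<bar>flux_kern \<alpha> t s * (\<phi> (y - s) - \<phi> y)\<bar>)"
      unfolding J_def by (rule integral_abs_bound)
    also have "\<dots> \<le> (LINT s|lborel. Q * (k s * ?d y s))"
    proof (rule integral_mono')
      show "integrable lborel (\<lambda>s. Q * (k s * ?d y s))" using k_int by simp
      show "\<bar>flux_kern \<alpha> t s * (\<phi> (y - s) - \<phi> y)\<bar> \<le> Q * (k s * ?d y s)" for s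
        using mult_right_mono[OF flux_k[of t s], of "?d y s"] by (simp add: abs_mult mult.assoc)
    qed (use Q k0 in auto)
    also have "\<dots> = Q * P y" by (simp add: P_eq)
    finally show ?thesis .
  qed
  have J_tendsto: "((\<lambda>t. J t y) \<longlongrightarrow> 2 * \<alpha> * ext_const \<alpha> * I y) (at_right 0)" for y
  proof -
    have "((\<lambda>t. J t y) \<longlongrightarrow> (LINT s|lborel. 2 * \<alpha> * ext_const \<alpha> * k s * (\<phi> (y - s) - \<phi> y))) (at 0 within {0<..})"
      unfolding J_def
    proof (rule tendsto_integral_dominated[where g = "\<lambda>s. Q * (k s * ?d y s)"])
      show "\<forall>\<^sub>F t in at_right 0. AE s in lborel. \<bar>flux_kern \<alpha> t s * (\<phi> (y - s) - \<phi> y)\<bar> \<le> Q * (k s * ?d y s)"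
      proof (intro always_eventually allI AE_I2)
        fix t s show "\<bar>flux_kern \<alpha> t s * (\<phi> (y - s) - \<phi> y)\<bar> \<le> Q * (k s * ?d y s)"
          using mult_right_mono[OF flux_k[of t s], of "?d y s"] by (simp add: abs_mult mult.assoc)
      qed
      show "AE s in lborel. ((\<lambda>t. flux_kern \<alpha> t s * (\<phi> (y - s) - \<phi> y)) \<longlongrightarrow> 2 * \<alpha> * ext_const \<alpha> * k s * (\<phi> (y - s) - \<phi> y)) (at_right 0)"
        unfolding k_def by (intro AE_I2 tendsto_mult flux_kern_tendsto tendsto_const)
      show "integrable lborel (\<lambda>s. Q * (k s * ?d y s))" using k_int by simp
    qed measurable
    then show ?thesis by (simp add: I_def mult.assoc)
  qed
  have lim: "((\<lambda>t. LINT y|lborel. f y * J t y) \<longlongrightarrow> (LINT y|lborel. f y * (2 * \<alpha> * ext_const \<alpha> * I y))) (at 0 within {0<..})"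
  proof (rule tendsto_integral_dominated[where g = "\<lambda>y. Q * (\<bar>f y\<bar> * P y)"])
    show "\<forall>\<^sub>F t in at_right 0. AE y in lborel. \<bar>f y * J t y\<bar> \<le> Q * (\<bar>f y\<bar> * P y)"
    proof (intro always_eventually allI AE_I2)
      fix t y show "\<bar>f y * J t y\<bar> \<le> Q * (\<bar>f y\<bar> * P y)"
        using mult_left_mono[OF J_bound[of t y], of "\<bar>f y\<bar>"] by (simp add: abs_mult mult_ac)
    qed
    show "AE y in lborel. ((\<lambda>t. f y * J t y) \<longlongrightarrow> f y * (2 * \<alpha> * ext_const \<alpha> * I y)) (at_right 0)"
      by (intro AE_I2 tendsto_mult J_tendsto tendsto_const)
    show "integrable lborel (\<lambda>y. Q * (\<bar>f y\<bar> * P y))" using fP(1) by simp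
  qed measurable
  have main: "integrable lborel (\<lambda>x. ?W t x * \<phi> x) \<and>
     (LINT x|lborel. ?W t x * \<phi> x) = (LINT y|lborel. f y * J t y)"
    if t: "0 < t" for t
  proof -
    \<comment> \<open>\<open>R\<close> depends on \<open>t\<close> and grows like
      \<open>t powr (-2 * \<alpha>)\<close> as \<open>t\<close> tends to 0. It serves at a fixed
      \<open>t\<close> only, to justify the exchange of integrals before \<open>\<phi> y\<close> is
      subtracted; this is the purpose of the term \<open>ennreal \<bar>\<phi> y\<bar>\<close> in the
      hypothesis.\<close>
    define R where "R = (LINT s|lborel. \<bar>flux_kern \<alpha> t s\<bar>)"
    have flux_int: "integrable lborel (flux_kern \<alpha> t)" using a(1) t by (rule integrable_flux_kern)
    have R: "(\<integral>\<^sup>+s. ennreal \<bar>flux_kern \<alpha> t s\<bar> \<partial>lborel) = ennreal R" "0 \<le> R"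
      unfolding R_def using flux_int by (auto intro!: nn_integral_eq_integral)
    define F where "F x y = flux_kern \<alpha> t (y - x) * f y * \<phi> x" for x y
    have Fm: "case_prod F \<in> borel_measurable (lborel \<Otimes>\<^sub>M lborel)" unfolding F_def by measurable
    have "integrable (lborel \<Otimes>\<^sub>M lborel) (case_prod F)"
    proof (rule integrableI_bounded[OF Fm])
      have "(\<integral>\<^sup>+z. ennreal (norm (case_prod F z)) \<partial>(lborel \<Otimes>\<^sub>M lborel))
        = (\<integral>\<^sup>+y. \<integral>\<^sup>+x. ennreal (norm (case_prod F (x, y))) \<partial>lborel \<partial>lborel)"
        by (rule lborel_pair.nn_integral_snd[symmetric]) (use Fm in measurable)
      also have "\<dots> \<le> (\<integral>\<^sup>+y. ennreal (Q * (\<bar>f y\<bar> * P y) + R * (\<bar>f y\<bar> * \<bar>\<phi> y\<bar>)) \<partial>lborel)"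
      proof (rule nn_integral_mono)
        fix y
        have "(\<integral>\<^sup>+x. ennreal (norm (case_prod F (x, y))) \<partial>lborel)
            = ennreal \<bar>-1\<bar> * (\<integral>\<^sup>+s. ennreal (norm (case_prod F (y + (-1) * s, y))) \<partial>lborel)"
          by (rule nn_integral_real_affine) (auto simp: F_def)
        also have "\<dots> = (\<integral>\<^sup>+s. ennreal (\<bar>f y\<bar> * (\<bar>flux_kern \<alpha> t s\<bar> * \<bar>\<phi> (y - s)\<bar>)) \<partial>lborel)"
          by (simp add: F_def abs_mult mult_ac)
        also have "\<dots> \<le> (\<integral>\<^sup>+s. ennreal (\<bar>f y\<bar> * Q) * ennreal (k s * ?d y s) + ennreal (\<bar>f y\<bar> * \<bar>\<phi> y\<bar>) * ennreal \<bar>flux_kern \<alpha> t s\<bar> \<partial>lborel)"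
        proof (rule nn_integral_mono)
          fix s
          have "\<bar>flux_kern \<alpha> t s\<bar> * \<bar>\<phi> (y - s)\<bar> \<le> \<bar>flux_kern \<alpha> t s\<bar> * (?d y s + \<bar>\<phi> y\<bar>)"
            by (intro mult_left_mono) auto
          also have "\<dots> \<le> Q * k s * ?d y s + \<bar>\<phi> y\<bar> * \<bar>flux_kern \<alpha> t s\<bar>"
            using mult_right_mono[OF flux_k[of t s], of "?d y s"] by (simp add: algebra_simps)
          finally have "\<bar>f y\<bar> * (\<bar>flux_kern \<alpha> t s\<bar> * \<bar>\<phi> (y - s)\<bar>) \<le> \<bar>f y\<bar> * (Q * k s * ?d y s + \<bar>\<phi> y\<bar> * \<bar>flux_kern \<alpha> t s\<bar>)"
            by (rule mult_left_mono) simp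
          then have "ennreal (\<bar>f y\<bar> * (\<bar>flux_kern \<alpha> t s\<bar> * \<bar>\<phi> (y - s)\<bar>))
              \<le> ennreal ((\<bar>f y\<bar> * Q) * (k s * ?d y s) + (\<bar>f y\<bar> * \<bar>\<phi> y\<bar>) * \<bar>flux_kern \<alpha> t s\<bar>)"
            by (intro ennreal_leI) (simp add: algebra_simps)
          also have "\<dots> = ennreal (\<bar>f y\<bar> * Q) * ennreal (k s * ?d y s) + ennreal (\<bar>f y\<bar> * \<bar>\<phi> y\<bar>) * ennreal \<bar>flux_kern \<alpha> t s\<bar>"
            using Q k0[of s] by (subst ennreal_plus) (auto simp: ennreal_mult')
          finally show "ennreal (\<bar>f y\<bar> * (\<bar>flux_kern \<alpha> t s\<bar> * \<bar>\<phi> (y - s)\<bar>)) \<le> \<dots>" .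
        qed
        also have "\<dots> = ennreal (\<bar>f y\<bar> * Q) * dpsi \<alpha> \<phi> y + ennreal (\<bar>f y\<bar> * \<bar>\<phi> y\<bar>) * ennreal R"
          unfolding dpsi_k R(1)[symmetric] by (subst nn_integral_add) (auto simp: nn_integral_cmult)
        also have "\<dots> = ennreal (Q * (\<bar>f y\<bar> * P y) + R * (\<bar>f y\<bar> * \<bar>\<phi> y\<bar>))"
          using Q R(2) P0[of y] unfolding P
          by (simp add: ennreal_mult'[symmetric] ennreal_plus[symmetric] mult_ac del: ennreal_plus)
        finally show "(\<integral>\<^sup>+x. ennreal (norm (case_prod F (x, y))) \<partial>lborel) \<le> \<dots>" .
      qed
      also have "\<dots> < \<infinity>"
      proof -
        have "integrable lborel (\<lambda>y. Q * (\<bar>f y\<bar> * P y) + R * (\<bar>f y\<bar> * \<bar>\<phi> y\<bar>))"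
          using fP by auto
        then show ?thesis
          using Q R(2) P0 by (auto simp: integrable_iff_bounded)
      qed
      finally show "(\<integral>\<^sup>+z. ennreal (norm (case_prod F z)) \<partial>(lborel \<Otimes>\<^sub>M lborel)) < \<infinity>" .
    qed
    note F_int = this
    have 1: "(LINT y|lborel. F x y) = ?W t x * \<phi> x" for x
      unfolding flux_eq_conv[OF f a(1) t] F_def by simp
    have 2: "(LINT x|lborel. F x y) = f y * J t y" for y
    proof -
      have "(LINT x|lborel. F x y) = \<bar>-1\<bar> *\<^sub>R (LINT s|lborel. F (y + (-1) * s) y)"
        by (rule lborel_integral_real_affine) simp
      also have "\<dots> = f y * (LINT s|lborel. flux_kern \<alpha> t s * \<phi> (y - s))"
        by (simp add: F_def mult_ac)
      \<comment> \<open>Subtracting \<open>\<phi> y\<close> costs nothing because the flux kernel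
        has integral 0.\<close>
      also have "(LINT s|lborel. flux_kern \<alpha> t s * \<phi> (y - s)) = (LINT s|lborel. flux_kern \<alpha> t s * (\<phi> (y - s) - \<phi> y) + \<phi> y * flux_kern \<alpha> t s)"
        by (intro Bochner_Integration.integral_cong) (auto simp: algebra_simps)
      also have "\<dots> = J t y + \<phi> y * (LINT s|lborel. flux_kern \<alpha> t s)"
      proof -
        have "integrable lborel (\<lambda>s. flux_kern \<alpha> t s * (\<phi> (y - s) - \<phi> y))"
        proof (rule Bochner_Integration.integrable_bound)
          show "integrable lborel (\<lambda>s. Q * (k s * ?d y s))" using k_int by simp
          show "AE s in lborel. norm (flux_kern \<alpha> t s * (\<phi> (y - s) - \<phi> y)) \<le> norm (Q * (k s * ?d y s))"
          proof (rule AE_I2)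
            fix s show "norm (flux_kern \<alpha> t s * (\<phi> (y - s) - \<phi> y)) \<le> norm (Q * (k s * ?d y s))"
              using mult_right_mono[OF flux_k[of t s], of "?d y s"] Q k0[of s]
              by (simp add: abs_mult mult.assoc)
          qed
        qed measurable
        then show ?thesis using flux_int by (simp add: J_def)
      qed
      finally show ?thesis by (simp add: integral_flux_kern[OF a(1) t])
    qed
    have "integrable lborel (\<lambda>x. LINT y|lborel. F x y)"
      using lborel_pair.integrable_fst[OF F_int] by simp
    moreover have "(LINT y|lborel. LINT x|lborel. F x y) = (LINT x|lborel. LINT y|lborel. F x y)"
      by (rule lborel_pair.Fubini_integral[OF F_int])
    ultimately show ?thesis unfolding 1 2 by simp
  qed
  show "integrable lborel (\<lambda>x. ?W t x * \<phi> x)" if "0 < t" for t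
    using main[OF that] by simp
  have lim': "((\<lambda>t. - c_const \<alpha> * (LINT y|lborel. f y * J t y)) \<longlongrightarrow> - c_const \<alpha> * (LINT y|lborel. f y * (2 * \<alpha> * ext_const \<alpha> * I y))) (at_right 0)"
    using lim by (rule tendsto_mult_left)
  have val: "- c_const \<alpha> * (LINT y|lborel. f y * (2 * \<alpha> * ext_const \<alpha> * I y)) = (LINT x|lborel. f x * frac_D_left \<alpha> \<phi> x)"
  proof -
    have "- c_const \<alpha> * (LINT y|lborel. f y * (2 * \<alpha> * ext_const \<alpha> * I y))
      = (- c_const \<alpha> * (2 * \<alpha> * ext_const \<alpha>)) * (LINT y|lborel. f y * I y)"
      by (simp add: mult.left_commute[of "f _"])
    also have "\<dots> = (LINT x|lborel. f x * frac_D_left \<alpha> \<phi> x)"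
      unfolding frac_const[OF a] frac by (simp add: mult.left_commute[of "f _"])
    finally show ?thesis .
  qed
  have ev: "\<forall>\<^sub>F t in at_right 0. - c_const \<alpha> * (LINT y|lborel. f y * J t y)
     = - c_const \<alpha> * (LINT x|lborel. ?W t x * \<phi> x)"
    using eventually_at_right_less[of 0] by eventually_elim (simp add: main)
  show ?B
    using Lim_transform_eventually[OF lim' ev] unfolding val .
qed

section \<open>Schwartz functions\<close>

lemma schwartz_has_deriv:
  assumes "\<phi> \<in> schwartz"
  shows "(\<phi> has_real_derivative deriv \<phi> x) (at x)"
proof -
  have "(deriv ^^ 0) \<phi> differentiable (at x)" using assms unfolding schwartz_def by blast
  then show ?thesis by (simp add: DERIV_deriv_iff_real_differentiable)
qed

lemma schwartz_measurable:
  assumes "\<phi> \<in> schwartz"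
  shows "\<phi> \<in> borel_measurable borel"
proof -
  have "continuous_on UNIV \<phi>"
    using schwartz_has_deriv[OF assms] by (intro continuous_at_imp_continuous_on ballI) (rule DERIV_isCont)
  then show ?thesis by (rule borel_measurable_continuous_onI)
qed

lemma one_plus_power_le:
  fixes a :: real
  assumes "0 \<le> a"
  shows "(1 + a) ^ N \<le> 2 ^ N * (1 + a ^ N)"
proof (cases "a \<le> 1")
  case True
  then have "(1 + a) ^ N \<le> 2 ^ N" using assms by (intro power_mono) auto
  also have "\<dots> \<le> 2 ^ N * (1 + a ^ N)" using assms by simp
  finally show ?thesis .
next
  case False
  then have "(1 + a) ^ N \<le> (2 * a) ^ N" by (intro power_mono) auto
  also have "\<dots> \<le> 2 ^ N * (1 + a ^ N)" by (simp add: power_mult_distrib)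
  finally show ?thesis .
qed

lemma schwartz_decay_deriv:
  assumes "\<phi> \<in> schwartz"
  shows "\<exists>C\<ge>0. \<forall>x. \<bar>(deriv ^^ n) \<phi> x\<bar> \<le> C / (1 + \<bar>x\<bar>) ^ N"
proof -
  have bd: "\<exists>B\<ge>0. \<forall>x. \<bar>x ^ m * (deriv ^^ n) \<phi> x\<bar> \<le> B" for m
  proof -
    have "bounded (range (\<lambda>x. x ^ m * (deriv ^^ n) \<phi> x))" using assms unfolding schwartz_def by blast
    then obtain B where "\<And>x. \<bar>x ^ m * (deriv ^^ n) \<phi> x\<bar> \<le> B" by (auto simp: bounded_iff)
    then show ?thesis by (intro exI[of _ "\<bar>B\<bar>"]) (auto intro: order_trans[OF _ abs_ge_self])
  qed
  obtain B0 where B0: "0 \<le> B0" "\<And>x. \<bar>x ^ 0 * (deriv ^^ n) \<phi> x\<bar> \<le> B0" using bd[of 0] by blast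
  obtain B1 where B1: "0 \<le> B1" "\<And>x. \<bar>x ^ N * (deriv ^^ n) \<phi> x\<bar> \<le> B1" using bd[of N] by blast
  show ?thesis
  proof (intro exI[of _ "2 ^ N * (B0 + B1)"] conjI allI)
    fix x
    have "(1 + \<bar>x\<bar>) ^ N * \<bar>(deriv ^^ n) \<phi> x\<bar> \<le> 2 ^ N * (1 + \<bar>x\<bar> ^ N) * \<bar>(deriv ^^ n) \<phi> x\<bar>"
      by (intro mult_right_mono one_plus_power_le) auto
    also have "\<dots> = 2 ^ N * (\<bar>(deriv ^^ n) \<phi> x\<bar> + \<bar>x ^ N * (deriv ^^ n) \<phi> x\<bar>)"
      by (simp add: abs_mult power_abs algebra_simps)
    also have "\<dots> \<le> 2 ^ N * (B0 + B1)"
      using B0(2)[of x] B1(2)[of x] by (intro mult_left_mono add_mono) auto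
    finally show "\<bar>(deriv ^^ n) \<phi> x\<bar> \<le> 2 ^ N * (B0 + B1) / (1 + \<bar>x\<bar>) ^ N"
      by (subst le_divide_eq) (auto simp: mult.commute add_pos_nonneg intro!: zero_less_power)
  qed (use B0(1) B1(1) in auto)
qed

lemma schwartz_decay:
  assumes "\<phi> \<in> schwartz"
  shows "\<exists>C\<ge>0. \<forall>x. \<bar>\<phi> x\<bar> \<le> C / (1 + \<bar>x\<bar>) ^ N \<and> \<bar>deriv \<phi> x\<bar> \<le> C / (1 + \<bar>x\<bar>) ^ N"
proof -
  obtain C0 where C0: "0 \<le> C0" "\<And>x. \<bar>\<phi> x\<bar> \<le> C0 / (1 + \<bar>x\<bar>) ^ N"
    using schwartz_decay_deriv[OF assms, of 0 N] by auto
  obtain C1 where C1: "0 \<le> C1" "\<And>x. \<bar>deriv \<phi> x\<bar> \<le> C1 / (1 + \<bar>x\<bar>) ^ N"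
    using schwartz_decay_deriv[OF assms, of 1 N] by auto
  show ?thesis
  proof (intro exI[of _ "C0 + C1"] conjI allI)
    fix x
    have "C0 / (1 + \<bar>x\<bar>) ^ N \<le> (C0 + C1) / (1 + \<bar>x\<bar>) ^ N" "C1 / (1 + \<bar>x\<bar>) ^ N \<le> (C0 + C1) / (1 + \<bar>x\<bar>) ^ N"
      using C0(1) C1(1) by (auto intro!: divide_right_mono)
    then show "\<bar>\<phi> x\<bar> \<le> (C0 + C1) / (1 + \<bar>x\<bar>) ^ N" "\<bar>deriv \<phi> x\<bar> \<le> (C0 + C1) / (1 + \<bar>x\<bar>) ^ N"
      using C0(2)[of x] C1(2)[of x] by (blast intro: order_trans)+
  qed (use C0(1) C1(1) in auto)
qed

text \<open>\<open>min s 2\<close> bounds the increment over a step \<open>s\<close> of a function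
  that is bounded by 1 together with its derivative. Near 0 it improves the singularity to
  \<open>s powr (-\<alpha>)\<close>, integrable as \<open>\<alpha> < 1\<close>; at infinity
  \<open>s powr (-1 - \<alpha>)\<close> is integrable as \<open>\<alpha> > 0\<close>.\<close>

definition mker :: "real \<Rightarrow> real \<Rightarrow> real" where
  "mker \<alpha> s = indicator {0<..} s * min s 2 * s powr (-1 - \<alpha>)"

lemma measurable_mker [measurable]: "mker \<alpha> \<in> borel_measurable borel"
  unfolding mker_def by measurable

lemma mker_nonneg: "0 \<le> mker \<alpha> s"
  by (auto simp: mker_def split: split_indicator)

lemma integrable_mker:
  assumes a: "0 < \<alpha>" "\<alpha> < 1"
  shows "integrable lborel (mker \<alpha>)"
proof (rule integrableI_bounded)
  have near: "(\<integral>\<^sup>+s. ennreal (indicator {0..1} s * s powr (-\<alpha>)) \<partial>lborel) < \<infinity>"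
  proof -
    have "((\<lambda>s. s powr (-\<alpha>)) has_integral (1 powr (-\<alpha> + 1) / (-\<alpha> + 1))) {0..1}"
      by (rule has_integral_powr_from_0) (use a in auto)
    from nn_integral_has_integral_lebesgue[OF _ this] show ?thesis by simp
  qed
  have "(\<integral>\<^sup>+s. ennreal (norm (mker \<alpha> s)) \<partial>lborel)
    \<le> (\<integral>\<^sup>+s. ennreal (indicator {0..1} s * s powr (-\<alpha>)) +
        ennreal (2 * 2 powr (1 + \<alpha>)) * (ennreal ((1 + s) powr (-1 - \<alpha>)) * indicator {0..} s) \<partial>lborel)"
  proof (rule nn_integral_mono)
    fix s :: real
    consider "s \<le> 0" | "0 < s" "s \<le> 1" | "1 < s" by linarith
    then show "ennreal (norm (mker \<alpha> s)) \<le> ennreal (indicator {0..1} s * s powr (-\<alpha>)) +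
        ennreal (2 * 2 powr (1 + \<alpha>)) * (ennreal ((1 + s) powr (-1 - \<alpha>)) * indicator {0..} s)"
    proof cases
      case 2
      have "s * s powr (-1 - \<alpha>) = s powr 1 * s powr (-1 - \<alpha>)" using 2 by simp
      also have "\<dots> = s powr (-\<alpha>)" by (subst powr_add[symmetric]) simp
      finally have "norm (mker \<alpha> s) = s powr (-\<alpha>)" using 2 by (simp add: mker_def)
      then show ?thesis using 2 by simp
    next
      case 3
      have "norm (mker \<alpha> s) \<le> 2 * s powr (-(1 + \<alpha>))"
        using 3 by (auto simp: mker_def intro!: mult_right_mono)
      also have "\<dots> \<le> 2 * ((1 + s) / 2) powr (-(1 + \<alpha>))"
        using 3 a by (intro mult_left_mono powr_mono2') auto
      also have "((1 + s) / 2) powr (-(1 + \<alpha>)) = 2 powr (1 + \<alpha>) * (1 + s) powr (-(1 + \<alpha>))"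
        using 3 by (subst powr_divide) (auto simp: powr_minus_divide[of 2 "1 + \<alpha>"] simp del: minus_add_distrib)
      finally have "norm (mker \<alpha> s) \<le> (2 * 2 powr (1 + \<alpha>)) * (1 + s) powr (-1 - \<alpha>)" by simp
      then show ?thesis
        using 3 by (auto simp: ennreal_mult'[symmetric] intro: ennreal_leI)
    qed (simp add: mker_def)
  qed
  also have "\<dots> = (\<integral>\<^sup>+s. ennreal (indicator {0..1} s * s powr (-\<alpha>)) \<partial>lborel) +
      ennreal (2 * 2 powr (1 + \<alpha>)) * ennreal ((1 + 0) powr (-\<alpha>) / \<alpha>)"
    using a by (subst nn_integral_add) (auto simp: nn_integral_cmult nn_integral_powr_tail)
  also have "\<dots> < \<infinity>" using near by (simp add: ennreal_mult_less_top)
  finally show "(\<integral>\<^sup>+s. ennreal (norm (mker \<alpha> s)) \<partial>lborel) < \<infinity>" .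
qed measurable

definition mker_mass :: "real \<Rightarrow> real" where
  "mker_mass \<alpha> = (LINT s|lborel. mker \<alpha> s)"

lemma nn_integral_mker:
  assumes "0 < \<alpha>" "\<alpha> < 1"
  shows "(\<integral>\<^sup>+s. ennreal (mker \<alpha> s) \<partial>lborel) = ennreal (mker_mass \<alpha>)"
  unfolding mker_mass_def using integrable_mker[OF assms] mker_nonneg by (intro nn_integral_eq_integral) auto

lemma mker_mass_nonneg: "0 \<le> mker_mass \<alpha>"
  unfolding mker_mass_def by (intro integral_nonneg_AE AE_I2 mker_nonneg)

lemma increment_le_min:
  fixes \<phi> :: "real \<Rightarrow> real"
  assumes "\<And>z. z \<in> {y - s..y} \<Longrightarrow> (\<phi> has_real_derivative \<phi>' z) (at z)"
    and "\<And>z. z \<in> {y - s..y} \<Longrightarrow> \<bar>\<phi> z\<bar> \<le> D" "\<And>z. z \<in> {y - s..y} \<Longrightarrow> \<bar>\<phi>' z\<bar> \<le> D" and "0 < s"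
  shows "\<bar>\<phi> (y - s) - \<phi> y\<bar> \<le> D * min s 2"
proof -
  have "norm (\<phi> (y - s) - \<phi> y) \<le> D * norm (y - s - y)"
    by (rule field_differentiable_bound[of "{y - s..y}" _ \<phi>'])
      (use assms in \<open>auto intro: has_field_derivative_at_within\<close>)
  moreover have "\<bar>\<phi> (y - s) - \<phi> y\<bar> \<le> D * 2"
    using assms(2)[of y] assms(2)[of "y - s"] assms(4) by simp
  ultimately show ?thesis using assms(4) by (simp add: min_def)
qed

section \<open>Decay of the absolute fractional increments of a Schwartz function\<close>

lemma dpsi_le:
  assumes a: "0 < \<alpha>" "\<alpha> < 1" and D: "0 \<le> D" "\<And>s. 0 < s \<Longrightarrow> \<bar>\<phi> (y - s) - \<phi> y\<bar> \<le> D * min s 2"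
  shows "dpsi \<alpha> \<phi> y \<le> ennreal (D * mker_mass \<alpha>)"
proof -
  have "dpsi \<alpha> \<phi> y \<le> (\<integral>\<^sup>+s. ennreal D * ennreal (mker \<alpha> s) \<partial>lborel)"
    unfolding dpsi_def
  proof (rule nn_integral_mono)
    fix s
    show "ennreal (indicator {0<..} s * \<bar>\<phi> (y - s) - \<phi> y\<bar> * s powr (-1 - \<alpha>)) \<le> ennreal D * ennreal (mker \<alpha> s)"
    proof (cases "0 < s")
      case True
      then have "\<bar>\<phi> (y - s) - \<phi> y\<bar> * s powr (-1 - \<alpha>) \<le> D * min s 2 * s powr (-1 - \<alpha>)"
        by (intro mult_right_mono D(2)) auto
      then show ?thesis
        using True D(1) by (simp add: ennreal_mult'[symmetric] mker_def mult.assoc ennreal_leI)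
    qed simp
  qed
  also have "\<dots> = ennreal (D * mker_mass \<alpha>)"
    using D(1) by (subst nn_integral_cmult) (auto simp: nn_integral_mker[OF a] ennreal_mult')
  finally show ?thesis .
qed

text \<open>For \<open>y \<le> 0\<close> the increments to the left see only points
  \<open>z \<le> y\<close>, where \<open>\<bar>z\<bar> \<ge> \<bar>y\<bar>\<close>, so the decay of
  every order of \<open>\<phi>\<close> and its derivative is inherited.\<close>

lemma dpsi_le_left:
  assumes \<phi>: "\<phi> \<in> schwartz" and a: "0 < \<alpha>" "\<alpha> < 1"
  shows "\<exists>K\<ge>0. \<forall>y\<le>0. dpsi \<alpha> \<phi> y + ennreal \<bar>\<phi> y\<bar> \<le> ennreal (K / (1 + \<bar>y\<bar>) ^ N)"
proof -
  obtain C where C: "0 \<le> C" "\<And>x. \<bar>\<phi> x\<bar> \<le> C / (1 + \<bar>x\<bar>) ^ N" "\<And>x. \<bar>deriv \<phi> x\<bar> \<le> C / (1 + \<bar>x\<bar>) ^ N"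
    using schwartz_decay[OF \<phi>] by blast
  show ?thesis
  proof (intro exI[of _ "C * mker_mass \<alpha> + C"] conjI allI impI)
    fix y :: real assume y: "y \<le> 0"
    define D where "D = C / (1 + \<bar>y\<bar>) ^ N"
    have D: "0 \<le> D" using C(1) by (simp add: D_def)
    have z: "C / (1 + \<bar>z\<bar>) ^ N \<le> D" if "z \<le> y" for z
      unfolding D_def using that y C(1) by (intro divide_left_mono power_mono mult_pos_pos zero_less_power) auto
    have "dpsi \<alpha> \<phi> y \<le> ennreal (D * mker_mass \<alpha>)"
    proof (rule dpsi_le[OF a D])
      fix s :: real assume s: "0 < s"
      show "\<bar>\<phi> (y - s) - \<phi> y\<bar> \<le> D * min s 2"
        by (rule increment_le_min[of y s \<phi> "deriv \<phi>"])
          (use s in \<open>auto intro!: schwartz_has_deriv[OF \<phi>] order_trans[OF C(2) z] order_trans[OF C(3) z]\<close>)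
    qed
    moreover have "ennreal \<bar>\<phi> y\<bar> \<le> ennreal D" using C(2)[of y] by (intro ennreal_leI) (simp add: D_def)
    ultimately have "dpsi \<alpha> \<phi> y + ennreal \<bar>\<phi> y\<bar> \<le> ennreal (D * mker_mass \<alpha>) + ennreal D"
      by (rule add_mono)
    also have "\<dots> = ennreal ((C * mker_mass \<alpha> + C) / (1 + \<bar>y\<bar>) ^ N)"
    proof (subst ennreal_plus[symmetric])
      show "ennreal (D * mker_mass \<alpha> + D) = ennreal ((C * mker_mass \<alpha> + C) / (1 + \<bar>y\<bar>) ^ N)"
        by (simp add: D_def add_divide_distrib)
    qed (use D mker_mass_nonneg[of \<alpha>] in simp_all)
    finally show "dpsi \<alpha> \<phi> y + ennreal \<bar>\<phi> y\<bar> \<le> \<dots>" .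
  qed (use C(1) mker_mass_nonneg in auto)
qed

lemma dpsi_finite:
  assumes \<phi>: "\<phi> \<in> schwartz" and a: "0 < \<alpha>" "\<alpha> < 1"
  shows "dpsi \<alpha> \<phi> y < \<infinity>"
proof -
  obtain C where C: "0 \<le> C" "\<And>x. \<bar>\<phi> x\<bar> \<le> C / (1 + \<bar>x\<bar>) ^ 0" "\<And>x. \<bar>deriv \<phi> x\<bar> \<le> C / (1 + \<bar>x\<bar>) ^ 0"
    using schwartz_decay[OF \<phi>, of 0] by blast
  have "dpsi \<alpha> \<phi> y \<le> ennreal (C * mker_mass \<alpha>)"
  proof (rule dpsi_le[OF a C(1)])
    fix s :: real assume s: "0 < s"
    show "\<bar>\<phi> (y - s) - \<phi> y\<bar> \<le> C * min s 2"
      by (rule increment_le_min[of y s \<phi> "deriv \<phi>"]) (use s C schwartz_has_deriv[OF \<phi>] in auto)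
  qed
  then show ?thesis by (rule le_less_trans) simp
qed

lemma integrable_inverse_square: "integrable lborel (\<lambda>x::real. 1 / (1 + \<bar>x\<bar>) ^ 2)"
proof -
  have eq: "indicator {0..} u * (1 + u) powr (-1 - 1) = indicator {0..} u * (1 / (1 + \<bar>u\<bar>) ^ 2)" for u :: real
    by (auto simp: powr_minus divide_inverse split: split_indicator)
  have 1: "integrable lborel (\<lambda>u::real. indicator {0..} u * (1 / (1 + \<bar>u\<bar>) ^ 2))"
    using integrable_powr_tail[of 1 0] unfolding eq by simp
  from lborel_integrable_real_affine[OF this, of "-1" 0]
  have 2: "integrable lborel (\<lambda>u::real. indicator {0..} (-u) * (1 / (1 + \<bar>u\<bar>) ^ 2))" by simp
  show ?thesis
    by (rule Bochner_Integration.integrable_bound[OF Bochner_Integration.integrable_add[OF 1 2]])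
      (auto simp: indicator_def)
qed

text \<open>For \<open>y \<ge> 0\<close> a step of length about \<open>y\<close> reaches the bulk of
  \<open>\<phi>\<close>, so only the order \<open>1 + \<alpha>\<close> of the kernel is left as
  decay. Steps up to \<open>\<rho> = (1 + y) / 2\<close> stay where
  \<open>1 + \<bar>z\<bar> \<ge> \<rho>\<close> and profit from the decay of \<open>\<phi>\<close>;
  for longer steps the kernel itself is small and \<open>\<phi>\<close> is integrated.\<close>

lemma dpsi_le_right:
  assumes \<phi>: "\<phi> \<in> schwartz" and a: "0 < \<alpha>" "\<alpha> < 1"
  shows "\<exists>K\<ge>0. \<forall>y\<ge>0. dpsi \<alpha> \<phi> y + ennreal \<bar>\<phi> y\<bar> \<le> ennreal (K * (1 + y) powr (-(1 + \<alpha>)))"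
proof -
  note [measurable] = schwartz_measurable[OF \<phi>]
  obtain C where C: "0 \<le> C" "\<And>x. \<bar>\<phi> x\<bar> \<le> C / (1 + \<bar>x\<bar>) ^ 2" "\<And>x. \<bar>deriv \<phi> x\<bar> \<le> C / (1 + \<bar>x\<bar>) ^ 2"
    using schwartz_decay[OF \<phi>] by blast
  have \<phi>_int: "integrable lborel \<phi>"
  proof (rule Bochner_Integration.integrable_bound)
    show "integrable lborel (\<lambda>x::real. C * (1 / (1 + \<bar>x\<bar>) ^ 2))"
      using integrable_inverse_square by (rule integrable_mult_right)
  qed (use C in \<open>auto intro!: AE_I2\<close>)
  define R where "R = (LINT s|lborel. \<bar>\<phi> s\<bar>)"
  have R: "(\<integral>\<^sup>+s. ennreal \<bar>\<phi> s\<bar> \<partial>lborel) = ennreal R" "0 \<le> R"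
    unfolding R_def using \<phi>_int by (auto intro!: nn_integral_eq_integral)
  \<comment> \<open>\<open>12 = 3 * 4\<close>: the 4 is from
    \<open>\<rho>\<^sup>2 = (1 + y)\<^sup>2 / 4\<close>; the 3 lets \<open>3 * min s 2\<close>
    exceed 1 for \<open>s > \<rho>\<close>, as \<open>\<rho> \<ge> 1/2\<close>. The second term is
    the kernel at \<open>\<rho>\<close> against the integral of \<open>\<bar>\<phi>\<bar>\<close>,
    the third the summand \<open>\<bar>\<phi> y\<bar>\<close>.\<close>
  define K where "K = 12 * C * mker_mass \<alpha> + 2 powr (1 + \<alpha>) * R + C"
  show ?thesis
  proof (intro exI[of _ K] conjI allI impI)
    show "0 \<le> K" using C(1) R(2) mker_mass_nonneg[of \<alpha>] by (simp add: K_def)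
    fix y :: real assume y: "0 \<le> y"
    define \<rho> where "\<rho> = (1 + y) / 2"
    have \<rho>: "1 / 2 \<le> \<rho>" "0 < \<rho>" using y by (auto simp: \<rho>_def)
    define E where "E = (1 + y) powr (-(1 + \<alpha>))"
    have E: "0 \<le> E" by (simp add: E_def)
    define D where "D = C / \<rho> ^ 2"
    have D: "0 \<le> D" using C(1) by (simp add: D_def)
    have sq: "1 / (1 + y) ^ 2 \<le> E"
    proof -
      have "1 / (1 + y) ^ 2 = (1 + y) powr (-2)" using y by (simp add: powr_minus divide_inverse)
      also have "\<dots> \<le> E" unfolding E_def using y a by (intro powr_mono) auto
      finally show ?thesis .
    qed
    have D_le: "D \<le> 4 * C * E"
    proof -
      have "D = 4 * C * (1 / (1 + y) ^ 2)" by (simp add: D_def \<rho>_def power_divide)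
      also have "\<dots> \<le> 4 * C * E" using sq C(1) by (intro mult_left_mono) auto
      finally show ?thesis .
    qed
    have z: "C / (1 + \<bar>z\<bar>) ^ 2 \<le> D" if "y - \<rho> \<le> z" for z
    proof -
      have "y = 2 * \<rho> - 1" by (simp add: \<rho>_def field_simps)
      then have "\<rho> \<le> 1 + \<bar>z\<bar>" using that by linarith
      then show ?thesis unfolding D_def using C(1) \<rho>
        by (intro divide_left_mono power_mono mult_pos_pos zero_less_power) auto
    qed
    have point: "\<bar>\<phi> (y - s) - \<phi> y\<bar> * s powr (-(1 + \<alpha>)) \<le> 3 * D * (min s 2 * s powr (-(1 + \<alpha>))) + 2 powr (1 + \<alpha>) * E * \<bar>\<phi> (y - s)\<bar>"
      if s: "0 < s" for s
    proof (cases "s \<le> \<rho>")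
      case True
      have "\<bar>\<phi> (y - s) - \<phi> y\<bar> \<le> D * min s 2"
        by (rule increment_le_min[of y s \<phi> "deriv \<phi>"])
          (use s True in \<open>auto intro!: schwartz_has_deriv[OF \<phi>] order_trans[OF C(2) z] order_trans[OF C(3) z]\<close>)
      also have "\<dots> \<le> 3 * D * min s 2" using D s by (intro mult_right_mono) auto
      finally have "\<bar>\<phi> (y - s) - \<phi> y\<bar> * s powr (-(1 + \<alpha>)) \<le> 3 * D * min s 2 * s powr (-(1 + \<alpha>))"
        by (rule mult_right_mono) simp
      also have "\<dots> \<le> 3 * D * (min s 2 * s powr (-(1 + \<alpha>))) + 2 powr (1 + \<alpha>) * E * \<bar>\<phi> (y - s)\<bar>"
        using E by simp
      finally show ?thesis .
    next
      case False
      have "s powr (-(1 + \<alpha>)) \<le> \<rho> powr (-(1 + \<alpha>))"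
        using False \<rho> a by (intro powr_mono2') auto
      also have "\<dots> = 2 powr (1 + \<alpha>) * E"
        unfolding \<rho>_def E_def using y
        by (subst powr_divide) (auto simp: powr_minus_divide[of 2 "1 + \<alpha>"] simp del: minus_add_distrib)
      finally have s_le: "s powr (-(1 + \<alpha>)) \<le> 2 powr (1 + \<alpha>) * E" .
      have "\<bar>\<phi> y\<bar> \<le> D" using C(2)[of y] z[of y] \<rho> by linarith
      also have "D * 1 \<le> D * (3 * min s 2)" using False \<rho> D by (intro mult_left_mono) auto
      finally have py: "\<bar>\<phi> y\<bar> \<le> 3 * D * min s 2" by simp
      have "\<bar>\<phi> (y - s) - \<phi> y\<bar> * s powr (-(1 + \<alpha>)) \<le> (\<bar>\<phi> y\<bar> + \<bar>\<phi> (y - s)\<bar>) * s powr (-(1 + \<alpha>))"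
        by (intro mult_right_mono) auto
      also have "\<dots> = \<bar>\<phi> y\<bar> * s powr (-(1 + \<alpha>)) + s powr (-(1 + \<alpha>)) * \<bar>\<phi> (y - s)\<bar>"
        by (simp add: algebra_simps)
      also have "\<dots> \<le> 3 * D * min s 2 * s powr (-(1 + \<alpha>)) + 2 powr (1 + \<alpha>) * E * \<bar>\<phi> (y - s)\<bar>"
        using py s_le by (intro add_mono mult_right_mono) auto
      finally show ?thesis by (simp add: mult.assoc)
    qed
    have "dpsi \<alpha> \<phi> y \<le> (\<integral>\<^sup>+s. ennreal (3 * D) * ennreal (mker \<alpha> s) + ennreal (2 powr (1 + \<alpha>) * E) * ennreal \<bar>\<phi> (y - s)\<bar> \<partial>lborel)"
      unfolding dpsi_def
    proof (rule nn_integral_mono)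
      fix s
      show "ennreal (indicator {0<..} s * \<bar>\<phi> (y - s) - \<phi> y\<bar> * s powr (-1 - \<alpha>))
        \<le> ennreal (3 * D) * ennreal (mker \<alpha> s) + ennreal (2 powr (1 + \<alpha>) * E) * ennreal \<bar>\<phi> (y - s)\<bar>"
      proof (cases "0 < s")
        case True
        have "ennreal (3 * D) * ennreal (mker \<alpha> s) + ennreal (2 powr (1 + \<alpha>) * E) * ennreal \<bar>\<phi> (y - s)\<bar>
          = ennreal (3 * D * mker \<alpha> s + 2 powr (1 + \<alpha>) * E * \<bar>\<phi> (y - s)\<bar>)"
          using D E mker_nonneg[of \<alpha> s] by (subst ennreal_plus) (auto simp: ennreal_mult')
        then show ?thesis
          using point[OF True] True by (auto simp: mker_def intro!: ennreal_leI)
      qed simp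
    qed
    also have "\<dots> = ennreal (3 * D) * ennreal (mker_mass \<alpha>) + ennreal (2 powr (1 + \<alpha>) * E) * (\<integral>\<^sup>+s. ennreal \<bar>\<phi> (y - s)\<bar> \<partial>lborel)"
      by (subst nn_integral_add) (auto simp: nn_integral_cmult nn_integral_mker[OF a])
    also have "(\<integral>\<^sup>+s. ennreal \<bar>\<phi> (y - s)\<bar> \<partial>lborel) = ennreal R"
      using nn_integral_real_affine[of "\<lambda>s. ennreal \<bar>\<phi> s\<bar>" "-1" y] R(1) by simp
    also have "ennreal (3 * D) * ennreal (mker_mass \<alpha>) + ennreal (2 powr (1 + \<alpha>) * E) * ennreal R
        = ennreal (3 * D * mker_mass \<alpha> + 2 powr (1 + \<alpha>) * E * R)"
      using D E R(2) mker_mass_nonneg[of \<alpha>] by (subst ennreal_plus) (auto simp: ennreal_mult')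
    finally have "dpsi \<alpha> \<phi> y + ennreal \<bar>\<phi> y\<bar> \<le> ennreal (3 * D * mker_mass \<alpha> + 2 powr (1 + \<alpha>) * E * R) + ennreal (C * E)"
    proof (rule add_mono)
      have "\<bar>\<phi> y\<bar> \<le> C * (1 / (1 + y) ^ 2)" using C(2)[of y] y by simp
      also have "\<dots> \<le> C * E" using sq C(1) by (rule mult_left_mono)
      finally show "ennreal \<bar>\<phi> y\<bar> \<le> ennreal (C * E)" by (rule ennreal_leI)
    qed
    also have "\<dots> = ennreal (3 * D * mker_mass \<alpha> + 2 powr (1 + \<alpha>) * E * R + C * E)"
      using D E R(2) C(1) mker_mass_nonneg[of \<alpha>] by (subst ennreal_plus[symmetric]) auto
    also have "\<dots> \<le> ennreal (K * E)"
    proof (rule ennreal_leI)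
      have "3 * D * mker_mass \<alpha> \<le> 3 * (4 * C * E) * mker_mass \<alpha>"
        using D_le mker_mass_nonneg[of \<alpha>] by (intro mult_right_mono mult_left_mono) auto
      then show "3 * D * mker_mass \<alpha> + 2 powr (1 + \<alpha>) * E * R + C * E \<le> K * E"
        by (simp add: K_def algebra_simps)
    qed
    finally show "dpsi \<alpha> \<phi> y + ennreal \<bar>\<phi> y\<bar> \<le> ennreal (K * (1 + y) powr (-(1 + \<alpha>)))"
      unfolding E_def .
  qed
qed

lemma nn_integral_dpsi_right:
  assumes f: "linear_growth f" and \<phi>: "\<phi> \<in> schwartz" and a: "0 < \<alpha>" "\<alpha> < 1"
  shows "(\<integral>\<^sup>+y. ennreal \<bar>f y\<bar> * (dpsi \<alpha> \<phi> y + ennreal \<bar>\<phi> y\<bar>) * indicator {0..} y \<partial>lborel) < \<infinity>"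
proof -
  note [measurable] = linear_growth_measurable[OF f]
  obtain K where K: "0 \<le> K" "\<And>y. 0 \<le> y \<Longrightarrow> dpsi \<alpha> \<phi> y + ennreal \<bar>\<phi> y\<bar> \<le> ennreal (K * (1 + y) powr (-(1 + \<alpha>)))"
    using dpsi_le_right[OF \<phi> a] by blast
  have "(\<integral>\<^sup>+y. ennreal \<bar>f y\<bar> * (dpsi \<alpha> \<phi> y + ennreal \<bar>\<phi> y\<bar>) * indicator {0..} y \<partial>lborel)
    \<le> (\<integral>\<^sup>+y. ennreal K * ennreal (indicator {0..} y * (1 + y - 0) powr (-(1 + \<alpha>)) * \<bar>f y\<bar>) \<partial>lborel)"
  proof (rule nn_integral_mono)
    fix y :: real
    show "ennreal \<bar>f y\<bar> * (dpsi \<alpha> \<phi> y + ennreal \<bar>\<phi> y\<bar>) * indicator {0..} y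
      \<le> ennreal K * ennreal (indicator {0..} y * (1 + y - 0) powr (-(1 + \<alpha>)) * \<bar>f y\<bar>)"
    proof (cases "0 \<le> y")
      case True
      have "ennreal \<bar>f y\<bar> * (dpsi \<alpha> \<phi> y + ennreal \<bar>\<phi> y\<bar>) \<le> ennreal \<bar>f y\<bar> * ennreal (K * (1 + y) powr (-(1 + \<alpha>)))"
        by (intro mult_left_mono K(2) True) simp
      also have "\<dots> = ennreal K * ennreal ((1 + y) powr (-(1 + \<alpha>)) * \<bar>f y\<bar>)"
        using K(1) by (simp add: ennreal_mult'[symmetric] mult_ac)
      finally show ?thesis using True by simp
    qed simp
  qed
  also have "\<dots> = ennreal K * (\<integral>\<^sup>+y. ennreal (indicator {0..} y * (1 + y - 0) powr (-(1 + \<alpha>)) * \<bar>f y\<bar>) \<partial>lborel)"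
    by (rule nn_integral_cmult) measurable
  also have "\<dots> < \<infinity>"
    using nn_integral_powr_tail_linear_growth[OF f, of "1 + \<alpha>" 0] a by (simp add: ennreal_mult_less_top del: minus_add_distrib)
  finally show ?thesis .
qed

lemma nn_integral_split_at_0:
  fixes g :: "real \<Rightarrow> ennreal"
  assumes [measurable]: "g \<in> borel_measurable borel"
    and "(\<integral>\<^sup>+y. g y * indicator {0..} y \<partial>lborel) < \<infinity>" "(\<integral>\<^sup>+y. g y * indicator {..0} y \<partial>lborel) < \<infinity>"
  shows "(\<integral>\<^sup>+y. g y \<partial>lborel) < \<infinity>"
proof -
  have "(\<integral>\<^sup>+y. g y \<partial>lborel) \<le> (\<integral>\<^sup>+y. g y * indicator {0..} y + g y * indicator {..0} y \<partial>lborel)"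
    by (intro nn_integral_mono) (auto split: split_indicator)
  also have "\<dots> = (\<integral>\<^sup>+y. g y * indicator {0..} y \<partial>lborel) + (\<integral>\<^sup>+y. g y * indicator {..0} y \<partial>lborel)"
    by (rule nn_integral_add) measurable
  finally show ?thesis using assms(2,3) by (auto intro: le_less_trans)
qed

text \<open>Left of the support both \<open>\<phi> y\<close> and all \<open>\<phi> (y - s)\<close>
  vanish, and with them \<open>dpsi\<close>. Only the mass of \<open>f\<close> on
  \<open>[A, 0]\<close> and its growth to the right enter.\<close>

lemma nn_integral_dpsi_left_bounded:
  assumes f: "linear_growth f" and \<phi>: "\<phi> \<in> schwartz_left_bounded" and a: "0 < \<alpha>" "\<alpha> < 1"
  shows "(\<integral>\<^sup>+y. ennreal \<bar>f y\<bar> * (dpsi \<alpha> \<phi> y + ennreal \<bar>\<phi> y\<bar>) \<partial>lborel) < \<infinity>"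
proof -
  have \<phi>s: "\<phi> \<in> schwartz" using \<phi> by (simp add: schwartz_left_bounded_def)
  obtain A where A: "\<And>x. x < A \<Longrightarrow> \<phi> x = 0" using \<phi> by (auto simp: schwartz_left_bounded_def)
  note [measurable] = linear_growth_measurable[OF f] schwartz_measurable[OF \<phi>s]
  obtain K where K: "0 \<le> K" "\<And>y. y \<le> 0 \<Longrightarrow> dpsi \<alpha> \<phi> y + ennreal \<bar>\<phi> y\<bar> \<le> ennreal (K / (1 + \<bar>y\<bar>) ^ 0)"
    using dpsi_le_left[OF \<phi>s a, of 0] by blast
  show ?thesis
  proof (rule nn_integral_split_at_0)
    have "(\<integral>\<^sup>+y. ennreal \<bar>f y\<bar> * (dpsi \<alpha> \<phi> y + ennreal \<bar>\<phi> y\<bar>) * indicator {..0} y \<partial>lborel)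
      \<le> (\<integral>\<^sup>+y. ennreal K * (ennreal \<bar>f y\<bar> * indicator {A..0} y) \<partial>lborel)"
    proof (rule nn_integral_mono)
      fix y :: real
      consider "y < A" | "0 < y" | "A \<le> y" "y \<le> 0" by linarith
      then show "ennreal \<bar>f y\<bar> * (dpsi \<alpha> \<phi> y + ennreal \<bar>\<phi> y\<bar>) * indicator {..0} y \<le> ennreal K * (ennreal \<bar>f y\<bar> * indicator {A..0} y)"
      proof cases
        case 1
        have 0: "indicator {0<..} s * \<bar>\<phi> (y - s) - \<phi> y\<bar> * s powr (-1 - \<alpha>) = 0" for s
          using A[of "y - s"] A[of y] 1 by (cases "0 < s") auto
        have "dpsi \<alpha> \<phi> y = 0" unfolding dpsi_def 0 by simp
        then show ?thesis using A[OF 1] by simp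
      next
        case 3
        then have "ennreal \<bar>f y\<bar> * (dpsi \<alpha> \<phi> y + ennreal \<bar>\<phi> y\<bar>) \<le> ennreal \<bar>f y\<bar> * ennreal K"
          using K(2)[of y] by (intro mult_left_mono) auto
        then show ?thesis using 3 by (simp add: mult.commute)
      qed simp
    qed
    also have "\<dots> = ennreal K * (\<integral>\<^sup>+y. ennreal \<bar>f y\<bar> * indicator {A..0} y \<partial>lborel)"
      by (rule nn_integral_cmult) measurable
    also have "\<dots> < \<infinity>" using linear_growth_finite[OF f, of A 0] by (simp add: ennreal_mult_less_top)
    finally show "(\<integral>\<^sup>+y. ennreal \<bar>f y\<bar> * (dpsi \<alpha> \<phi> y + ennreal \<bar>\<phi> y\<bar>) * indicator {..0} y \<partial>lborel) < \<infinity>" .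
  qed (use nn_integral_dpsi_right[OF f \<phi>s a] in auto)
qed

section \<open>A test function detecting super-polynomial growth\<close>

text \<open>A bump that increases on the half-line \<open>u \<le> 0\<close>, so that its left
  increments have a sign there, and whose derivatives are polynomials times itself, which makes the
  Schwartz property elementary.\<close>

definition gauss :: "real \<Rightarrow> real" where
  "gauss x = exp (-(x\<^sup>2))"

lemma gauss_deriv: "(gauss has_real_derivative - 2 * x * gauss x) (at x)"
  unfolding gauss_def by (auto intro!: derivative_eq_intros)

lemma deriv_funpow_gauss: "\<exists>q. (deriv ^^ n) gauss = (\<lambda>x. poly q x * gauss x)"
proof (induction n)
  case 0
  show ?case by (rule exI[of _ 1]) auto
next
  case (Suc n)
  then obtain q where q: "(deriv ^^ n) gauss = (\<lambda>x. poly q x * gauss x)" by blast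
  have "deriv (\<lambda>x. poly q x * gauss x) x = poly (pderiv q + [:0, -2:] * q) x * gauss x" for x
    by (rule DERIV_imp_deriv) (auto intro!: derivative_eq_intros gauss_deriv poly_DERIV simp: algebra_simps)
  then show ?case by (intro exI[of _ "pderiv q + [:0, -2:] * q"]) (simp add: q fun_eq_iff)
qed

text \<open>Induction on the polynomial with \<open>m\<close> arbitrary, since
  \<open>pCons a q\<close> passes the power \<open>Suc m\<close> to \<open>q\<close>. Monomials are
  bounded by comparing \<open>(x\<^sup>2) ^ m / fact m\<close> with the exponential series.\<close>

lemma bounded_poly_gauss: "\<exists>B\<ge>0. \<forall>x. \<bar>x ^ m * (poly q x * gauss x)\<bar> \<le> B"
proof (induction q arbitrary: m)
  case 0
  show ?case by (rule exI[of _ 0]) auto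
next
  case (pCons a q)
  obtain B where B: "0 \<le> B" "\<And>x. \<bar>x ^ Suc m * (poly q x * gauss x)\<bar> \<le> B"
    using pCons.IH[of "Suc m"] by blast
  have "\<exists>B'. \<forall>x. \<bar>x ^ m * gauss x\<bar> \<le> B'"
  proof (intro exI[of _ "1 + real (fact m)"] allI)
    fix x :: real
    have "(x\<^sup>2) ^ m / fact m \<le> exp (x\<^sup>2)"
    proof -
      have "(x\<^sup>2) ^ m /\<^sub>R fact m \<le> (\<Sum>n. (x\<^sup>2) ^ n /\<^sub>R fact n)"
        using sum_le_suminf[OF summable_exp_generic[of "x\<^sup>2"], of "{m}"] by simp
      then show ?thesis by (simp add: exp_def divide_inverse mult.commute)
    qed
    then have 1: "(x\<^sup>2) ^ m * gauss x \<le> fact m"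
      by (simp add: gauss_def exp_minus field_simps)
    have "\<bar>x\<bar> ^ m \<le> 1 + (x\<^sup>2) ^ m"
    proof (cases "\<bar>x\<bar> \<le> 1")
      case True
      then have "\<bar>x\<bar> ^ m \<le> 1" by (intro power_le_one) auto
      then show ?thesis by (simp add: add_increasing2)
    next
      case False
      then have "\<bar>x\<bar> ^ m \<le> \<bar>x\<bar> ^ (2 * m)" by (intro power_increasing) auto
      then show ?thesis by (simp add: power_mult)
    qed
    then have "\<bar>x ^ m * gauss x\<bar> \<le> (1 + (x\<^sup>2) ^ m) * gauss x"
      by (simp add: abs_mult power_abs gauss_def mult_right_mono)
    also have "\<dots> \<le> 1 + fact m" using 1 by (simp add: distrib_right gauss_def add_mono)
    finally show "\<bar>x ^ m * gauss x\<bar> \<le> 1 + real (fact m)" by simp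
  qed
  then obtain B' where B': "\<And>x. \<bar>x ^ m * gauss x\<bar> \<le> B'" by blast
  show ?case
  proof (intro exI[of _ "\<bar>a\<bar> * \<bar>B'\<bar> + B"] conjI allI)
    fix x
    have "\<bar>x ^ m * (poly (pCons a q) x * gauss x)\<bar> = \<bar>a * (x ^ m * gauss x) + x ^ Suc m * (poly q x * gauss x)\<bar>"
      by (simp add: algebra_simps)
    also have "\<dots> \<le> \<bar>a * (x ^ m * gauss x)\<bar> + \<bar>x ^ Suc m * (poly q x * gauss x)\<bar>"
      by (rule abs_triangle_ineq)
    also have "\<dots> \<le> \<bar>a\<bar> * \<bar>B'\<bar> + B"
      unfolding abs_mult[of a] using B(2)[of x] B'[of x] by (intro add_mono mult_left_mono) auto
    finally show "\<bar>x ^ m * (poly (pCons a q) x * gauss x)\<bar> \<le> \<bar>a\<bar> * \<bar>B'\<bar> + B" .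
  qed (use B(1) in auto)
qed

lemma gauss_schwartz: "gauss \<in> schwartz"
  unfolding schwartz_def
proof (intro CollectI conjI allI)
  fix n x
  obtain q where q: "(deriv ^^ n) gauss = (\<lambda>x. poly q x * gauss x)" using deriv_funpow_gauss by blast
  have "((\<lambda>x. poly q x * gauss x) has_real_derivative (poly (pderiv q) x * gauss x + (- 2 * x * gauss x) * poly q x)) (at x)"
    by (intro DERIV_mult poly_DERIV gauss_deriv)
  then show "(deriv ^^ n) gauss differentiable (at x)"
    unfolding q real_differentiable_def by (rule exI)
next
  fix m n
  obtain q where q: "(deriv ^^ n) gauss = (\<lambda>x. poly q x * gauss x)" using deriv_funpow_gauss by blast
  obtain B where "\<And>x. \<bar>x ^ m * (poly q x * gauss x)\<bar> \<le> B" using bounded_poly_gauss by blast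
  then show "bounded (range (\<lambda>x. x ^ m * (deriv ^^ n) gauss x))"
    unfolding q bounded_iff by auto
qed

text \<open>Translation worsens the decay bounds by powers of the shift:
  \<open>\<bar>x\<bar>\<close> is at most \<open>(1 + \<bar>x + k j\<bar>) * k j\<close>, so
  \<open>x ^ m\<close> times a derivative of the j-th translate is bounded by \<open>k j ^ m\<close>
  times a constant of \<open>G\<close>. Hence the summability for every \<open>m\<close>.
  Derivatives are taken termwise by the Weierstrass test.\<close>

lemma schwartz_translate_sum:
  fixes a k :: "nat \<Rightarrow> real"
  assumes G: "G \<in> schwartz" and a: "\<And>j. 0 \<le> a j" and k: "\<And>j. 1 \<le> k j"
    and sum: "\<And>m. summable (\<lambda>j. a j * k j ^ m)"
  shows "(\<lambda>x. \<Sum>j. a j * G (x + k j)) \<in> schwartz"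
proof -
  have sum0: "summable a" using sum[of 0] by simp
  have bd: "\<exists>C\<ge>0. \<forall>x. \<bar>(deriv ^^ n) G x\<bar> \<le> C" for n
    using schwartz_decay_deriv[OF G, of n 0] by simp
  have smb: "summable (\<lambda>j. a j * (deriv ^^ n) G (x + k j))" for n x
  proof -
    obtain C where C: "0 \<le> C" "\<And>x. \<bar>(deriv ^^ n) G x\<bar> \<le> C" using bd by blast
    show ?thesis
    proof (rule summable_comparison_test)
      show "summable (\<lambda>j. a j * C)" using sum0 by (rule summable_mult2)
      show "\<exists>N. \<forall>j\<ge>N. norm (a j * (deriv ^^ n) G (x + k j)) \<le> a j * C"
        using C(2) a by (auto simp: abs_mult intro!: mult_left_mono)
    qed
  qed
  have D: "((\<lambda>x. \<Sum>j. a j * (deriv ^^ n) G (x + k j)) has_real_derivative (\<Sum>j. a j * (deriv ^^ Suc n) G (x + k j))) (at x)" for n x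
  proof -
    let ?f = "\<lambda>j x. a j * (deriv ^^ n) G (x + k j)"
    let ?f' = "\<lambda>j x. a j * (deriv ^^ Suc n) G (x + k j)"
    have 1: "(?f j has_real_derivative ?f' j x) (at x within UNIV)" for j x
    proof -
      have "(deriv ^^ n) G differentiable (at (x + k j))" using G unfolding schwartz_def by blast
      then have "((deriv ^^ n) G has_real_derivative (deriv ^^ Suc n) G (x + k j)) (at (x + k j))"
        by (simp add: DERIV_deriv_iff_real_differentiable)
      then have "((\<lambda>x. (deriv ^^ n) G (x + k j)) has_real_derivative (deriv ^^ Suc n) G (x + k j)) (at x)"
        by (simp add: DERIV_shift)
      then show ?thesis by (rule DERIV_cmult)
    qed
    obtain C where C: "0 \<le> C" "\<And>x. \<bar>(deriv ^^ Suc n) G x\<bar> \<le> C" using bd by blast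
    have 2: "uniformly_convergent_on UNIV (\<lambda>N x. \<Sum>j<N. ?f' j x)"
    proof (rule Weierstrass_m_test')
      show "summable (\<lambda>j. a j * C)" using sum0 by (rule summable_mult2)
      show "norm (?f' j x) \<le> a j * C" for j x
        using C(2)[of "x + k j"] a[of j] by (simp add: abs_mult mult_left_mono del: funpow.simps)
    qed
    have 3: "summable (\<lambda>j. ?f j 0)" by (rule smb)
    have "x \<in> interior UNIV" by simp
    from has_field_derivative_series'(2)[of UNIV ?f ?f', OF convex_UNIV 1 2 UNIV_I 3 this]
    show ?thesis .
  qed
  have iter: "(deriv ^^ n) (\<lambda>x. \<Sum>j. a j * G (x + k j)) = (\<lambda>x. \<Sum>j. a j * (deriv ^^ n) G (x + k j))" for n
  proof (induction n)
    case (Suc n)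
    have "(deriv ^^ Suc n) (\<lambda>x. \<Sum>j. a j * G (x + k j)) = deriv (\<lambda>x. \<Sum>j. a j * (deriv ^^ n) G (x + k j))"
      by (simp add: Suc)
    also have "\<dots> = (\<lambda>x. \<Sum>j. a j * (deriv ^^ Suc n) G (x + k j))"
      by (rule ext) (rule DERIV_imp_deriv[OF D])
    finally show ?case .
  qed simp
  show ?thesis
    unfolding schwartz_def
  proof (intro CollectI conjI allI)
    fix n x
    show "(deriv ^^ n) (\<lambda>x. \<Sum>j. a j * G (x + k j)) differentiable (at x)"
      unfolding iter real_differentiable_def using D by (rule exI)
  next
    fix m n
    obtain C where C: "0 \<le> C" "\<And>x. \<bar>(deriv ^^ n) G x\<bar> \<le> C / (1 + \<bar>x\<bar>) ^ m"
      using schwartz_decay_deriv[OF G, of n m] by blast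
    have "\<bar>x ^ m * (\<Sum>j. a j * (deriv ^^ n) G (x + k j))\<bar> \<le> (\<Sum>j. a j * k j ^ m * C)" for x
    proof -
      have trm: "norm (x ^ m * (a j * (deriv ^^ n) G (x + k j))) \<le> a j * k j ^ m * C" for j
      proof -
        let ?z = "x + k j"
        have "\<bar>x\<bar> \<le> \<bar>?z\<bar> + k j" using k[of j] by linarith
        also have "\<dots> \<le> (1 + \<bar>?z\<bar>) * k j"
          using k[of j] mult_left_mono[of 1 "k j" "\<bar>?z\<bar>"] by (simp add: distrib_right)
        finally have "\<bar>x\<bar> ^ m \<le> ((1 + \<bar>?z\<bar>) * k j) ^ m" by (intro power_mono) auto
        then have "\<bar>x\<bar> ^ m * \<bar>(deriv ^^ n) G ?z\<bar> \<le> ((1 + \<bar>?z\<bar>) * k j) ^ m * (C / (1 + \<bar>?z\<bar>) ^ m)"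
          using C(2)[of ?z] k[of j] by (intro mult_mono) auto
        also have "\<dots> = k j ^ m * C"
        proof -
          have "(1 + \<bar>?z\<bar>) ^ m \<noteq> 0" by (simp add: add_nonneg_eq_0_iff)
          then show ?thesis by (simp add: power_mult_distrib)
        qed
        finally have "a j * (\<bar>x\<bar> ^ m * \<bar>(deriv ^^ n) G ?z\<bar>) \<le> a j * (k j ^ m * C)"
          using a[of j] by (rule mult_left_mono)
        then show ?thesis using a[of j] by (simp add: abs_mult power_abs mult_ac)
      qed
      have sC: "summable (\<lambda>j. a j * k j ^ m * C)" using sum[of m] by (rule summable_mult2)
      have "x ^ m * (\<Sum>j. a j * (deriv ^^ n) G (x + k j)) = (\<Sum>j. x ^ m * (a j * (deriv ^^ n) G (x + k j)))"
        by (rule suminf_mult[symmetric, OF smb])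
      also have "\<bar>\<dots>\<bar> \<le> (\<Sum>j. a j * k j ^ m * C)"
        using norm_suminf_le[OF trm sC] by simp
      finally show ?thesis .
    qed
    then show "bounded (range (\<lambda>x. x ^ m * (deriv ^^ n) (\<lambda>x. \<Sum>j. a j * G (x + k j)) x))"
      unfolding iter bounded_iff by auto
  qed
qed

lemma gauss_increment_nonneg: "u \<le> 0 \<Longrightarrow> 0 \<le> s \<Longrightarrow> gauss (u - s) \<le> gauss u"
  unfolding gauss_def by (simp add: abs_le_square_iff[symmetric])

text \<open>As \<open>u * s \<le> 0\<close> and \<open>s \<ge> 1\<close>, the square grows by at
  least 1, so \<open>gauss (u - s) \<le> exp (-1) * gauss u\<close>; the other factor
  \<open>exp (-1)\<close> is the minimum of \<open>gauss\<close> on \<open>[-1, 0]\<close>.\<close>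

lemma gauss_increment_lower:
  assumes "-1 \<le> u" "u \<le> 0" "1 \<le> s"
  shows "exp (-1) * (1 - exp (-1)) \<le> gauss u - gauss (u - s)"
proof -
  have "u * s \<le> 0" using assms by (intro mult_nonpos_nonneg) auto
  moreover have "1 \<le> s\<^sup>2" using assms by (simp add: one_le_power)
  moreover have "(u - s)\<^sup>2 = u\<^sup>2 - 2 * (u * s) + s\<^sup>2" by (simp add: power2_diff)
  ultimately have "u\<^sup>2 + 1 \<le> (u - s)\<^sup>2" by linarith
  then have "gauss (u - s) \<le> exp (-(u\<^sup>2 + 1))" unfolding gauss_def by simp
  also have "\<dots> = exp (-1) * gauss u" by (simp add: gauss_def exp_add[symmetric])
  finally have "gauss u - exp (-1) * gauss u \<le> gauss u - gauss (u - s)" by simp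
  moreover have "exp (-1) * (1 - exp (-1)) \<le> gauss u * (1 - exp (-1))"
  proof (rule mult_right_mono)
    have "u\<^sup>2 \<le> 1" using assms by (simp add: abs_square_le_1)
    then show "exp (-1) \<le> gauss u" unfolding gauss_def by simp
  qed simp
  ultimately show ?thesis by (simp add: algebra_simps)
qed

lemma gauss_increment_bound:
  assumes "0 < s"
  shows "\<bar>gauss u - gauss (u - s)\<bar> \<le> min s 2"
proof -
  have d: "\<bar>- 2 * z * gauss z\<bar> \<le> 1" for z
  proof -
    have "2 * \<bar>z\<bar> \<le> 1 + z\<^sup>2"
      using zero_le_power2[of "\<bar>z\<bar> - 1"] by (simp add: power2_diff)
    also have "\<dots> \<le> exp (z\<^sup>2)" by (rule exp_ge_add_one_self)
    finally show ?thesis by (simp add: abs_mult gauss_def exp_minus field_simps)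
  qed
  have "\<bar>gauss (u - s) - gauss u\<bar> \<le> 1 * min s 2"
    by (rule increment_le_min[where \<phi>' = "\<lambda>z. - 2 * z * gauss z", OF gauss_deriv _ d assms]) (simp add: gauss_def)
  then show ?thesis by (simp add: abs_minus_commute)
qed

section \<open>Mass on unit cells, and its polynomial growth at -infinity\<close>

definition cell_mass :: "(real \<Rightarrow> real) \<Rightarrow> nat \<Rightarrow> real" where
  "cell_mass f k = enn2real (\<integral>\<^sup>+y. ennreal \<bar>f y\<bar> * indicator {- real k - 1..- real k} y \<partial>lborel)"

lemma cell_mass_eq:
  assumes "linear_growth f"
  shows "(\<integral>\<^sup>+y. ennreal \<bar>f y\<bar> * indicator {- real k - 1..- real k} y \<partial>lborel) = ennreal (cell_mass f k)"
  using linear_growth_finite[OF assms, of "- real k - 1" "- real k"] by (simp add: cell_mass_def)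

lemma cell_mass_nonneg: "0 \<le> cell_mass f k"
  by (simp add: cell_mass_def)

lemma c_const_pos:
  fixes \<alpha> :: real
  assumes "0 < \<alpha>" "\<alpha> < 1"
  shows "0 < c_const \<alpha>"
  using assms by (simp add: c_const_def Gamma_real_pos)

text \<open>The sign is read off from \<open>frac_const\<close>, whose left-hand side is
  negative.\<close>

lemma Gamma_minus_neg:
  fixes \<alpha> :: real
  assumes "0 < \<alpha>" "\<alpha> < 1"
  shows "Gamma (-\<alpha>) < 0"
proof -
  have "- c_const \<alpha> * (2 * \<alpha> * ext_const \<alpha>) < 0"
    using c_const_pos[OF assms] ext_const_pos[OF assms(1)] assms by (simp add: mult_neg_pos)
  then show ?thesis unfolding frac_const[OF assms] by simp
qed

text \<open>
  On the unit interval around the centre of its j-th bump the function $\psi = \sum_j a_j G(\cdot + k_j)$ has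
  increasing summands for $i < j$ and negligible ones for $i > j$, so its left fractional derivative there
  is at least of the order of $a_j$.
\<close>

lemma frac_D_left_bump_lower_bound:
  fixes a k :: "nat \<Rightarrow> real"
  assumes \<alpha>: "0 < \<alpha>" "\<alpha> < 1" and a: "\<And>i. 0 \<le> a i" and k: "\<And>i. 1 \<le> k i" "incseq k"
    and sum: "\<And>m. summable (\<lambda>i. a i * k i ^ m)"
    and tail: "(\<Sum>i. a (i + Suc j)) \<le> T" and x: "x \<in> {- k j - 1..- k j}"
  shows "(a j * (exp (-1) * (1 - exp (-1)) * 2 powr (-1 - \<alpha>)) - T * mker_mass \<alpha>) / \<bar>Gamma (-\<alpha>)\<bar>
    \<le> frac_D_left \<alpha> (\<lambda>x. \<Sum>i. a i * gauss (x + k i)) x"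
proof -
  define \<psi> where "\<psi> x = (\<Sum>i. a i * gauss (x + k i))" for x
  have \<psi>S: "\<psi> \<in> schwartz"
    unfolding \<psi>_def by (rule schwartz_translate_sum[OF gauss_schwartz a k(1) sum])
  note [measurable] = schwartz_measurable[OF \<psi>S]
  define c\<^sub>0 where "c\<^sub>0 = exp (-1) * (1 - exp (-1 :: real))"
  have c0: "0 \<le> c\<^sub>0" by (simp add: c\<^sub>0_def)
  have sum0: "summable a" using sum[of 0] by simp
  have smb: "summable (\<lambda>i. a i * gauss (z + k i))" for z
  proof (rule summable_comparison_test)
    show "\<exists>N. \<forall>i\<ge>N. norm (a i * gauss (z + k i)) \<le> a i"
      using a by (auto simp: gauss_def abs_mult mult_left_le)
  qed (rule sum0)
  have T0: "0 \<le> T"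
    using tail suminf_nonneg[of "\<lambda>i. a (i + Suc j)"] a summable_ignore_initial_segment[OF sum0, of "Suc j"] by fastforce
  \<comment> \<open>The bumps with \<open>i \<le> j\<close> are centred at \<open>- k j\<close> or
    to the right of it, so their left increments at \<open>x\<close> are nonnegative, and the j-th
    one contributes at least \<open>a j * c\<^sub>0\<close> for steps in \<open>[1, 2]\<close>. The
    bumps with \<open>i > j\<close> may contribute with either sign and are estimated by their total
    weight \<open>T\<close>.\<close>
  have incr: "a j * c\<^sub>0 * indicator {1..2} s - T * min s 2 \<le> \<psi> x - \<psi> (x - s)" if s: "0 < s" for s
  proof -
    define d where "d i = a i * gauss (x + k i) - a i * gauss (x - s + k i)" for i
    have d_sm: "summable d" unfolding d_def by (intro summable_diff smb)
    have d_sum: "\<psi> x - \<psi> (x - s) = (\<Sum>i. d i)"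
      unfolding d_def \<psi>_def by (intro suminf_diff smb)
    have d_eq: "d i = a i * (gauss (x + k i) - gauss ((x + k i) - s))" for i
      by (simp add: d_def algebra_simps)
    have d_le: "0 \<le> d i" if "i \<le> j" for i
    proof -
      have "k i \<le> k j" using k(2) that by (auto dest: incseqD)
      then have "x + k i \<le> 0" using x by auto
      then show ?thesis unfolding d_eq using a[of i] gauss_increment_nonneg[of "x + k i" s] s by simp
    qed
    have d_j: "a j * c\<^sub>0 * indicator {1..2} s \<le> d j"
    proof (cases "s \<in> {1..2}")
      case True
      then have "c\<^sub>0 \<le> gauss (x + k j) - gauss ((x + k j) - s)"
        unfolding c\<^sub>0_def using x by (intro gauss_increment_lower) auto
      then show ?thesis unfolding d_eq using True a[of j] by (simp add: mult_left_mono)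
    qed (use d_le[of j] in simp)
    have "(\<Sum>i. d i) = (\<Sum>i. d (i + Suc j)) + (\<Sum>i<Suc j. d i)"
      by (rule suminf_split_initial_segment[OF d_sm])
    moreover have "a j * c\<^sub>0 * indicator {1..2} s \<le> (\<Sum>i<Suc j. d i)"
    proof -
      have "0 \<le> (\<Sum>i<j. d i)" by (intro sum_nonneg d_le) auto
      then show ?thesis using d_j by simp
    qed
    moreover have "- (T * min s 2) \<le> (\<Sum>i. d (i + Suc j))"
    proof -
      have "- (T * min s 2) \<le> - ((\<Sum>i. a (i + Suc j)) * min s 2)"
        using tail s by (simp add: mult_right_mono)
      also have "\<dots> = (\<Sum>i. - (a (i + Suc j) * min s 2))"
        using summable_ignore_initial_segment[OF sum0, of "Suc j"]
        by (subst suminf_minus) (auto simp: suminf_mult2 intro: summable_mult2)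
      also have "\<dots> \<le> (\<Sum>i. d (i + Suc j))"
      proof (rule suminf_le)
        show "- (a (i + Suc j) * min s 2) \<le> d (i + Suc j)" for i
        proof -
          have "- min s 2 \<le> gauss (x + k (i + Suc j)) - gauss ((x + k (i + Suc j)) - s)"
            using gauss_increment_bound[OF s, of "x + k (i + Suc j)"] by linarith
          from mult_left_mono[OF this a[of "i + Suc j"]] show ?thesis unfolding d_eq by simp
        qed
        show "summable (\<lambda>i. - (a (i + Suc j) * min s 2))"
          by (intro summable_minus summable_mult2 summable_ignore_initial_segment sum0)
        show "summable (\<lambda>i. d (i + Suc j))" by (rule summable_ignore_initial_segment[OF d_sm])
      qed
      finally show ?thesis .
    qed
    ultimately show ?thesis unfolding d_sum by linarith
  qed
  define \<kappa> where "\<kappa> s = indicator {0<..} s * s powr (-1 - \<alpha>)" for s :: real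
  have [measurable]: "\<kappa> \<in> borel_measurable borel" unfolding \<kappa>_def by measurable
  have int: "integrable lborel (\<lambda>s. \<kappa> s * (\<psi> x - \<psi> (x - s)))"
  proof (rule integrableI_bounded)
    have "(\<integral>\<^sup>+s. ennreal (norm (\<kappa> s * (\<psi> x - \<psi> (x - s)))) \<partial>lborel) = dpsi \<alpha> \<psi> x"
      unfolding dpsi_def
      by (intro nn_integral_cong) (simp add: \<kappa>_def abs_mult abs_minus_commute mult_ac)
    then show "(\<integral>\<^sup>+s. ennreal (norm (\<kappa> s * (\<psi> x - \<psi> (x - s)))) \<partial>lborel) < \<infinity>"
      using dpsi_finite[OF \<psi>S \<alpha>] by simp
  qed measurable
  let ?c = "a j * (c\<^sub>0 * 2 powr (-1 - \<alpha>))"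
  have "?c * 1 - T * mker_mass \<alpha> = (LINT s|lborel. ?c * indicator {1..2} s - T * mker \<alpha> s)"
    using integrable_mker[OF \<alpha>] by (simp add: mker_mass_def)
  also have "\<dots> \<le> (LINT s|lborel. \<kappa> s * (\<psi> x - \<psi> (x - s)))"
  proof (rule integral_mono)
    show "integrable lborel (\<lambda>s. ?c * indicator {1..2} s - T * mker \<alpha> s)"
      using integrable_mker[OF \<alpha>] by (intro Bochner_Integration.integrable_diff integrable_mult_right) auto
    show "?c * indicator {1..2} s - T * mker \<alpha> s \<le> \<kappa> s * (\<psi> x - \<psi> (x - s))" for s
    proof (cases "0 < s")
      case True
      have "?c * indicator {1..2} s \<le> \<kappa> s * (a j * c\<^sub>0 * indicator {1..2} s)"
      proof (cases "s \<in> {1..2}")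
        case in12: True
        \<comment> \<open>The steps in \<open>[1, 2]\<close> form an interval of length 1 on which
          the kernel is at least \<open>2 powr (-1 - \<alpha>)\<close>, the last factor of the
          constant.\<close>
        have "2 powr (-1 - \<alpha>) \<le> s powr (-1 - \<alpha>)" using in12 \<alpha> by (intro powr_mono2') auto
        then have "(a j * c\<^sub>0) * 2 powr (-1 - \<alpha>) \<le> (a j * c\<^sub>0) * s powr (-1 - \<alpha>)"
          using a[of j] c0 by (intro mult_left_mono) auto
        then show ?thesis using in12 True by (simp add: \<kappa>_def mult_ac)
      qed simp
      moreover have "T * mker \<alpha> s = \<kappa> s * (T * min s 2)" using True by (simp add: mker_def \<kappa>_def)
      moreover have "\<kappa> s * (a j * c\<^sub>0 * indicator {1..2} s - T * min s 2) \<le> \<kappa> s * (\<psi> x - \<psi> (x - s))"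
        using incr[OF True] True by (intro mult_left_mono) (auto simp: \<kappa>_def)
      ultimately show ?thesis
        using right_diff_distrib[of "\<kappa> s" "a j * c\<^sub>0 * indicator {1..2} s" "T * min s 2"] by linarith
    qed (simp add: mker_def \<kappa>_def)
  qed (rule int)
  finally have main: "?c - T * mker_mass \<alpha> \<le> (LINT s|lborel. \<kappa> s * (\<psi> x - \<psi> (x - s)))" by simp
  have "frac_D_left \<alpha> \<psi> x = 1 / Gamma (-\<alpha>) * (LINT s|lborel. \<kappa> s * (\<psi> (x - s) - \<psi> x))"
    unfolding \<kappa>_def by (rule frac_D_left_eq) measurable
  also have "(LINT s|lborel. \<kappa> s * (\<psi> (x - s) - \<psi> x)) = - (LINT s|lborel. \<kappa> s * (\<psi> x - \<psi> (x - s)))"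
    by (subst integral_minus[symmetric]) (simp add: algebra_simps)
  \<comment> \<open>\<open>Gamma (-\<alpha>)\<close> is negative, so the prefactor and the reversed
    increment change sign together.\<close>
  finally have "frac_D_left \<alpha> \<psi> x = (LINT s|lborel. \<kappa> s * (\<psi> x - \<psi> (x - s))) / \<bar>Gamma (-\<alpha>)\<bar>"
    using Gamma_minus_neg[OF \<alpha>] by simp
  moreover have "(?c - T * mker_mass \<alpha>) / \<bar>Gamma (-\<alpha>)\<bar> \<le> (LINT s|lborel. \<kappa> s * (\<psi> x - \<psi> (x - s))) / \<bar>Gamma (-\<alpha>)\<bar>"
    using main by (rule divide_right_mono) simp
  ultimately show ?thesis unfolding \<psi>_def c\<^sub>0_def by simp
qed

lemma cell_integral_tendsto_0:
  fixes k :: "nat \<Rightarrow> real" and h :: "real \<Rightarrow> real"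
  assumes h: "integrable lborel h" and k: "filterlim k at_top sequentially"
  shows "(\<lambda>j. LINT x|lborel. \<bar>h x\<bar> * indicator {- k j - 1..- k j} x) \<longlonglongrightarrow> 0"
proof -
  have "(\<lambda>j. LINT x|lborel. \<bar>h x\<bar> * indicator {- k j - 1..- k j} x) \<longlonglongrightarrow> integral\<^sup>L lborel (\<lambda>_::real. 0)"
  proof (rule integral_dominated_convergence[where w = "\<lambda>x. \<bar>h x\<bar>"])
    show "AE x in lborel. (\<lambda>j. \<bar>h x\<bar> * indicator {- k j - 1..- k j} x) \<longlonglongrightarrow> 0"
    proof (rule AE_I2)
      fix x
      have "\<forall>\<^sub>F j in sequentially. - x < k j"
        using k by (simp add: filterlim_at_top_dense)
      then have "\<forall>\<^sub>F j in sequentially. \<bar>h x\<bar> * indicator {- k j - 1..- k j} x = 0"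
        by eventually_elim auto
      then show "(\<lambda>j. \<bar>h x\<bar> * indicator {- k j - 1..- k j} x) \<longlonglongrightarrow> 0"
        by (rule tendsto_eventually)
    qed
  qed (use h in \<open>auto split: split_indicator\<close>)
  then show ?thesis by simp
qed

text \<open>Growth beyond every polynomial yields for each \<open>j\<close> an index with
  \<open>real k ^ j \<le> F k\<close>. Multiplying the polynomial by 1 plus the sum of
  \<open>F i\<close> over \<open>i < M\<close> forces this index to be at least \<open>M\<close>, so
  the indices can be made as sparse as desired.\<close>

lemma exists_sparse_sequence:
  fixes F :: "nat \<Rightarrow> real" and L :: nat
  assumes F0: "\<And>k. 0 \<le> F k" and unb: "\<And>N K. \<exists>k. K * (real k + 1) ^ N < F k"
  shows "\<exists>k::nat \<Rightarrow> nat. \<forall>j. 1 \<le> k j \<and> real (k j) ^ j \<le> F (k j) \<and> L * k j \<le> k (Suc j)"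
proof -
  have ex: "\<exists>k\<ge>M. real k ^ j \<le> F k" for M j :: nat
  proof -
    obtain k where k: "(1 + (\<Sum>i<M. F i)) * (real k + 1) ^ j < F k" using unb by blast
    define S where "S = (\<Sum>i<M. F i)"
    have s0: "0 \<le> S" unfolding S_def by (intro sum_nonneg F0)
    define Q where "Q = (1 + S) * (real k + 1) ^ j"
    have kQ: "Q < F k" using k by (simp add: Q_def S_def)
    have p1: "1 \<le> (real k + 1) ^ j" by (intro one_le_power) auto
    have "1 * (real k + 1) ^ j \<le> Q"
      unfolding Q_def using s0 by (intro mult_right_mono) auto
    moreover have "real k ^ j \<le> (real k + 1) ^ j" by (intro power_mono) auto
    ultimately have "real k ^ j \<le> F k" using kQ by linarith
    moreover have "M \<le> k"
    proof (rule ccontr)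
      assume "\<not> M \<le> k"
      then have "F k \<le> S" unfolding S_def using F0 by (intro member_le_sum) auto
      moreover have "(1 + S) * 1 \<le> Q"
        unfolding Q_def using s0 p1 by (intro mult_left_mono) auto
      ultimately have "1 + S \<le> Q" "F k \<le> S" by simp_all
      with kQ have "1 + S < S" by (meson le_less_trans less_le_trans)
      then show False by simp
    qed
    ultimately show ?thesis by blast
  qed
  have "\<exists>k. \<forall>j. (1 \<le> k j \<and> real (k j) ^ j \<le> F (k j)) \<and> L * k j \<le> k (Suc j)"
  proof (rule dependent_nat_choice)
    show "\<exists>k. 1 \<le> k \<and> real k ^ 0 \<le> F k" using ex[of 1 0] by blast
    fix k :: nat and j
    show "\<exists>k'. (1 \<le> k' \<and> real k' ^ Suc j \<le> F k') \<and> L * k \<le> k'"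
      using ex[of "max 1 (L * k)" "Suc j"] by auto
  qed
  then show ?thesis by blast
qed

text \<open>Otherwise there are sparse cells with mass at least \<open>k j ^ j\<close>. The weights
  \<open>a j = 1 / k j ^ j\<close> beat every fixed power of \<open>k j\<close>, so the sum of
  translates is a Schwartz function, while weight times mass stays at least 1. On each of these
  cells \<open>\<bar>f\<bar>\<close> integrated against the fractional derivative gives at least a
  fixed \<open>\<gamma>\<close>, which contradicts integrability.\<close>

lemma cell_mass_polynomial:
  assumes f: "linear_growth f" and \<alpha>: "0 < \<alpha>" "\<alpha> < 1"
    and int: "\<And>\<phi>. \<phi> \<in> schwartz \<Longrightarrow> integrable lborel (\<lambda>x. f x * frac_D_left \<alpha> \<phi> x)"
  shows "\<exists>N K. \<forall>k. cell_mass f k \<le> K * (real k + 1) ^ N"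
proof (rule ccontr)
  assume "\<not> ?thesis"
  then have unb: "\<exists>k. K * (real k + 1) ^ N < cell_mass f k" for N K by (metis not_le)
  note [measurable] = linear_growth_measurable[OF f]
  define c\<^sub>1 where "c\<^sub>1 = exp (-1) * (1 - exp (-1)) * 2 powr (-1 - \<alpha>)"
  have c1: "0 < c\<^sub>1" by (simp add: c\<^sub>1_def)
  \<comment> \<open>\<open>L\<close> is the ratio of sparsity. The weights beyond \<open>j\<close>
    sum up to at most \<open>2 * a j / L\<close>, and
    \<open>L \<ge> 4 * mker_mass \<alpha> / c\<^sub>1\<close> makes their effect at most half of the
    main term \<open>a j * c\<^sub>1\<close>.\<close>
  obtain L0 :: nat where L0: "4 * mker_mass \<alpha> / c\<^sub>1 \<le> real L0" using real_arch_simple by blast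
  define L where "L = max 2 L0"
  have L: "2 \<le> L" "4 * mker_mass \<alpha> / c\<^sub>1 \<le> real L" using L0 by (auto simp: L_def)
  obtain \<kappa> :: "nat \<Rightarrow> nat" where \<kappa>: "\<And>j. 1 \<le> \<kappa> j" "\<And>j. real (\<kappa> j) ^ j \<le> cell_mass f (\<kappa> j)" "\<And>j. L * \<kappa> j \<le> \<kappa> (Suc j)"
    using exists_sparse_sequence[OF cell_mass_nonneg unb, of L] by blast
  define k where "k j = real (\<kappa> j)" for j
  have k1: "1 \<le> k j" for j using \<kappa>(1)[of j] by (simp add: k_def)
  have kL: "real L * k j \<le> k (Suc j)" for j
    using \<kappa>(3)[of j] unfolding k_def by (metis of_nat_le_iff of_nat_mult)
  have k_inc: "incseq k"
  proof (rule incseq_SucI)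
    fix j
    have "1 * k j \<le> real L * k j" using L(1) k1[of j] by (intro mult_right_mono) auto
    then show "k j \<le> k (Suc j)" using kL[of j] by simp
  qed
  have k_pow: "2 ^ j \<le> k j" for j
  proof (induction j)
    case (Suc j)
    have "2 ^ Suc j \<le> 2 * k j" using Suc by simp
    also have "\<dots> \<le> real L * k j" using L(1) k1[of j] by (intro mult_right_mono) auto
    finally show ?case using kL[of j] by simp
  qed (use k1[of 0] in simp)
  have k_top: "filterlim k at_top sequentially"
  proof (rule filterlim_at_top_mono)
    show "filterlim real at_top sequentially" by (rule filterlim_real_sequentially)
    show "\<forall>\<^sub>F j in sequentially. real j \<le> k j"
    proof (rule always_eventually, rule allI)
      fix j
      have "real j < 2 ^ j" by (rule of_nat_less_two_power)
      then show "real j \<le> k j" using k_pow[of j] by linarith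
    qed
  qed
  define a where "a j = 1 / k j ^ j" for j
  have a0: "0 \<le> a j" for j using k1[of j] by (simp add: a_def)
  have a_Suc: "a (Suc j) \<le> a j / real L" for j
  proof -
    have "real L * k j ^ j \<le> k (Suc j) * k (Suc j) ^ j"
    proof (rule mult_mono)
      have "real L * 1 \<le> real L * k j" using k1[of j] by (intro mult_left_mono) auto
      then show "real L \<le> k (Suc j)" using kL[of j] by simp
      show "k j ^ j \<le> k (Suc j) ^ j" using k_inc k1[of j] by (intro power_mono) (auto dest: incseq_SucD)
    qed (use k1[of j] k1[of "Suc j"] in auto)
    then show ?thesis
      unfolding a_def using k1[of j] L(1) by (simp add: frac_le mult.commute)
  qed
  have a_geo: "a (i + j) \<le> a j * (1 / real L) ^ i" for i j
  proof (induction i)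
    case (Suc i)
    have "a (Suc i + j) \<le> a (i + j) / real L" using a_Suc[of "i + j"] by simp
    also have "\<dots> \<le> a j * (1 / real L) ^ i / real L" using Suc by (rule divide_right_mono) simp
    finally show ?case by simp
  qed simp
  have summ: "summable (\<lambda>j. a j * k j ^ m)" for m
  proof (rule summable_comparison_test_ev)
    show "summable (\<lambda>j. (1 / 2 :: real) ^ j)" by (rule summable_geometric) simp
    show "\<forall>\<^sub>F j in sequentially. norm (a j * k j ^ m) \<le> (1 / 2) ^ j"
      using eventually_ge_at_top[of "Suc m"]
    proof eventually_elim
      case (elim j)
      have "k j ^ m * 2 ^ j \<le> k j ^ m * k j" using k_pow[of j] k1[of j] by (intro mult_left_mono) auto
      also have "\<dots> = k j ^ Suc m" by simp
      also have "\<dots> \<le> k j ^ j" using elim k1[of j] by (intro power_increasing) auto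
      finally have "k j ^ m / k j ^ j \<le> 1 / 2 ^ j" using k1[of j] by (simp add: field_simps)
      then show ?case using k1[of j] by (simp add: a_def power_one_over)
    qed
  qed
  have sum0: "summable a" using summ[of 0] by simp
  \<comment> \<open>Each weight is at most \<open>1 / L\<close> times its predecessor; the geometric
    series contributes \<open>1 / (1 - 1 / L)\<close>, which is at most 2 as
    \<open>L \<ge> 2\<close>.\<close>
  have tail: "(\<Sum>i. a (i + Suc j)) \<le> 2 * a j / real L" for j
  proof -
    have q: "norm (1 / real L) < 1" using L(1) by simp
    have "(\<Sum>i. a (i + Suc j)) \<le> (\<Sum>i. a j / real L * (1 / real L) ^ i)"
    proof (rule suminf_le)
      show "a (i + Suc j) \<le> a j / real L * (1 / real L) ^ i" for i
        using a_geo[of i "Suc j"] mult_right_mono[OF a_Suc[of j], of "(1 / real L) ^ i"] by simp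
      show "summable (\<lambda>i. a (i + Suc j))" by (rule summable_ignore_initial_segment[OF sum0])
      show "summable (\<lambda>i. a j / real L * (1 / real L) ^ i)"
        by (intro summable_mult summable_geometric q)
    qed
    also have "\<dots> = a j / real L * (1 / (1 - 1 / real L))"
      using q by (subst suminf_mult) (auto intro: summable_geometric simp: suminf_geometric)
    also have "\<dots> \<le> a j / real L * 2"
    proof (rule mult_left_mono)
      have "1 / real L \<le> 1 / 2" using L(1) by (intro divide_left_mono) auto
      then show "1 / (1 - 1 / real L) \<le> 2" by (simp add: divide_le_eq)
    qed (use a0[of j] in simp)
    finally show ?thesis by (simp add: mult.commute)
  qed
  define \<psi> where "\<psi> x = (\<Sum>i. a i * gauss (x + k i))" for x
  have \<psi>S: "\<psi> \<in> schwartz"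
    unfolding \<psi>_def by (rule schwartz_translate_sum[OF gauss_schwartz a0 k1 summ])
  \<comment> \<open>The half of the main term that survives, divided by the normalisation of the
    fractional derivative, with \<open>a j\<close> split off.\<close>
  define \<gamma> where "\<gamma> = c\<^sub>1 / (2 * \<bar>Gamma (-\<alpha>)\<bar>)"
  have \<gamma>: "0 < \<gamma>" unfolding \<gamma>_def using c1 Gamma_minus_neg[OF \<alpha>] by (intro divide_pos_pos) auto
  have low: "\<gamma> * a j \<le> \<bar>frac_D_left \<alpha> \<psi> x\<bar>" if x: "x \<in> {- k j - 1..- k j}" for x j
  proof -
    have "2 * a j / real L * mker_mass \<alpha> \<le> a j * c\<^sub>1 / 2"
    proof -
      have "4 * mker_mass \<alpha> \<le> real L * c\<^sub>1" using L(2) c1 by (simp add: divide_le_eq)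
      then have "a j * (4 * mker_mass \<alpha>) \<le> a j * (real L * c\<^sub>1)" using a0[of j] by (rule mult_left_mono)
      then have "a j * (4 * mker_mass \<alpha>) / (2 * real L) \<le> a j * (real L * c\<^sub>1) / (2 * real L)"
        by (rule divide_right_mono) simp
      then show ?thesis using L(1) by (simp add: mult_ac)
    qed
    then have "a j * c\<^sub>1 / 2 \<le> a j * c\<^sub>1 - 2 * a j / real L * mker_mass \<alpha>" by linarith
    then have "a j * c\<^sub>1 / 2 / \<bar>Gamma (-\<alpha>)\<bar> \<le> (a j * c\<^sub>1 - 2 * a j / real L * mker_mass \<alpha>) / \<bar>Gamma (-\<alpha>)\<bar>"
      by (rule divide_right_mono) simp
    also have "\<dots> \<le> frac_D_left \<alpha> \<psi> x"
      unfolding c\<^sub>1_def \<psi>_def by (rule frac_D_left_bump_lower_bound[OF \<alpha> a0 k1 k_inc summ tail x])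
    finally show ?thesis by (simp add: \<gamma>_def mult_ac)
  qed
  define h where "h x = f x * frac_D_left \<alpha> \<psi> x" for x
  have h: "integrable lborel h" unfolding h_def by (rule int[OF \<psi>S])
  have "\<gamma> \<le> (LINT x|lborel. \<bar>h x\<bar> * indicator {- k j - 1..- k j} x)" for j
  proof -
    have "a j * cell_mass f (\<kappa> j) \<ge> 1"
      using \<kappa>(2)[of j] k1[of j] by (simp add: a_def k_def)
    then have "\<gamma> * 1 \<le> \<gamma> * (a j * cell_mass f (\<kappa> j))" using \<gamma> by (intro mult_left_mono) auto
    then have "ennreal \<gamma> \<le> ennreal (\<gamma> * a j) * ennreal (cell_mass f (\<kappa> j))"
      using \<gamma> a0[of j] by (subst ennreal_mult'[symmetric]) (auto intro!: ennreal_leI simp: mult.assoc)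
    also have "\<dots> = (\<integral>\<^sup>+x. ennreal (\<gamma> * a j) * (ennreal \<bar>f x\<bar> * indicator {- k j - 1..- k j} x) \<partial>lborel)"
      unfolding cell_mass_eq[OF f, symmetric] k_def by (rule nn_integral_cmult[symmetric]) measurable
    also have "\<dots> \<le> (\<integral>\<^sup>+x. ennreal (\<bar>h x\<bar> * indicator {- k j - 1..- k j} x) \<partial>lborel)"
    proof (rule nn_integral_mono)
      fix x
      show "ennreal (\<gamma> * a j) * (ennreal \<bar>f x\<bar> * indicator {- k j - 1..- k j} x) \<le> ennreal (\<bar>h x\<bar> * indicator {- k j - 1..- k j} x)"
      proof (cases "x \<in> {- k j - 1..- k j}")
        case True
        have "(\<gamma> * a j) * \<bar>f x\<bar> \<le> \<bar>frac_D_left \<alpha> \<psi> x\<bar> * \<bar>f x\<bar>" using low[OF True] by (rule mult_right_mono) simp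
        then have "ennreal ((\<gamma> * a j) * \<bar>f x\<bar>) \<le> ennreal \<bar>h x\<bar>" by (intro ennreal_leI) (simp add: h_def abs_mult mult.commute)
        then show ?thesis using True \<gamma> a0[of j] by (simp add: ennreal_mult')
      qed simp
    qed
    also have "\<dots> = ennreal (LINT x|lborel. \<bar>h x\<bar> * indicator {- k j - 1..- k j} x)"
      using integrable_real_mult_indicator[of "{- k j - 1..- k j}" lborel "\<lambda>x. \<bar>h x\<bar>"] h
      by (intro nn_integral_eq_integral) auto
    finally show ?thesis
      by (subst (asm) ennreal_le_iff) (auto intro!: integral_nonneg_AE)
  qed
  moreover have "\<forall>\<^sub>F j in sequentially. (LINT x|lborel. \<bar>h x\<bar> * indicator {- k j - 1..- k j} x) < \<gamma>"
    using order_tendstoD(2)[OF cell_integral_tendsto_0[OF h k_top] \<gamma>] .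
  ultimately show False by (auto simp: eventually_sequentially not_less[symmetric])
qed

lemma nn_integral_dpsi_schwartz:
  assumes f: "linear_growth f" and \<alpha>: "0 < \<alpha>" "\<alpha> < 1" and \<phi>: "\<phi> \<in> schwartz"
    and int: "\<And>\<phi>. \<phi> \<in> schwartz \<Longrightarrow> integrable lborel (\<lambda>x. f x * frac_D_left \<alpha> \<phi> x)"
  shows "(\<integral>\<^sup>+y. ennreal \<bar>f y\<bar> * (dpsi \<alpha> \<phi> y + ennreal \<bar>\<phi> y\<bar>) \<partial>lborel) < \<infinity>"
proof -
  note [measurable] = linear_growth_measurable[OF f] schwartz_measurable[OF \<phi>]
  obtain N K where NK: "\<And>k. cell_mass f k \<le> K * (real k + 1) ^ N"
    using cell_mass_polynomial[OF f \<alpha> int] by blast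
  have K: "0 \<le> K" using NK[of 0] cell_mass_nonneg[of f 0] by simp
  \<comment> \<open>Of the decay of order \<open>N + 2\<close>, the part \<open>N\<close>
    compensates the growth of the cell masses and the 2 makes the sum over the cells
    converge.\<close>
  obtain M where M: "0 \<le> M" "\<And>y. y \<le> 0 \<Longrightarrow> dpsi \<alpha> \<phi> y + ennreal \<bar>\<phi> y\<bar> \<le> ennreal (M / (1 + \<bar>y\<bar>) ^ (N + 2))"
    using dpsi_le_left[OF \<phi> \<alpha>, of "N + 2"] by blast
  show ?thesis
  proof (rule nn_integral_split_at_0)
    let ?g = "\<lambda>k y. ennreal (M / (1 + real k) ^ (N + 2)) * (ennreal \<bar>f y\<bar> * indicator {- real k - 1..- real k} y)"
    have "(\<integral>\<^sup>+y. ennreal \<bar>f y\<bar> * (dpsi \<alpha> \<phi> y + ennreal \<bar>\<phi> y\<bar>) * indicator {..0} y \<partial>lborel)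
      \<le> (\<integral>\<^sup>+y. (\<Sum>k. ?g k y) \<partial>lborel)"
    proof (rule nn_integral_mono)
      fix y :: real
      show "ennreal \<bar>f y\<bar> * (dpsi \<alpha> \<phi> y + ennreal \<bar>\<phi> y\<bar>) * indicator {..0} y \<le> (\<Sum>k. ?g k y)"
      proof (cases "y \<le> 0")
        case True
        define k where "k = nat \<lfloor>- y\<rfloor>"
        have k: "real k \<le> - y" "- y < real k + 1" using True unfolding k_def by linarith+
        have "ennreal \<bar>f y\<bar> * (dpsi \<alpha> \<phi> y + ennreal \<bar>\<phi> y\<bar>) \<le> ennreal \<bar>f y\<bar> * ennreal (M / (1 + \<bar>y\<bar>) ^ (N + 2))"
          using M(2)[OF True] by (rule mult_left_mono) simp
        also have "\<dots> \<le> ennreal \<bar>f y\<bar> * ennreal (M / (1 + real k) ^ (N + 2))"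
          using k True M(1) by (intro mult_left_mono ennreal_leI divide_left_mono power_mono mult_pos_pos zero_less_power) auto
        also have "\<dots> = ?g k y" using k by (simp add: mult.commute)
        also have "\<dots> = (\<Sum>k\<in>{k}. ?g k y)" by simp
        also have "\<dots> \<le> (\<Sum>k. ?g k y)" by (intro sum_le_suminf) auto
        finally show ?thesis using True by simp
      qed simp
    qed
    also have "\<dots> = (\<Sum>k. \<integral>\<^sup>+y. ?g k y \<partial>lborel)"
      by (rule nn_integral_suminf) measurable
    also have "\<dots> = (\<Sum>k. ennreal (M / (1 + real k) ^ (N + 2) * cell_mass f k))"
    proof (rule arg_cong[where f = suminf], rule ext)
      fix k
      have "(\<integral>\<^sup>+y. ?g k y \<partial>lborel) = ennreal (M / (1 + real k) ^ (N + 2)) * ennreal (cell_mass f k)"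
        unfolding cell_mass_eq[OF f, symmetric] by (rule nn_integral_cmult) measurable
      moreover have "0 \<le> M / (1 + real k) ^ (N + 2)" using M(1) by simp
      ultimately show "(\<integral>\<^sup>+y. ?g k y \<partial>lborel) = ennreal (M / (1 + real k) ^ (N + 2) * cell_mass f k)"
        by (simp only: ennreal_mult')
    qed
    also have "\<dots> \<le> (\<Sum>k. ennreal (M * K * inverse (real (Suc k) ^ 2)))"
    proof (rule suminf_le)
      fix k
      have "M / (1 + real k) ^ (N + 2) * cell_mass f k \<le> M / (1 + real k) ^ (N + 2) * (K * (real k + 1) ^ N)"
        using NK[of k] M(1) by (intro mult_left_mono) auto
      also have "\<dots> = M * K * inverse (real (Suc k) ^ 2)"
      proof -
        define P where "P = 1 + real k"
        have "P \<noteq> 0" by (simp add: P_def)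
        then have "M / P ^ (N + 2) * (K * P ^ N) = M * K * inverse (P ^ 2)"
          by (simp add: power_add power2_eq_square field_simps)
        then show ?thesis by (simp only: P_def of_nat_Suc add.commute)
      qed
      finally show "ennreal (M / (1 + real k) ^ (N + 2) * cell_mass f k) \<le> ennreal (M * K * inverse (real (Suc k) ^ 2))"
        by (rule ennreal_leI)
    qed auto
    also have "\<dots> < \<infinity>"
    proof -
      have "summable (\<lambda>k. inverse (real (Suc k) ^ 2))"
        using inverse_power_summable[of 2, where 'a = real] by (subst summable_Suc_iff) simp
      then have "summable (\<lambda>k. M * K * inverse (real (Suc k) ^ 2))" by (rule summable_mult)
      then show ?thesis
        using M(1) K by (subst suminf_ennreal2) auto
    qed
    finally show "(\<integral>\<^sup>+y. ennreal \<bar>f y\<bar> * (dpsi \<alpha> \<phi> y + ennreal \<bar>\<phi> y\<bar>) * indicator {..0} y \<partial>lborel) < \<infinity>" .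
  qed (use nn_integral_dpsi_right[OF f \<phi> \<alpha>] in auto)
qed

section \<open>Reduction to Borel functions\<close>

lemma AE_lborel_translate:
  fixes x :: real
  assumes "AE y in lborel. P y"
  shows "AE s in lborel. P (x + s)"
proof -
  obtain N where N: "N \<in> null_sets lborel" "{y. \<not> P y} \<subseteq> N"
    using assms by (auto elim!: AE_E simp: null_sets_def)
  have [measurable]: "N \<in> sets borel" using N(1) by (auto dest: null_setsD2)
  have "AE y in lborel. y \<notin> N" using N(1) by (rule AE_not_in)
  then have "AE s in lborel. x + 1 * s \<notin> N"
    by (intro AE_borel_affine) auto
  then show ?thesis by eventually_elim (use N(2) in auto)
qed

lemma AE_extension_integrand_eq:
  assumes "AE y in lborel. f y = g y"
  shows "AE s in lebesgue. indicat_real {0<..} s *\<^sub>R extension_integrand \<alpha> f x t s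
    = indicat_real {0<..} s *\<^sub>R extension_integrand \<alpha> g x t s"
proof -
  have "AE s in lborel. f (x + s) = g (x + s)" by (rule AE_lborel_translate[OF assms])
  then have "AE s in lborel. indicat_real {0<..} s *\<^sub>R extension_integrand \<alpha> f x t s
    = indicat_real {0<..} s *\<^sub>R extension_integrand \<alpha> g x t s"
    by eventually_elim (simp add: extension_integrand_def)
  then show ?thesis by (rule AE_completion)
qed

lemma measurable_lebesgue_translate:
  fixes f :: "real \<Rightarrow> real"
  assumes "f \<in> borel_measurable lebesgue"
  shows "(\<lambda>s. f (x + s)) \<in> borel_measurable lebesgue"
proof -
  have "(\<lambda>s. x + (\<Sum>j\<in>Basis. (1 * (s \<bullet> j)) *\<^sub>R j)) \<in> lebesgue \<rightarrow>\<^sub>M (lebesgue :: real measure)"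
    by (rule lebesgue_affine_measurable) simp
  then have "(\<lambda>s. x + s) \<in> lebesgue \<rightarrow>\<^sub>M (lebesgue :: real measure)" by simp
  from measurable_compose[OF this assms] show ?thesis .
qed

lemma extension_integrand_measurable_lebesgue:
  assumes "f \<in> borel_measurable lebesgue"
  shows "(\<lambda>s. indicat_real {0<..} s *\<^sub>R extension_integrand \<alpha> f x t s) \<in> borel_measurable lebesgue"
proof -
  note [measurable] = measurable_lebesgue_translate[OF assms, of x]
  have [measurable]: "(\<lambda>s. indicat_real {0<..} s * exp (- (t\<^sup>2 / (4 * s))) / s powr (1 + \<alpha>)) \<in> borel_measurable lebesgue"
    by (rule measurable_completion) measurable
  have "(\<lambda>s. (indicat_real {0<..} s * exp (- (t\<^sup>2 / (4 * s))) / s powr (1 + \<alpha>)) * f (x + s)) \<in> borel_measurable lebesgue"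
    by measurable
  moreover have "(\<lambda>s. (indicat_real {0<..} s * exp (- (t\<^sup>2 / (4 * s))) / s powr (1 + \<alpha>)) * f (x + s))
    = (\<lambda>s. indicat_real {0<..} s *\<^sub>R extension_integrand \<alpha> f x t s)"
    by (auto simp: extension_integrand_def)
  ultimately show ?thesis by simp
qed

text \<open>For fixed \<open>x\<close> a translate of a null set is a null set, so the integrals
  agree at every \<open>x\<close> and \<open>t\<close>. Pointwise statements on the extension may
  therefore be proved for a Borel version of \<open>f\<close>.\<close>

lemma extension_cong_AE:
  assumes "f \<in> borel_measurable lebesgue" "g \<in> borel_measurable lebesgue" "AE y in lborel. f y = g y"
  shows "extension \<alpha> f = extension \<alpha> g"
    and "set_integrable lebesgue {0<..} (extension_integrand \<alpha> f x t) \<longleftrightarrow>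
      set_integrable lebesgue {0<..} (extension_integrand \<alpha> g x t)"
proof -
  note m = extension_integrand_measurable_lebesgue[OF assms(1)] extension_integrand_measurable_lebesgue[OF assms(2)]
  show "extension \<alpha> f = extension \<alpha> g"
    unfolding extension_def set_lebesgue_integral_def
    by (intro ext arg_cong2[where f = times] refl integral_cong_AE m AE_extension_integrand_eq assms(3))
  show "set_integrable lebesgue {0<..} (extension_integrand \<alpha> f x t) \<longleftrightarrow>
      set_integrable lebesgue {0<..} (extension_integrand \<alpha> g x t)"
    unfolding set_integrable_def
    by (intro integrable_cong_AE m AE_extension_integrand_eq assms(3))
qed

lemma frac_D_left_measurable:
  assumes [measurable]: "\<phi> \<in> borel_measurable borel"
  shows "frac_D_left \<alpha> \<phi> \<in> borel_measurable borel"
  unfolding frac_D_left_eq[OF assms, abs_def] by measurable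

lemma lebesgue_mult_cong_AE:
  fixes f g h :: "real \<Rightarrow> real"
  assumes f: "f \<in> borel_measurable lebesgue" and [measurable]: "g \<in> borel_measurable borel" "h \<in> borel_measurable borel"
    and eq: "AE y in lborel. f y = g y"
  shows "integrable lebesgue (\<lambda>x. f x * h x) \<longleftrightarrow> integrable lborel (\<lambda>x. g x * h x)"
    and "(LINT x|lebesgue. f x * h x) = (LINT x|lborel. g x * h x)"
proof -
  have [measurable]: "g \<in> borel_measurable lebesgue" "h \<in> borel_measurable lebesgue" "f \<in> borel_measurable lebesgue"
    using f by (auto intro: measurable_completion)
  have ae: "AE x in lebesgue. f x * h x = g x * h x"
    by (rule AE_completion) (use eq in eventually_elim, simp)
  have "integrable lebesgue (\<lambda>x. f x * h x) \<longleftrightarrow> integrable lebesgue (\<lambda>x. g x * h x)"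
    by (rule integrable_cong_AE) (use ae in \<open>auto intro: borel_measurable_times\<close>)
  then show "integrable lebesgue (\<lambda>x. f x * h x) \<longleftrightarrow> integrable lborel (\<lambda>x. g x * h x)"
    by (simp add: integrable_completion)
  have "(LINT x|lebesgue. f x * h x) = (LINT x|lebesgue. g x * h x)"
    by (rule integral_cong_AE) (use ae in \<open>auto intro: borel_measurable_times\<close>)
  then show "(LINT x|lebesgue. f x * h x) = (LINT x|lborel. g x * h x)"
    by (simp add: integral_completion)
qed

text \<open>Common to both classes of test functions, which differ only in the way the finiteness
  \<open>fin\<close> is obtained.\<close>

lemma distributional_limit_extension:
  assumes fm: "f \<in> borel_measurable lebesgue" and g: "linear_growth g" and eq: "AE y in lborel. f y = g y"
    and \<alpha>: "0 < \<alpha>" "\<alpha> < 1" and T: "T \<subseteq> schwartz"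
    and fin: "\<And>\<phi>. \<phi> \<in> T \<Longrightarrow> (\<integral>\<^sup>+y. ennreal \<bar>g y\<bar> * (dpsi \<alpha> \<phi> y + ennreal \<bar>\<phi> y\<bar>) \<partial>lborel) < \<infinity>"
  shows "distributional_limit T \<alpha> (c_const \<alpha>) (extension \<alpha> f) f"
proof -
  note gm [measurable] = linear_growth_measurable[OF g]
  let ?W = "\<lambda>t x. t powr (1 - 2 * \<alpha>) * deriv (\<lambda>\<tau>. extension \<alpha> g x \<tau>) t"
  have "g \<in> borel_measurable lebesgue" by (rule measurable_completion) measurable
  then have ext: "extension \<alpha> f = extension \<alpha> g"
    using fm eq by (intro extension_cong_AE(1))
  have T': "\<phi> \<in> schwartz" if "\<phi> \<in> T" for \<phi> using T that by blast
  note single = distributional_limit_single[OF g \<alpha> schwartz_measurable[OF T'] dpsi_finite[OF T' \<alpha>] fin]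
  have flux_m: "(\<lambda>x. ?W t x * \<phi> x) \<in> borel_measurable borel"
    if "0 < t" "\<phi> \<in> T" for t \<phi>
  proof -
    have [measurable]: "\<phi> \<in> borel_measurable borel" using T that by (auto intro: schwartz_measurable)
    show ?thesis unfolding flux_eq_conv[OF g \<alpha>(1) that(1)] by measurable
  qed
  have frac: "integrable lebesgue (\<lambda>x. f x * frac_D_left \<alpha> \<phi> x)"
    "frac_D_right \<alpha> f \<phi> = (LINT x|lborel. g x * frac_D_left \<alpha> \<phi> x)" if \<phi>: "\<phi> \<in> T" for \<phi>
  proof -
    have \<phi>': "\<phi> \<in> schwartz" using T \<phi> by blast
    have m: "frac_D_left \<alpha> \<phi> \<in> borel_measurable borel" by (rule frac_D_left_measurable[OF schwartz_measurable[OF \<phi>']])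
    show "integrable lebesgue (\<lambda>x. f x * frac_D_left \<alpha> \<phi> x)"
      unfolding lebesgue_mult_cong_AE(1)[OF fm gm m eq] by (rule single(1)[OF \<phi> \<phi> \<phi>])
    show "frac_D_right \<alpha> f \<phi> = (LINT x|lborel. g x * frac_D_left \<alpha> \<phi> x)"
      unfolding frac_D_right_def by (rule lebesgue_mult_cong_AE(2)[OF fm gm m eq])
  qed
  have flux: "integrable lebesgue (\<lambda>x. ?W t x * \<phi> x)"
    "(LINT x|lebesgue. ?W t x * \<phi> x)
      = (LINT x|lborel. ?W t x * \<phi> x)"
    if t: "0 < t" and \<phi>: "\<phi> \<in> T" for t \<phi>
  proof -
    have m: "(\<lambda>x. ?W t x * \<phi> x) \<in> borel_measurable lborel"
      unfolding measurable_lborel2 by (rule flux_m[OF t \<phi>])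
    show "integrable lebesgue (\<lambda>x. ?W t x * \<phi> x)"
      using integrable_completion[OF m] single(2)[OF \<phi> \<phi> \<phi> t] by (rule iffD2)
    show "(LINT x|lebesgue. ?W t x * \<phi> x)
      = (LINT x|lborel. ?W t x * \<phi> x)"
      using m by (rule integral_completion)
  qed
  have lim: "((\<lambda>t. - c_const \<alpha> * (LINT x|lebesgue. ?W t x * \<phi> x))
      \<longlongrightarrow> frac_D_right \<alpha> f \<phi>) (at_right 0)" if \<phi>: "\<phi> \<in> T" for \<phi>
    unfolding frac(2)[OF \<phi>]
  proof (rule Lim_transform_eventually[OF single(3)[OF \<phi> \<phi> \<phi>]])
    show "\<forall>\<^sub>F t in at_right 0. - c_const \<alpha> * (LINT x|lborel. ?W t x * \<phi> x)
      = - c_const \<alpha> * (LINT x|lebesgue. ?W t x * \<phi> x)"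
      using eventually_at_right_less[of 0] by eventually_elim (simp only: flux(2) \<phi>)
  qed
  have def: "frac_D_right_defined_on T \<alpha> f"
    unfolding frac_D_right_defined_on_def using frac(1) by (rule ballI)
  show ?thesis
    unfolding distributional_limit_def ext using def flux(1) lim by (intro conjI ballI allI impI)
qed

context Ap_weight
begin

lemma integrable_weighted_iff:
  assumes w': "w' \<in> borel_measurable lebesgue" "AE x in lborel. w' x = w x"
    and f: "f \<in> borel_measurable lebesgue" "g \<in> borel_measurable borel" "AE x in lborel. f x = g x"
  shows "integrable lebesgue (\<lambda>x. \<bar>f x\<bar> powr p * w' x) \<longleftrightarrow> Lp_mass g < \<infinity>"
    and "(LINT x|lebesgue. \<bar>f x\<bar> powr p * w' x) = enn2real (Lp_mass g)"
proof -
  have [measurable]: "w' \<in> borel_measurable lebesgue" "f \<in> borel_measurable lebesgue" "g \<in> borel_measurable borel"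
    using w' f by auto
  have gl [measurable]: "(\<lambda>x. \<bar>g x\<bar> powr p * w x) \<in> borel_measurable lebesgue"
    by (rule measurable_completion) measurable
  have fl: "(\<lambda>x. \<bar>f x\<bar> powr p * w' x) \<in> borel_measurable lebesgue"
    by measurable
  have ae: "AE x in lebesgue. \<bar>f x\<bar> powr p * w' x = \<bar>g x\<bar> powr p * w x"
    by (rule AE_completion) (use w'(2) f(3) in eventually_elim, simp)
  have "integrable lebesgue (\<lambda>x. \<bar>f x\<bar> powr p * w' x) \<longleftrightarrow> integrable lebesgue (\<lambda>x. \<bar>g x\<bar> powr p * w x)"
    using fl gl ae by (rule integrable_cong_AE)
  also have "\<dots> \<longleftrightarrow> integrable lborel (\<lambda>x. \<bar>g x\<bar> powr p * w x)"
    by (rule integrable_completion) measurable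
  also have "\<dots> \<longleftrightarrow> Lp_mass g < \<infinity>"
    using integrable_if_Lp_mass_finite[OF f(2)] Lp_mass_eq_integral[of g] by auto
  finally show "integrable lebesgue (\<lambda>x. \<bar>f x\<bar> powr p * w' x) \<longleftrightarrow> Lp_mass g < \<infinity>" .
  have "(LINT x|lebesgue. \<bar>f x\<bar> powr p * w' x) = (LINT x|lebesgue. \<bar>g x\<bar> powr p * w x)"
    using fl gl ae by (rule integral_cong_AE)
  also have "\<dots> = (LINT x|lborel. \<bar>g x\<bar> powr p * w x)"
    by (rule integral_completion) measurable
  also have "\<dots> = enn2real (Lp_mass g)"
    unfolding Lp_mass_def using w_pos by (intro integral_eq_nn_integral) (auto simp: less_imp_le)
  finally show "(LINT x|lebesgue. \<bar>f x\<bar> powr p * w' x) = enn2real (Lp_mass g)" .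
qed

end

lemma Borel_weight_version:
  assumes "weight w"
  shows "\<exists>w'\<in>borel_measurable borel. (\<forall>x. 0 < w' x) \<and> (AE x in lborel. w x = w' x)"
proof -
  obtain v where v: "v \<in> borel_measurable lborel" "AE x in lborel. w x = v x"
    using completion_ex_borel_measurable_real[of w lborel] assms by (auto simp: weight_def)
  have [measurable]: "v \<in> borel_measurable borel" using v(1) by simp
  \<comment> \<open>A Borel version may fail to be positive on a null set; there it is replaced by
    1, as positivity is wanted at every point.\<close>
  show ?thesis
  proof (intro bexI[of _ "\<lambda>x. if 0 < v x then v x else 1"] conjI allI)
    show "AE x in lborel. w x = (if 0 < v x then v x else 1)"
      using v(2)
    proof eventually_elim
      case (elim x)
      moreover have "0 < w x" using assms unfolding weight_def by blast
      ultimately show ?case by simp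
    qed
  qed auto
qed

theorem theorem1p3:
  fixes \<alpha> p :: real and w f :: "real \<Rightarrow> real"
  assumes "0 < \<alpha>" "\<alpha> < 1" and "1 < p"
    and "Ap_plus p w"
    and "f \<in> Lp_weighted p w"
  shows "(\<forall>x t. t > 0 \<longrightarrow> set_integrable lebesgue {0<..} (extension_integrand \<alpha> f x t)) \<and>
    classical_solution \<alpha> (extension \<alpha> f) \<and>
    (AE x in lebesgue. ((\<lambda>t. extension \<alpha> f x t) \<longlongrightarrow> f x) (at_right 0)) \<and>
    (\<forall>t>0. (\<lambda>x. extension \<alpha> f x t) \<in> Lp_weighted p w) \<and>
    ((\<lambda>t. Lp_weighted_norm p w (\<lambda>x. extension \<alpha> f x t - f x)) \<longlongrightarrow> 0) (at_right 0) \<and>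
    c_const \<alpha> > 0 \<and>
    distributional_limit schwartz_left_bounded \<alpha> (c_const \<alpha>) (extension \<alpha> f) f \<and>
    (frac_D_right_defined_on schwartz \<alpha> f \<longrightarrow>
       distributional_limit schwartz \<alpha> (c_const \<alpha>) (extension \<alpha> f) f)"
proof -
  have fm: "f \<in> borel_measurable lebesgue" and f_int: "integrable lebesgue (\<lambda>x. \<bar>f x\<bar> powr p * w x)"
    using assms(5) by (auto simp: Lp_weighted_def)
  have weight: "weight w" using assms(4) by (simp add: Ap_plus_def)
  then have wm: "w \<in> borel_measurable lebesgue" by (simp add: weight_def)
  obtain w' where w': "w' \<in> borel_measurable borel" "\<And>x. 0 < w' x" "AE x in lborel. w x = w' x"
    using Borel_weight_version[OF weight] by blast
  obtain C where C: "Ap_weight p C w'"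
    by (rule Ap_plus_imp_Ap_weight[OF assms(3,4) w'])
  interpret Ap_weight p C w' by (rule C)
  obtain g where g: "g \<in> borel_measurable borel" "AE x in lborel. f x = g x"
    using completion_ex_borel_measurable_real[OF fm] by auto
  have g_fin: "Lp_mass g < \<infinity>"
    using f_int integrable_weighted_iff(1)[OF wm w'(3) fm g] by simp
  have gl: "linear_growth g" using g(1) g_fin by (rule linear_growth_if_Lp)
  have gm: "g \<in> borel_measurable lebesgue" using g(1) by (auto intro: measurable_completion)
  have ext: "extension \<alpha> f = extension \<alpha> g" by (rule extension_cong_AE(1)[OF fm gm g(2)])
  have U_meas: "(\<lambda>x. extension \<alpha> g x t) \<in> borel_measurable borel" if "0 < t" for t
    by (rule borel_measurable_extension[OF gl assms(1) that])
  obtain D where D: "\<And>t. 0 < t \<Longrightarrow> Lp_mass (\<lambda>x. extension \<alpha> (\<lambda>x. \<bar>g x\<bar>) x t) \<le> ennreal D * Lp_mass g"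
    using Lp_mass_extension_bound[OF assms(1)] gl by blast
  show ?thesis
  proof (intro conjI allI impI)
    fix x t :: real assume t: "0 < t"
    show "set_integrable lebesgue {0<..} (extension_integrand \<alpha> f x t)"
      using set_integrable_extension_integrand[OF gl assms(1) t] extension_cong_AE(2)[OF fm gm g(2)] by simp
  next
    show "classical_solution \<alpha> (extension \<alpha> f)"
      unfolding ext by (rule classical_solution_extension[OF gl assms(1)])
  next
    have "AE x in lebesgue. f x = g x" using g(2) by (rule AE_completion)
    with extension_tendsto_AE[OF gl assms(1)]
    show "AE x in lebesgue. ((\<lambda>t. extension \<alpha> f x t) \<longlongrightarrow> f x) (at_right 0)"
      unfolding ext by eventually_elim simp
  next
    fix t :: real assume t: "0 < t"
    have "Lp_mass (\<lambda>x. extension \<alpha> g x t) \<le> Lp_mass (\<lambda>x. extension \<alpha> (\<lambda>x. \<bar>g x\<bar>) x t)"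
      by (rule Lp_mass_mono) (rule order_trans[OF abs_extension_le[OF gl assms(1)] abs_ge_self])
    also have "\<dots> \<le> ennreal D * Lp_mass g" by (rule D[OF t])
    also have "\<dots> < \<infinity>" using g_fin by (simp add: ennreal_mult_less_top)
    finally have "Lp_mass (\<lambda>x. extension \<alpha> g x t) < \<infinity>" .
    moreover have Um: "(\<lambda>x. extension \<alpha> g x t) \<in> borel_measurable lebesgue"
      using U_meas[OF t] by (auto intro: measurable_completion)
    ultimately show "(\<lambda>x. extension \<alpha> f x t) \<in> Lp_weighted p w"
      unfolding ext Lp_weighted_def
      using integrable_weighted_iff(1)[OF wm w'(3) Um U_meas[OF t]] by auto
  next
    have "((\<lambda>t. Lp_mass (\<lambda>x. extension \<alpha> g x t - g x)) \<longlongrightarrow> 0) (at_right 0)"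
      by (rule extension_Lp_tendsto[OF g(1) g_fin assms(1)])
    \<comment> \<open>The limit is taken in \<open>ennreal\<close> first, where infinite masses
      cause no harm, and carried over to the norm by continuity of \<open>enn2real\<close> at the
      finite value 0.\<close>
    then have "((\<lambda>t. enn2real (Lp_mass (\<lambda>x. extension \<alpha> g x t - g x))) \<longlongrightarrow> 0) (at_right 0)"
      by (intro tendsto_enn2real) simp_all
    then have lim: "((\<lambda>t. enn2real (Lp_mass (\<lambda>x. extension \<alpha> g x t - g x)) powr (1 / p)) \<longlongrightarrow> 0 powr (1 / p)) (at_right 0)"
      using assms(3) by (intro tendsto_powr' tendsto_const) auto
    have ev: "\<forall>\<^sub>F t in at_right 0. enn2real (Lp_mass (\<lambda>x. extension \<alpha> g x t - g x)) powr (1 / p)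
        = Lp_weighted_norm p w (\<lambda>x. extension \<alpha> f x t - f x)"
      using eventually_at_right_less[of 0]
    proof eventually_elim
      case (elim t)
      have Um: "(\<lambda>x. extension \<alpha> g x t) \<in> borel_measurable lebesgue"
        using U_meas[OF elim] by (auto intro: measurable_completion)
      have "(LINT x|lebesgue. \<bar>extension \<alpha> g x t - f x\<bar> powr p * w x) = enn2real (Lp_mass (\<lambda>x. extension \<alpha> g x t - g x))"
      proof (rule integrable_weighted_iff(2)[OF wm w'(3)])
        show "(\<lambda>x. extension \<alpha> g x t - f x) \<in> borel_measurable lebesgue" using Um fm by (rule borel_measurable_diff)
        show "(\<lambda>x. extension \<alpha> g x t - g x) \<in> borel_measurable borel" using U_meas[OF elim] g(1) by (rule borel_measurable_diff)
        show "AE x in lborel. extension \<alpha> g x t - f x = extension \<alpha> g x t - g x"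
          using g(2) by eventually_elim simp
      qed
      then show ?case unfolding Lp_weighted_norm_def ext by simp
    qed
    show "((\<lambda>t. Lp_weighted_norm p w (\<lambda>x. extension \<alpha> f x t - f x)) \<longlongrightarrow> 0) (at_right 0)"
      using Lim_transform_eventually[OF lim ev] by (simp only: powr_0)
  next
    show "c_const \<alpha> > 0" by (rule c_const_pos[OF assms(1,2)])
  next
    show "distributional_limit schwartz_left_bounded \<alpha> (c_const \<alpha>) (extension \<alpha> f) f"
    proof (rule distributional_limit_extension[OF fm gl g(2) assms(1,2)])
      show "schwartz_left_bounded \<subseteq> schwartz" by (auto simp: schwartz_left_bounded_def)
    qed (rule nn_integral_dpsi_left_bounded[OF gl _ assms(1,2)])
  next
    assume def: "frac_D_right_defined_on schwartz \<alpha> f"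
    \<comment> \<open>Convergence is required for all Schwartz functions at once: the growth of
      \<open>f\<close> is tested with a specially built function, not with the given
      \<open>\<phi>\<close>.\<close>
    have int: "integrable lborel (\<lambda>x. g x * frac_D_left \<alpha> \<phi> x)" if "\<phi> \<in> schwartz" for \<phi>
    proof -
      have "integrable lebesgue (\<lambda>x. f x * frac_D_left \<alpha> \<phi> x)"
        using def that unfolding frac_D_right_defined_on_def by blast
      with lebesgue_mult_cong_AE(1)[OF fm g(1) frac_D_left_measurable[OF schwartz_measurable[OF that]] g(2)]
      show ?thesis by (rule iffD1)
    qed
    show "distributional_limit schwartz \<alpha> (c_const \<alpha>) (extension \<alpha> f) f"
      by (rule distributional_limit_extension[OF fm gl g(2) assms(1,2) order_refl])
        (rule nn_integral_dpsi_schwartz[OF gl assms(1,2) _ int])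
  qed
qed

end
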